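(* Let $\kappa$ be a field, and let $R'/R$ be a rectangular numerical semigroup algebra whose minimal monomials are $\mathbf{u}^{s_1},\mathbf{u}^{s_2},\mathbf{u}^{s_3},\mathbf{u}^{s_4}$. If $R=\kappa[\![\mathbf{u}^s]\!]$ for some $s$ in the semigroup generated by $s_1,s_2,s_3,s_4$, then $R'/R$ is a complete intersection.
   Context: A numerical semigroup is a monoid $S$ (under addition) generated by finitely many (at least one) positive rational numbers. The numerical semigroup ring $\kappa[\![\mathbf{u}^S]\!]$ consists of all power series $\sum_{s\in S}a_s\mathbf{u}^s$ with $a_s\in\kappa$; the elements $\mathbf{u}^s$ ($s\in S$) are its monomials. If $S$ is generated by a single positive rational number $s$, the ring is written $\kappa[\![\mathbf{u}^s]\!]$. For numerical semigroups $S\subset S'$, put $R=\kappa[\![\mathbf{u}^S]\!]$ and $R'=\kappa[\![\mathbf{u}^{S'}]\!]$; then $R'$ is an $R$-algebra via inclusion, denoted $R'/R$ and called a numerical semigroup algebra. A monomial $p$ of $R'$ is an Apéry monomial of $R'/R$ if, whenever $p=p_1p_2$ with $p_1$ a monomial of $R$ and $p_2$ a monomial of $R'$, then $p_1=1$. An Apéry monomial $p\neq 1$ is a minimal monomial if, whenever $p=p_1p_2$ with $p_1,p_2$ monomials of $R'$, one of $p_1,p_2$ equals $p$. Let $\mathbf{u}^{s_1},\ldots,\mathbf{u}^{s_n}$ be the (distinct) minimal monomials of $R'/R$; then $S'$ is generated by $S$ together with $s_1,\ldots,s_n$. The set of Apéry monomials is called a rectangle of size $\beta_1\times\cdots\times\beta_n$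 (for positive integers $\beta_i$) if every Apéry monomial can be written uniquely as $(\mathbf{u}^{s_1})^{\ell_1}\cdots(\mathbf{u}^{s_n})^{\ell_n}$ with integers $0\le\ell_i<\beta_i$, and every monomial $(\mathbf{u}^{s_1})^{\ell_1}\cdots(\mathbf{u}^{s_n})^{\ell_n}$ with $0\le\ell_i<\beta_i$ is Apéry. The algebra is rectangular if its Apéry monomials form a rectangle of some size. A numerical semigroup algebra $R'/R$ is a complete intersection if $R'$ is a flat $R$-module and there is a surjective local $R$-algebra homomorphism $R[\![Y_1,\ldots,Y_m]\!]\to R'$ (for some $m$) whose kernel can be generated by $m$ elements. *)

theory Defs
  imports "HOL-Algebra.Module" "HOL-Algebra.RingHom" "HOL-Algebra.Free_Abelian_Groups"
begin

section \<open>Power series with exponents in a commutative monoid\<close>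

text \<open>
  \<open>power_series R A\<close> is the ring of all formal series \<open>\<Sum>a\<in>A. f a * u^a\<close>, where \<open>A\<close> is a
  submonoid of the additive monoid of the exponent type in which every element is a sum of two
  elements in only finitely many ways. A series is its coefficient function, extended by \<open>\<zero>\<close>
  outside \<open>A\<close>, so that for \<open>A \<subseteq> B\<close> the inclusion of \<open>power_series R A\<close> into
  \<open>power_series R B\<close> is the identity on coefficient functions. The scalar multiplication makes
  it an \<open>R\<close>-algebra.
\<close>

definition power_series ::
  "('r, 'b) ring_scheme \<Rightarrow> 'e::comm_monoid_add set \<Rightarrow> ('r, 'e \<Rightarrow> 'r) module" where
  "power_series R A =
    \<lparr>carrier = {f. (\<forall>a\<in>A. f a \<in> carrier R) \<and> (\<forall>a. a \<notin> A \<longrightarrow> f a = \<zero>\<^bsub>R\<^esub>)},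
     monoid.mult = (\<lambda>f g a. \<Oplus>\<^bsub>R\<^esub>p\<in>{p \<in> A \<times> A. fst p + snd p = a}. f (fst p) \<otimes>\<^bsub>R\<^esub> g (snd p)),
     monoid.one = (\<lambda>a. if a = 0 then \<one>\<^bsub>R\<^esub> else \<zero>\<^bsub>R\<^esub>),
     ring.zero = (\<lambda>a. \<zero>\<^bsub>R\<^esub>),
     ring.add = (\<lambda>f g a. f a \<oplus>\<^bsub>R\<^esub> g a),
     smult = (\<lambda>r f a. r \<otimes>\<^bsub>R\<^esub> f a)\<rparr>"

definition ps_monom :: "('r, 'b) ring_scheme \<Rightarrow> 'e \<Rightarrow> 'e \<Rightarrow> 'r" where
  "ps_monom R a = (\<lambda>b. if b = a then \<one>\<^bsub>R\<^esub> else \<zero>\<^bsub>R\<^esub>)"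

text \<open>The ring \<open>R[[Y\<^sub>0, \<dots>, Y\<^sub>m\<^sub>-\<^sub>1]]\<close>: exponents are the finitely supported functions
  on \<open>nat\<close> with support in \<open>{..<m}\<close>.\<close>

definition multi_power_series ::
  "('r, 'b) ring_scheme \<Rightarrow> nat \<Rightarrow> ('r, (nat \<Rightarrow>\<^sub>0 nat) \<Rightarrow> 'r) module" where
  "multi_power_series R m = power_series R {e. Poly_Mapping.keys e \<subseteq> {..<m}}"


section \<open>Flat modules\<close>

text \<open>The underlying abelian group of the tensor product \<open>N \<otimes>\<^sub>R M\<close>, as the free abelian
  group on pairs modulo the bilinearity relations.\<close>

definition tensor_relations ::
  "('r, 'b) ring_scheme \<Rightarrow> ('r, 'n, 'c) module_scheme \<Rightarrow> ('r, 'm, 'd) module_scheme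
     \<Rightarrow> ('n \<times> 'm \<Rightarrow>\<^sub>0 int) set" where
  "tensor_relations R N M =
     {frag_of (x \<oplus>\<^bsub>N\<^esub> y, z) - frag_of (x, z) - frag_of (y, z) | x y z.
        x \<in> carrier N \<and> y \<in> carrier N \<and> z \<in> carrier M} \<union>
     {frag_of (x, y \<oplus>\<^bsub>M\<^esub> z) - frag_of (x, y) - frag_of (x, z) | x y z.
        x \<in> carrier N \<and> y \<in> carrier M \<and> z \<in> carrier M} \<union>
     {frag_of (r \<odot>\<^bsub>N\<^esub> x, z) - frag_of (x, r \<odot>\<^bsub>M\<^esub> z) | r x z.
        r \<in> carrier R \<and> x \<in> carrier N \<and> z \<in> carrier M}"

definition tensor_subgroup ::
  "('r, 'b) ring_scheme \<Rightarrow> ('r, 'n, 'c) module_scheme \<Rightarrow> ('r, 'm, 'd) module_scheme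
     \<Rightarrow> ('n \<times> 'm \<Rightarrow>\<^sub>0 int) set" where
  "tensor_subgroup R N M =
     generate (free_Abelian_group (carrier N \<times> carrier M)) (tensor_relations R N M)"

definition tensor_product ::
  "('r, 'b) ring_scheme \<Rightarrow> ('r, 'n, 'c) module_scheme \<Rightarrow> ('r, 'm, 'd) module_scheme
     \<Rightarrow> ('n \<times> 'm \<Rightarrow>\<^sub>0 int) set monoid" where
  "tensor_product R N M =
     free_Abelian_group (carrier N \<times> carrier M) Mod tensor_subgroup R N M"

text \<open>For an \<open>R\<close>-linear \<open>f : N \<rightarrow> P\<close>, the map \<open>f \<otimes> id : N \<otimes>\<^sub>R M \<rightarrow> P \<otimes>\<^sub>R M\<close>, sending the
  coset of \<open>x\<close> to the coset of the image of \<open>x\<close>; all members of a coset \<open>C\<close> have the same image,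
  so the union is over equal cosets.\<close>

definition tensor_map ::
  "('r, 'b) ring_scheme \<Rightarrow> ('r, 'p, 'c) module_scheme \<Rightarrow> ('r, 'm, 'd) module_scheme
     \<Rightarrow> ('n \<Rightarrow> 'p) \<Rightarrow> ('n \<times> 'm \<Rightarrow>\<^sub>0 int) set \<Rightarrow> ('p \<times> 'm \<Rightarrow>\<^sub>0 int) set" where
  "tensor_map R P M f C =
     (\<Union>x\<in>C. tensor_subgroup R P M #>\<^bsub>free_Abelian_group (carrier P \<times> carrier M)\<^esub>
               frag_extend (\<lambda>(n, z). frag_of (f n, z)) x)"

definition linear_maps ::
  "('r, 'b) ring_scheme \<Rightarrow> ('r, 'n, 'c) module_scheme \<Rightarrow> ('r, 'p, 'd) module_scheme
     \<Rightarrow> ('n \<Rightarrow> 'p) set" where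
  "linear_maps R N P =
     {f \<in> carrier N \<rightarrow> carrier P.
        (\<forall>x\<in>carrier N. \<forall>y\<in>carrier N. f (x \<oplus>\<^bsub>N\<^esub> y) = f x \<oplus>\<^bsub>P\<^esub> f y) \<and>
        (\<forall>r\<in>carrier R. \<forall>x\<in>carrier N. f (r \<odot>\<^bsub>N\<^esub> x) = r \<odot>\<^bsub>P\<^esub> f x)}"

text \<open>
  \<open>M\<close> is flat if tensoring with \<open>M\<close> preserves injectivity of linear maps between arbitrary
  \<open>R\<close>-modules. HOL cannot quantify over types inside a formula, so the types carrying the test
  modules are parameters. A theorem that concludes flatness with these parameters as type
  variables asserts it for test modules of all types.
\<close>

definition flat_module ::
  "'n itself \<Rightarrow> 'p itself \<Rightarrow> ('r, 'b) ring_scheme \<Rightarrow> ('r, 'm, 'd) module_scheme \<Rightarrow> bool" where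
  "flat_module _ _ R M \<longleftrightarrow>
     module R M \<and>
     (\<forall>(N :: ('r, 'n) module) (P :: ('r, 'p) module) f.
        module R N \<and> module R P \<and> f \<in> linear_maps R N P \<and> inj_on f (carrier N) \<longrightarrow>
        inj_on (tensor_map R P M f) (carrier (tensor_product R N M)))"


section \<open>Complete intersections\<close>

definition local_ring :: "('a, 'b) ring_scheme \<Rightarrow> bool" where
  "local_ring A \<longleftrightarrow> cring A \<and> (\<exists>!I. maximalideal I A)"

definition local_ring_hom ::
  "('a, 'b) ring_scheme \<Rightarrow> ('c, 'd) ring_scheme \<Rightarrow> ('a \<Rightarrow> 'c) \<Rightarrow> bool" where
  "local_ring_hom A B h \<longleftrightarrow>
     local_ring A \<and> local_ring B \<and> h \<in> ring_hom A B \<and>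
     (\<forall>I J. maximalideal I A \<longrightarrow> maximalideal J B \<longrightarrow> h ` I \<subseteq> J)"

definition complete_intersection ::
  "'n itself \<Rightarrow> 'p itself \<Rightarrow> ('r, 'b) ring_scheme \<Rightarrow> ('r, 'a, 'd) module_scheme \<Rightarrow> bool" where
  "complete_intersection TN TP R A \<longleftrightarrow>
     flat_module TN TP R A \<and>
     (\<exists>m h. local_ring_hom (multi_power_series R m) A h \<and>
        h \<in> linear_maps R (multi_power_series R m) A \<and>
        h ` carrier (multi_power_series R m) = carrier A \<and>
        (\<exists>g :: nat \<Rightarrow> _.
           (\<forall>i<m. g i \<in> carrier (multi_power_series R m)) \<and>
           a_kernel (multi_power_series R m) A h =
             Idl\<^bsub>multi_power_series R m\<^esub> (g ` {..<m})))"


section \<open>Numerical semigroups and their algebras\<close>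

inductive_set monoid_span :: "'a::comm_monoid_add set \<Rightarrow> 'a set" for G where
  zero: "0 \<in> monoid_span G"
| add: "g \<in> G \<Longrightarrow> x \<in> monoid_span G \<Longrightarrow> g + x \<in> monoid_span G"

definition numerical_semigroup :: "rat set \<Rightarrow> bool" where
  "numerical_semigroup S \<longleftrightarrow>
     (\<exists>G. finite G \<and> G \<noteq> {} \<and> (\<forall>g\<in>G. 0 < g) \<and> S = monoid_span G)"

text \<open>The numerical semigroup ring \<open>\<kappa>[[u^S]]\<close> is \<open>power_series K S\<close>. For \<open>S \<subseteq> S'\<close>,
  \<open>semigroup_algebra K S'\<close> is \<open>\<kappa>[[u^S']]\<close> as an algebra over its subring \<open>\<kappa>[[u^S]]\<close>:
  the scalar multiplication is the multiplication of \<open>\<kappa>[[u^S']]\<close>. The record does not depend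
  on \<open>S\<close>; the base ring \<open>power_series K S\<close> is passed separately, as usual for \<open>module R M\<close>.\<close>

definition semigroup_algebra ::
  "('k, 'b) ring_scheme \<Rightarrow> rat set \<Rightarrow> (rat \<Rightarrow> 'k, rat \<Rightarrow> 'k) module" where
  "semigroup_algebra K S' =
    \<lparr>carrier = carrier (power_series K S'),
     monoid.mult = monoid.mult (power_series K S'),
     monoid.one = monoid.one (power_series K S'),
     ring.zero = ring.zero (power_series K S'),
     ring.add = ring.add (power_series K S'),
     smult = monoid.mult (power_series K S')\<rparr>"

definition monomials :: "('k, 'b) ring_scheme \<Rightarrow> rat set \<Rightarrow> (rat \<Rightarrow> 'k) set" where
  "monomials K S = ps_monom K ` S"

definition apery_monomials ::
  "('k, 'b) ring_scheme \<Rightarrow> rat set \<Rightarrow> rat set \<Rightarrow> (rat \<Rightarrow> 'k) set" where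
  "apery_monomials K S S' =
     {p \<in> monomials K S'. \<forall>p1\<in>monomials K S. \<forall>p2\<in>monomials K S'.
        p = p1 \<otimes>\<^bsub>power_series K S'\<^esub> p2 \<longrightarrow> p1 = \<one>\<^bsub>power_series K S'\<^esub>}"

definition minimal_monomials ::
  "('k, 'b) ring_scheme \<Rightarrow> rat set \<Rightarrow> rat set \<Rightarrow> (rat \<Rightarrow> 'k) set" where
  "minimal_monomials K S S' =
     {p \<in> apery_monomials K S S'. p \<noteq> \<one>\<^bsub>power_series K S'\<^esub> \<and>
        (\<forall>p1\<in>monomials K S'. \<forall>p2\<in>monomials K S'.
           p = p1 \<otimes>\<^bsub>power_series K S'\<^esub> p2 \<longrightarrow> p1 = p \<or> p2 = p)}"

text \<open>The Apery monomials form a rectangle of size \<open>\<beta> 0 \<times> \<dots> \<times> \<beta> (n - 1)\<close>, with respect to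
  the enumeration \<open>s 0, \<dots>, s (n - 1)\<close> of the exponents of the minimal monomials. Exponent
  vectors are taken in \<open>\<Pi>\<^sub>E\<close> so that they are determined by their values on \<open>{..<n}\<close>.\<close>

definition apery_rectangle ::
  "('k, 'b) ring_scheme \<Rightarrow> rat set \<Rightarrow> rat set \<Rightarrow> nat \<Rightarrow> (nat \<Rightarrow> rat) \<Rightarrow> (nat \<Rightarrow> nat) \<Rightarrow> bool"
where
  "apery_rectangle K S S' n s \<beta> \<longleftrightarrow>
     inj_on s {..<n} \<and>
     (\<lambda>i. ps_monom K (s i)) ` {..<n} = minimal_monomials K S S' \<and>
     (\<forall>i<n. 0 < \<beta> i) \<and>
     (\<forall>p\<in>apery_monomials K S S'. \<exists>!l. l \<in> (\<Pi>\<^sub>E i\<in>{..<n}. {..<\<beta> i}) \<and>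
        p = (\<Otimes>\<^bsub>power_series K S'\<^esub>i\<in>{..<n}. ps_monom K (s i) [^]\<^bsub>power_series K S'\<^esub> l i)) \<and>
     (\<forall>l\<in>(\<Pi>\<^sub>E i\<in>{..<n}. {..<\<beta> i}).
        (\<Otimes>\<^bsub>power_series K S'\<^esub>i\<in>{..<n}. ps_monom K (s i) [^]\<^bsub>power_series K S'\<^esub> l i)
          \<in> apery_monomials K S S')"

definition rectangular :: "('k, 'b) ring_scheme \<Rightarrow> rat set \<Rightarrow> rat set \<Rightarrow> bool" where
  "rectangular K S S' \<longleftrightarrow> (\<exists>n s \<beta>. apery_rectangle K S S' n s \<beta>)"

end

theory Submission
  imports Defs "HOL-Library.FuncSet" HOL.Complex
begin

text \<open>
  Let \<open>s\<^sub>i\<close> be the exponents of the minimal monomials and \<open>\<beta>\<^sub>i\<close> the side lengths of the rectangle.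
  The Apery exponents represent the classes of \<open>S'\<close> modulo \<open>s\<close> uniquely, so \<open>R'\<close> is free of finite
  rank over \<open>R\<close>, hence flat, and the rectangle is a factorization of a cyclic group. Summing the
  faithful character \<open>t \<mapsto> exp (2 \<pi> i t / s)\<close> over the rectangle gives zero, and the sum is a product
  of geometric sums, so for some \<open>i\<close> the multiple \<open>\<beta>\<^sub>i s\<^sub>i\<close> lies in the subgroup generated by \<open>s\<close>.
  Adjoining \<open>s\<^sub>i\<close> to this subgroup, which stays cyclic, and repeating the argument orders the
  \<open>s\<^sub>i\<close> such that each \<open>\<beta>\<^sub>i s\<^sub>i\<close> is, modulo \<open>s\<close>, a combination of earlier ones. The relations
  \<open>Y\<^sub>i^\<beta>\<^sub>i = u^k Y^l\<close> read off from this triangular system rewrite every monomial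
  of \<open>R[[Y]]\<close> to a unique normal form in the rectangle, and therefore generate the kernel
  of \<open>Y\<^sub>i \<mapsto> u^s\<^sub>i\<close>.
\<close>


section \<open>Rings of formal power series\<close>

text \<open>Rewriting treats one monomial at a time, whereas a kernel element is an infinite series.
  The grading in which \<open>u^q\<close> has degree \<open>q\<close> and \<open>Y_i\<close> has
  degree \<open>\<sigma> i\<close> bridges the gap. All \<open>\<sigma> i\<close> are positive, so
  each degree contains only finitely many monomials, and each relation is homogeneous, of degree
  \<open>\<beta> i * \<sigma> i\<close>. A kernel element is therefore written as a combination of
  the relations degree by degree, and the coefficients found for different degrees occupy different
  places of one series, so they glue.

  One use of the character finds a single generator. For the others the subgroup has to grow, and it
  has to stay cyclic so that some character has exactly this subgroup as its kernel. The resulting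
  order matters for termination: substituting for \<open>Y_j^(\<beta> j)\<close> introduces earlier
  variables only.

  Since flatness is defined by explicit tensor products, freeness enters through a dual basis: the
  coordinate functions separate tensors and are natural in the test module.\<close>

lemma (in abelian_monoid) finsum_Sigma:
  assumes "finite I" and "\<And>i. i \<in> I \<Longrightarrow> finite (A i)"
    and "\<And>i x. i \<in> I \<Longrightarrow> x \<in> A i \<Longrightarrow> g (i, x) \<in> carrier G"
  shows "(\<Oplus>p\<in>Sigma I A. g p) = (\<Oplus>i\<in>I. \<Oplus>x\<in>A i. g (i, x))"
proof -
  have "(\<Oplus>p\<in>(\<Union>i\<in>I. Pair i ` A i). g p) = (\<Oplus>i\<in>I. \<Oplus>p\<in>Pair i ` A i. g p)"
    using assms by (intro add.finprod_UN_disjoint) (auto simp: pairwise_def disjnt_def)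
  also have "\<dots> = (\<Oplus>i\<in>I. \<Oplus>x\<in>A i. g (i, x))"
    using assms by (intro finsum_cong' refl finsum_reindex) (auto simp: inj_on_def)
  also have "(\<Union>i\<in>I. Pair i ` A i) = Sigma I A"
    by auto
  finally show ?thesis .
qed

lemma (in abelian_monoid) finsum_bij_betw:
  assumes "bij_betw b X Y" and "\<And>y. y \<in> Y \<Longrightarrow> g y \<in> carrier G"
    and "\<And>x. x \<in> X \<Longrightarrow> f x = g (b x)"
  shows "finsum G f X = finsum G g Y"
proof -
  have "finsum G g (b ` X) = (\<Oplus>x\<in>X. g (b x))"
    using assms by (intro finsum_reindex) (auto simp: bij_betw_def)
  also have "\<dots> = finsum G f X"
    using assms by (intro finsum_cong') (auto simp: bij_betw_def)
  finally show ?thesis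
    using assms by (simp add: bij_betw_def)
qed

lemma (in abelian_monoid) finsum_delta:
  assumes "finite I" and "i \<in> I \<Longrightarrow> x \<in> carrier G"
  shows "(\<Oplus>j\<in>I. if j = i then x else \<zero>) = (if i \<in> I then x else \<zero>)"
proof (cases "i \<in> I")
  case True
  then have "(\<Oplus>j\<in>I. if i = j then x else \<zero>) = x"
    using assms by (intro add.finprod_singleton) auto
  then show ?thesis
    using True by (simp add: eq_commute[of i] cong: if_cong)
next
  case False
  then have "(\<Oplus>j\<in>I. if j = i then x else \<zero>) = (\<Oplus>j\<in>I. \<zero>)"
    by (intro finsum_cong') auto
  then show ?thesis
    using False by simp
qed

lemma (in abelian_monoid) finsum_mono_neutral:
  assumes "finite J" and "I \<subseteq> J" and "\<And>j. j \<in> J - I \<Longrightarrow> f j = \<zero>"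
    and "\<And>j. j \<in> I \<Longrightarrow> f j \<in> carrier G"
  shows "finsum G f I = finsum G f J"
proof (rule add.finprod_mono_neutral_cong_left)
  show "f \<in> J \<rightarrow> carrier G"
    using assms by (metis DiffI Pi_I zero_closed)
qed (use assms in auto)


lemma
  shows power_series_mult_apply: "(f \<otimes>\<^bsub>power_series R A\<^esub> g) a =
      (\<Oplus>\<^bsub>R\<^esub>p\<in>{p \<in> A \<times> A. fst p + snd p = a}. f (fst p) \<otimes>\<^bsub>R\<^esub> g (snd p))"
    and power_series_add_apply: "(f \<oplus>\<^bsub>power_series R A\<^esub> g) a = f a \<oplus>\<^bsub>R\<^esub> g a"
    and power_series_zero_apply: "\<zero>\<^bsub>power_series R A\<^esub> a = \<zero>\<^bsub>R\<^esub>"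
    and power_series_one_apply: "\<one>\<^bsub>power_series R A\<^esub> a = (if a = 0 then \<one>\<^bsub>R\<^esub> else \<zero>\<^bsub>R\<^esub>)"
    and power_series_smult_apply: "(r \<odot>\<^bsub>power_series R A\<^esub> f) a = r \<otimes>\<^bsub>R\<^esub> f a"
  by (simp_all add: power_series_def)


text \<open>Serves both rational exponents and exponent vectors. Finite decompositions make the
  convolution a finite sum. The absence of opposites leaves 0 only the decomposition
  \<open>(0, 0)\<close>, so the coefficient at 0 is multiplicative and can decide
  invertibility.\<close>

locale power_series_exponents =
  fixes A :: "'e::cancel_comm_monoid_add set"
  assumes zero_mem [simp]: "0 \<in> A"
    and add_mem: "a \<in> A \<Longrightarrow> b \<in> A \<Longrightarrow> a + b \<in> A"
    and finite_decompositions [simp]: "finite {p \<in> A \<times> A. fst p + snd p = a}"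
    and add_eq_zero: "a \<in> A \<Longrightarrow> b \<in> A \<Longrightarrow> a + b = 0 \<Longrightarrow> a = 0"
begin

abbreviation decompositions :: "'e \<Rightarrow> ('e \<times> 'e) set" where
  "decompositions a \<equiv> {p \<in> A \<times> A. fst p + snd p = a}"

lemma decompositions_notin: "a \<notin> A \<Longrightarrow> decompositions a = {}"
  using add_mem by auto

lemma decompositions_zero: "decompositions 0 = {(0, 0)}"
  using add_eq_zero by (fastforce simp: add.commute)

end

locale power_series_ring = R?: cring R + power_series_exponents A
  for R (structure) and A :: "'e::cancel_comm_monoid_add set"
begin

abbreviation PS where "PS \<equiv> power_series R A"

lemma mem_carrier: "f \<in> carrier PS \<longleftrightarrow> (\<forall>a. f a \<in> carrier R) \<and> (\<forall>a. a \<notin> A \<longrightarrow> f a = \<zero>)"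
  unfolding power_series_def by auto

lemma coeff_closed [simp]: "f \<in> carrier PS \<Longrightarrow> f a \<in> carrier R"
  by (simp add: mem_carrier)

lemma coeff_notin: "f \<in> carrier PS \<Longrightarrow> a \<notin> A \<Longrightarrow> f a = \<zero>"
  by (simp add: mem_carrier)

lemmas mult_apply = power_series_mult_apply[of R A]
  and add_apply [simp] = power_series_add_apply[of R A]
  and zero_apply [simp] = power_series_zero_apply[of R A]
  and one_apply = power_series_one_apply[of R A]
  and smult_apply [simp] = power_series_smult_apply[of R A]

lemma add_carrier: "f \<in> carrier PS \<Longrightarrow> g \<in> carrier PS \<Longrightarrow> f \<oplus>\<^bsub>PS\<^esub> g \<in> carrier PS"
  by (simp add: mem_carrier)

lemma mult_carrier:
  assumes "f \<in> carrier PS" "g \<in> carrier PS"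
  shows "f \<otimes>\<^bsub>PS\<^esub> g \<in> carrier PS"
  unfolding mem_carrier
proof (intro conjI allI impI)
  show "(f \<otimes>\<^bsub>PS\<^esub> g) a \<in> carrier R" for a
    using assms unfolding mult_apply by (intro finsum_closed) auto
  show "(f \<otimes>\<^bsub>PS\<^esub> g) a = \<zero>" if "a \<notin> A" for a
    unfolding mult_apply decompositions_notin[OF that] by simp
qed

lemma mult_comm:
  assumes "f \<in> carrier PS" "g \<in> carrier PS"
  shows "f \<otimes>\<^bsub>PS\<^esub> g = g \<otimes>\<^bsub>PS\<^esub> f"
proof
  fix a
  have "bij_betw prod.swap (decompositions a) (decompositions a)"
    by (intro bij_betwI[where g = prod.swap]) (auto simp: add.commute)
  then show "(f \<otimes>\<^bsub>PS\<^esub> g) a = (g \<otimes>\<^bsub>PS\<^esub> f) a"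
    unfolding mult_apply using assms by (intro finsum_bij_betw) (auto simp: m_comm)
qed

lemma mult_assoc:
  assumes f: "f \<in> carrier PS" and g: "g \<in> carrier PS" and h: "h \<in> carrier PS"
  shows "(f \<otimes>\<^bsub>PS\<^esub> g) \<otimes>\<^bsub>PS\<^esub> h = f \<otimes>\<^bsub>PS\<^esub> (g \<otimes>\<^bsub>PS\<^esub> h)"
proof
  fix a
  let ?L = "Sigma (decompositions a) (\<lambda>p. decompositions (fst p))"
  let ?R = "Sigma (decompositions a) (\<lambda>p. decompositions (snd p))"
  let ?G = "\<lambda>(p, q). f (fst q) \<otimes> (g (snd q) \<otimes> h (snd p))"
  let ?H = "\<lambda>(p, q). f (fst p) \<otimes> (g (fst q) \<otimes> h (snd q))"
  have "((f \<otimes>\<^bsub>PS\<^esub> g) \<otimes>\<^bsub>PS\<^esub> h) a =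
      (\<Oplus>p\<in>decompositions a. \<Oplus>q\<in>decompositions (fst p). ?G (p, q))"
    unfolding mult_apply using f g h
    by (intro finsum_cong') (auto simp: finsum_ldistr m_assoc intro!: finsum_cong')
  also have "\<dots> = (\<Oplus>x\<in>?L. ?G x)"
    using f g h by (intro finsum_Sigma[symmetric]) auto
  \<comment> \<open>Both sums run over the triples in \<open>A\<close> with sum \<open>a\<close>;
    the bijection moves the bracket from the first two entries to the last two.\<close>
  also have "\<dots> = (\<Oplus>x\<in>?R. ?H x)"
  proof (rule finsum_bij_betw)
    show "bij_betw (\<lambda>(p, q). ((fst q, snd q + snd p), (snd q, snd p))) ?L ?R"
      by (rule bij_betwI[where g = "\<lambda>(p, q). ((fst p + fst q, snd q), (fst p, fst q))"])
        (auto simp: add.assoc intro: add_mem)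
  qed (use f g h in auto)
  also have "\<dots> = (\<Oplus>p\<in>decompositions a. \<Oplus>q\<in>decompositions (snd p). ?H (p, q))"
    using f g h by (intro finsum_Sigma) auto
  also have "\<dots> = (f \<otimes>\<^bsub>PS\<^esub> (g \<otimes>\<^bsub>PS\<^esub> h)) a"
    unfolding mult_apply using f g h
    by (intro finsum_cong') (auto simp: finsum_rdistr intro!: finsum_closed)
  finally show "((f \<otimes>\<^bsub>PS\<^esub> g) \<otimes>\<^bsub>PS\<^esub> h) a = (f \<otimes>\<^bsub>PS\<^esub> (g \<otimes>\<^bsub>PS\<^esub> h)) a" .
qed

lemma mult_distrib:
  assumes "f \<in> carrier PS" "g \<in> carrier PS" "h \<in> carrier PS"
  shows "(f \<oplus>\<^bsub>PS\<^esub> g) \<otimes>\<^bsub>PS\<^esub> h = f \<otimes>\<^bsub>PS\<^esub> h \<oplus>\<^bsub>PS\<^esub> g \<otimes>\<^bsub>PS\<^esub> h"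
proof
  fix a
  have "((f \<oplus>\<^bsub>PS\<^esub> g) \<otimes>\<^bsub>PS\<^esub> h) a =
      (\<Oplus>p\<in>decompositions a. f (fst p) \<otimes> h (snd p) \<oplus> g (fst p) \<otimes> h (snd p))"
    unfolding mult_apply using assms by (intro finsum_cong') (auto simp: l_distr)
  also have "\<dots> = (f \<otimes>\<^bsub>PS\<^esub> h \<oplus>\<^bsub>PS\<^esub> g \<otimes>\<^bsub>PS\<^esub> h) a"
    unfolding mult_apply add_apply using assms by (intro finsum_addf) auto
  finally show "((f \<oplus>\<^bsub>PS\<^esub> g) \<otimes>\<^bsub>PS\<^esub> h) a = (f \<otimes>\<^bsub>PS\<^esub> h \<oplus>\<^bsub>PS\<^esub> g \<otimes>\<^bsub>PS\<^esub> h) a" .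
qed

definition monom :: "'e \<Rightarrow> 'a \<Rightarrow> 'e \<Rightarrow> 'a" where
  "monom a r b = (if b = a then r else \<zero>)"

lemma monom_carrier: "a \<in> A \<Longrightarrow> r \<in> carrier R \<Longrightarrow> monom a r \<in> carrier PS"
  by (auto simp: mem_carrier monom_def)

lemma ps_monom_eq: "ps_monom R a = monom a \<one>"
  by (simp add: ps_monom_def monom_def fun_eq_iff)

lemma one_eq_monom: "\<one>\<^bsub>PS\<^esub> = monom 0 \<one>"
  by (simp add: one_apply monom_def fun_eq_iff)

text \<open>There is no condition on \<open>b\<close>: outside \<open>A\<close> the factor
  \<open>f b\<close> is zero, and by cancellation no decomposition of \<open>b + a\<close> has
  second entry \<open>a\<close>.\<close>

lemma mult_monom_apply_add:
  assumes "f \<in> carrier PS" "a \<in> A" "r \<in> carrier R"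
  shows "(f \<otimes>\<^bsub>PS\<^esub> monom a r) (b + a) = f b \<otimes> r"
proof -
  have "(f \<otimes>\<^bsub>PS\<^esub> monom a r) (b + a) =
      (\<Oplus>p\<in>decompositions (b + a). if p = (b, a) then f b \<otimes> r else \<zero>)"
    unfolding mult_apply using assms by (intro finsum_cong') (auto simp: monom_def)
  also have "\<dots> = (if b \<in> A then f b \<otimes> r else \<zero>)"
    using assms by (subst finsum_delta) auto
  finally show ?thesis
    using assms by (auto simp: coeff_notin)
qed

lemma mult_monom_apply_notin:
  assumes "f \<in> carrier PS" "a \<in> A" "r \<in> carrier R" "\<And>b. b \<in> A \<Longrightarrow> c \<noteq> b + a"
  shows "(f \<otimes>\<^bsub>PS\<^esub> monom a r) c = \<zero>"
proof -
  have "(f \<otimes>\<^bsub>PS\<^esub> monom a r) c = (\<Oplus>p\<in>decompositions c. \<zero>)"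
    unfolding mult_apply using assms by (intro finsum_cong') (fastforce simp: monom_def)+
  then show ?thesis by simp
qed

lemma monom_mult_monom:
  assumes "a \<in> A" "b \<in> A" "r \<in> carrier R" "t \<in> carrier R"
  shows "monom a r \<otimes>\<^bsub>PS\<^esub> monom b t = monom (a + b) (r \<otimes> t)"
proof
  fix c
  show "(monom a r \<otimes>\<^bsub>PS\<^esub> monom b t) c = monom (a + b) (r \<otimes> t) c"
  proof (cases "\<exists>d\<in>A. c = d + b")
    case True
    then obtain d where "c = d + b" by blast
    then show ?thesis
      using assms by (simp add: mult_monom_apply_add monom_carrier) (simp add: monom_def)
  next
    case False
    then show ?thesis
      using assms by (subst mult_monom_apply_notin) (auto simp: monom_def monom_carrier)
  qed
qed

lemma mult_one_right: "f \<in> carrier PS \<Longrightarrow> f \<otimes>\<^bsub>PS\<^esub> \<one>\<^bsub>PS\<^esub> = f"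
  using mult_monom_apply_add[of f 0 \<one>] by (auto simp: one_eq_monom fun_eq_iff)

lemma PS_cring: "cring PS"
proof (rule cringI)
  show "abelian_group PS"
  proof (rule abelian_groupI)
    fix f assume f: "f \<in> carrier PS"
    then have "(\<lambda>a. \<ominus> f a) \<in> carrier PS"
      by (simp add: mem_carrier)
    moreover have "(\<lambda>a. \<ominus> f a) \<oplus>\<^bsub>PS\<^esub> f = \<zero>\<^bsub>PS\<^esub>"
      using f by (auto simp: l_neg)
    ultimately show "\<exists>g\<in>carrier PS. g \<oplus>\<^bsub>PS\<^esub> f = \<zero>\<^bsub>PS\<^esub>" by blast
  qed (auto simp: add_carrier mem_carrier a_ac)
  show "comm_monoid PS"
    using mult_one_right mult_comm mult_assoc mult_carrier
    by (intro comm_monoidI) (auto simp: one_eq_monom monom_carrier)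
qed (use mult_distrib in auto)

sublocale PS: cring PS by (rule PS_cring)

lemma a_inv_apply:
  assumes "f \<in> carrier PS"
  shows "(\<ominus>\<^bsub>PS\<^esub> f) a = \<ominus> f a"
proof -
  have "(\<ominus>\<^bsub>PS\<^esub> f \<oplus>\<^bsub>PS\<^esub> f) a = \<zero>"
    using assms by (simp add: PS.l_neg del: add_apply)
  then show ?thesis
    using assms minus_equality[of "(\<ominus>\<^bsub>PS\<^esub> f) a" "f a"] by simp
qed

lemma minus_apply:
  assumes "f \<in> carrier PS" "g \<in> carrier PS"
  shows "(f \<ominus>\<^bsub>PS\<^esub> g) a = f a \<ominus> g a"
  using assms by (simp add: a_minus_def a_inv_apply)

lemma finsum_apply:
  assumes "\<And>i. i \<in> I \<Longrightarrow> F i \<in> carrier PS"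
  shows "(\<Oplus>\<^bsub>PS\<^esub>i\<in>I. F i) a = (\<Oplus>i\<in>I. F i a)"
proof (cases "finite I")
  case True
  then show ?thesis
    using assms by (induction I) (auto simp: Pi_def)
next
  case False
  then show ?thesis by simp
qed

lemma mult_apply_zero:
  assumes "f \<in> carrier PS" "g \<in> carrier PS"
  shows "(f \<otimes>\<^bsub>PS\<^esub> g) 0 = f 0 \<otimes> g 0"
  unfolding mult_apply decompositions_zero using assms by simp

text \<open>A well-founded measure for recursion on exponents, which need not carry an order: adding
  \<open>p\<close> to the second entry embeds the decompositions of \<open>q\<close> into those of
  \<open>p + q\<close> and misses \<open>(p + q, 0)\<close>, as \<open>p\<close> has no
  opposite.\<close>

lemma card_decompositions_less:
  assumes "p \<in> A" "q \<in> A" "p \<noteq> 0"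
  shows "card (decompositions q) < card (decompositions (p + q))"
proof -
  have "card (decompositions q) = card ((\<lambda>x. (fst x, snd x + p)) ` decompositions q)"
    by (rule card_image[symmetric]) (auto simp: inj_on_def)
  also have "\<dots> < card (decompositions (p + q))"
  proof (rule psubset_card_mono)
    have "(p + q, 0) \<in> decompositions (p + q)"
      using assms by (auto intro: add_mem)
    moreover have "(p + q, 0) \<notin> (\<lambda>x. (fst x, snd x + p)) ` decompositions q"
    proof
      assume "(p + q, 0) \<in> (\<lambda>x. (fst x, snd x + p)) ` decompositions q"
      then obtain y where "y \<in> A" "p + y = 0" by (auto simp: add.commute)
      then show False using assms add_eq_zero by blast
    qed
    moreover have "(\<lambda>x. (fst x, snd x + p)) ` decompositions q \<subseteq> decompositions (p + q)"
      using assms by (auto intro: add_mem simp: ac_simps)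
    ultimately show "(\<lambda>x. (fst x, snd x + p)) ` decompositions q \<subset> decompositions (p + q)"
      by blast
  qed simp
  finally show ?thesis .
qed

text \<open>One direction is multiplicativity of the constant coefficient. Conversely the equations
  for an inverse \<open>g\<close> are triangular: the one at \<open>a\<close> contains
  \<open>g a\<close> only in the product with the invertible \<open>f 0\<close>, and otherwise
  values of \<open>g\<close> at exponents below \<open>a\<close>.\<close>

lemma Units_PS:
  assumes f: "f \<in> carrier PS"
  shows "f \<in> Units PS \<longleftrightarrow> f 0 \<in> Units R"
proof
  assume "f \<in> Units PS"
  then obtain g where g: "g \<in> carrier PS" "g \<otimes>\<^bsub>PS\<^esub> f = \<one>\<^bsub>PS\<^esub>" "f \<otimes>\<^bsub>PS\<^esub> g = \<one>\<^bsub>PS\<^esub>"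
    by (auto simp: Units_def)
  then have "g 0 \<otimes> f 0 = \<one>" "f 0 \<otimes> g 0 = \<one>"
    using f mult_apply_zero[of f g] mult_apply_zero[of g f] by (auto simp: one_apply)
  then show "f 0 \<in> Units R"
    using f g by (auto simp: Units_def)
next
  assume "f 0 \<in> Units R"
  then obtain v where v: "v \<in> carrier R" "f 0 \<otimes> v = \<one>"
    by (auto simp: Units_def)
  define Rel where "Rel = {(q, a). q \<in> A \<and> (\<exists>p\<in>A. p \<noteq> 0 \<and> p + q = a)}"
  \<comment> \<open>The equation is imposed only when the earlier values lie in the carrier, so a
    suitable \<open>r\<close> exists for every \<open>g\<close>. Outside \<open>A\<close> the value
    is forced to be zero.\<close>
  define P where "P = (\<lambda>g a r. if a \<in> A
    then r \<in> carrier R \<and> ((\<forall>y. (y, a) \<in> Rel \<longrightarrow> g y \<in> carrier R) \<longrightarrow>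
      (\<Oplus>p\<in>decompositions a. f (fst p) \<otimes> (if fst p = 0 then r else g (snd p))) = \<one>\<^bsub>PS\<^esub> a)
    else r = \<zero>)"
  have "\<exists>g. \<forall>a. P g a (g a)"
  proof (rule dependent_wf_choice)
    show "wf Rel"
      by (rule wf_subset[OF wf_measure[of "\<lambda>a. card (decompositions a)"]])
        (auto simp: Rel_def intro: card_decompositions_less)
  next
    fix g g' :: "'e \<Rightarrow> 'a" and a r
    assume eq: "\<And>z. (z, a) \<in> Rel \<Longrightarrow> g z = g' z"
    have "(\<Oplus>p\<in>decompositions a. f (fst p) \<otimes> (if fst p = 0 then r else g (snd p))) =
      (\<Oplus>p\<in>decompositions a. f (fst p) \<otimes> (if fst p = 0 then r else g' (snd p)))"
      if "r \<in> carrier R" "\<forall>y. (y, a) \<in> Rel \<longrightarrow> g' y \<in> carrier R"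
      using f that by (intro finsum_cong') (auto simp: Rel_def eq)
    then show "P g a r = P g' a r"
      using eq by (simp add: P_def cong: conj_cong)
  next
    fix a and g :: "'e \<Rightarrow> 'a"
    show "\<exists>r. P g a r"
    proof (cases "a \<in> A \<and> (\<forall>y. (y, a) \<in> Rel \<longrightarrow> g y \<in> carrier R)")
      case True
      let ?D = "decompositions a - {(0, a)}"
      define c where "c = (\<Oplus>p\<in>?D. f (fst p) \<otimes> g (snd p))"
      have g: "g (snd p) \<in> carrier R" if "p \<in> ?D" for p
        using True that by (auto simp: Rel_def)
      have c: "c \<in> carrier R"
        unfolding c_def using f g by (intro finsum_closed) auto
      \<comment> \<open>Solves the equation at \<open>a\<close>: the pair \<open>(0, a)\<close>
        contributes \<open>f 0\<close> times \<open>r\<close>, all other pairs together contribute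
        \<open>c\<close>.\<close>
      define r where "r = v \<otimes> (\<one>\<^bsub>PS\<^esub> a \<ominus> c)"
      have o: "\<one>\<^bsub>PS\<^esub> a \<in> carrier R" by (simp add: one_apply)
      have r: "r \<in> carrier R" using v c o by (simp add: r_def)
      have "decompositions a = insert (0, a) ?D"
        using True by auto
      then have "(\<Oplus>p\<in>decompositions a. f (fst p) \<otimes> (if fst p = 0 then r else g (snd p))) =
        (\<Oplus>p\<in>insert (0, a) ?D. f (fst p) \<otimes> (if fst p = 0 then r else g (snd p)))"
        by (rule arg_cong)
      also have "\<dots> = f 0 \<otimes> r \<oplus> (\<Oplus>p\<in>?D. f (fst p) \<otimes> (if fst p = 0 then r else g (snd p)))"
        using f g r by (subst finsum_insert) auto
      also have "(\<Oplus>p\<in>?D. f (fst p) \<otimes> (if fst p = 0 then r else g (snd p))) = c"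
        unfolding c_def using f g by (intro finsum_cong') auto
      also have "f 0 \<otimes> r = \<one>\<^bsub>PS\<^esub> a \<ominus> c"
        unfolding r_def using f v c o by (simp add: m_assoc[symmetric])
      also have "\<one>\<^bsub>PS\<^esub> a \<ominus> c \<oplus> c = \<one>\<^bsub>PS\<^esub> a"
        using c o by (simp add: a_minus_def a_assoc l_neg)
      finally show ?thesis using True r by (auto simp: P_def)
    next
      case False
      then show ?thesis by (auto simp: P_def)
    qed
  qed
  then obtain g where g: "\<And>a. P g a (g a)" by blast
  have gc: "g \<in> carrier PS"
    using g by (auto simp: mem_carrier P_def split: if_splits) (metis zero_closed)
  have "f \<otimes>\<^bsub>PS\<^esub> g = \<one>\<^bsub>PS\<^esub>"
  proof
    fix a
    have "(f \<otimes>\<^bsub>PS\<^esub> g) a =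
        (\<Oplus>p\<in>decompositions a. f (fst p) \<otimes> (if fst p = 0 then g a else g (snd p)))"
      unfolding mult_apply using f gc by (intro finsum_cong') auto
    also have "\<dots> = \<one>\<^bsub>PS\<^esub> a"
    proof (cases "a \<in> A")
      case True
      then show ?thesis using g[of a] gc by (auto simp: P_def)
    next
      case False
      then show ?thesis unfolding decompositions_notin[OF False] by (auto simp: one_apply)
    qed
    finally show "(f \<otimes>\<^bsub>PS\<^esub> g) a = \<one>\<^bsub>PS\<^esub> a" .
  qed
  then show "f \<in> Units PS"
    using f gc PS.m_comm[of f g] by (auto simp: Units_def)
qed

end


section \<open>Local rings recognized by their nonunits\<close>

definition nonunits_additive :: "('a, 'b) ring_scheme \<Rightarrow> bool" where
  "nonunits_additive R \<longleftrightarrow> \<one>\<^bsub>R\<^esub> \<noteq> \<zero>\<^bsub>R\<^esub> \<and>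
     (\<forall>x\<in>carrier R - Units R. \<forall>y\<in>carrier R - Units R. x \<oplus>\<^bsub>R\<^esub> y \<notin> Units R)"

context cring
begin

lemma ideal_subset_nonunits:
  assumes "ideal I R" "I \<noteq> carrier R"
  shows "I \<subseteq> carrier R - Units R"
proof -
  interpret ideal I R by fact
  have "x \<notin> Units R" if "x \<in> I" for x
  proof
    assume "x \<in> Units R"
    then have "\<one> \<in> I"
      using that I_l_closed[of x "inv x"] Units_l_inv Units_inv_closed by auto
    then show False using assms one_imp_carrier by simp
  qed
  then show ?thesis using a_subset by auto
qed

lemma nonunits_ideal:
  assumes "nonunits_additive R"
  shows "ideal (carrier R - Units R) R"
proof (rule idealI)
  have zero: "\<zero> \<notin> Units R"
    using assms by (auto simp: Units_def nonunits_additive_def)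
  have mult: "x \<otimes> a \<notin> Units R" if "x \<in> carrier R" "a \<in> carrier R" "a \<notin> Units R" for x a
  proof
    assume "x \<otimes> a \<in> Units R"
    then obtain y where y: "y \<in> carrier R" "y \<otimes> (x \<otimes> a) = \<one>"
      by (auto simp: Units_def)
    then have "(y \<otimes> x) \<otimes> a = \<one>" using that by (simp add: m_assoc)
    then have "a \<in> Units R"
      using that y m_comm[of "y \<otimes> x" a] by (auto simp: Units_def)
    then show False using that by simp
  qed
  show "subgroup (carrier R - Units R) (add_monoid R)"
  proof (rule add.subgroupI)
    fix a assume a: "a \<in> carrier R - Units R"
    then have "\<ominus> \<one> \<otimes> a \<notin> Units R" by (intro mult) auto
    then show "\<ominus> a \<in> carrier R - Units R"
      using a by (simp add: l_minus)
  qed (use assms zero in \<open>auto simp: nonunits_additive_def\<close>)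
  show "x \<otimes> a \<in> carrier R - Units R" "a \<otimes> x \<in> carrier R - Units R"
    if "a \<in> carrier R - Units R" "x \<in> carrier R" for a x
    using that mult[of x a] m_comm[of x a] by auto
qed (rule ring_axioms)

text \<open>A proper ideal contains no unit, so the nonunits, once they form an ideal, contain every
  proper ideal.\<close>

lemma maximalideal_iff_nonunits:
  assumes "nonunits_additive R"
  shows "maximalideal I R \<longleftrightarrow> I = carrier R - Units R"
proof
  have neq: "carrier R - Units R \<noteq> carrier R"
    using Units_one_closed by auto
  {
    assume "maximalideal I R"
    then interpret maximalideal I R .
    show "I = carrier R - Units R"
      using I_maximal[OF nonunits_ideal[OF assms] ideal_subset_nonunits] neq I_notcarr is_ideal
      by auto
  }
  {
    assume "I = carrier R - Units R"
    then show "maximalideal I R"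
      using ideal_subset_nonunits neq nonunits_ideal[OF assms]
      by (intro maximalidealI) auto
  }
qed

lemma local_ringI: "nonunits_additive R \<Longrightarrow> local_ring R"
  by (simp add: local_ring_def maximalideal_iff_nonunits cring_axioms)

end

lemma (in field) nonunits_additive_field: "nonunits_additive R"
  by (auto simp: nonunits_additive_def field_Units)

text \<open>By \<open>Units_PS\<close> the criterion depends on constant coefficients only. Being
  inherited by power series, it can be applied twice to pass from \<open>K\<close> to R and on to
  R[[Y]].\<close>

lemma (in power_series_ring) nonunits_additive_PS:
  assumes "nonunits_additive R"
  shows "nonunits_additive PS"
  unfolding nonunits_additive_def
proof (intro conjI ballI)
  show "\<one>\<^bsub>PS\<^esub> \<noteq> \<zero>\<^bsub>PS\<^esub>"
    using assms by (metis nonunits_additive_def one_apply zero_apply)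
  fix f g assume f: "f \<in> carrier PS - Units PS" and g: "g \<in> carrier PS - Units PS"
  then have "f 0 \<oplus> g 0 \<notin> Units R"
    using assms Units_PS[of f] Units_PS[of g] by (auto simp: nonunits_additive_def)
  then show "f \<oplus>\<^bsub>PS\<^esub> g \<notin> Units PS"
    using f g Units_PS[of "f \<oplus>\<^bsub>PS\<^esub> g"] by simp
qed


section \<open>Modules with a finite dual basis are flat\<close>

locale tensor_pair = N: Module.module R N + M: Module.module R M
  for R :: "('r, 'b) ring_scheme" and N :: "('r, 'n, 'c) module_scheme"
    and M :: "('r, 'm, 'd) module_scheme"
begin

abbreviation "FA \<equiv> free_Abelian_group (carrier N \<times> carrier M)"
abbreviation "rels \<equiv> tensor_relations R N M"
abbreviation "tsub \<equiv> tensor_subgroup R N M"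

lemma relations_subset: "rels \<subseteq> carrier FA"
  unfolding tensor_relations_def
  by (auto dest!: subsetD[OF keys_diff])

lemma subgroup_tsub: "subgroup tsub FA"
  unfolding tensor_subgroup_def
  by (rule group.generate_is_subgroup[OF group_free_Abelian_group relations_subset])

lemma tsub_subset: "x \<in> tsub \<Longrightarrow> Poly_Mapping.keys x \<subseteq> carrier N \<times> carrier M"
  using subgroup.subset[OF subgroup_tsub] by (auto simp: subset_iff)

lemma tsub_zero: "0 \<in> tsub"
  using subgroup.one_closed[OF subgroup_tsub] by simp

lemma tsub_add: "x \<in> tsub \<Longrightarrow> y \<in> tsub \<Longrightarrow> x + y \<in> tsub"
  using subgroup.m_closed[OF subgroup_tsub] by simp

lemma tsub_uminus: "x \<in> tsub \<Longrightarrow> - x \<in> tsub"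
  using subgroup.m_inv_closed[OF subgroup_tsub, of x] tsub_subset[of x] by simp

lemma tsub_diff: "x \<in> tsub \<Longrightarrow> y \<in> tsub \<Longrightarrow> x - y \<in> tsub"
  using tsub_add[of x "- y"] tsub_uminus by simp

lemma tsub_sum: "(\<And>i. i \<in> I \<Longrightarrow> x i \<in> tsub) \<Longrightarrow> sum x I \<in> tsub"
  by (induction I rule: infinite_finite_induct) (auto intro: tsub_zero tsub_add)

lemma relation_in_tsub: "x \<in> rels \<Longrightarrow> x \<in> tsub"
  by (simp add: tensor_subgroup_def generate.incl)

lemma tsub_add_left:
  "x \<in> carrier N \<Longrightarrow> y \<in> carrier N \<Longrightarrow> z \<in> carrier M \<Longrightarrow>
    frag_of (x \<oplus>\<^bsub>N\<^esub> y, z) - frag_of (x, z) - frag_of (y, z) \<in> tsub"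
  by (rule relation_in_tsub) (auto simp: tensor_relations_def)

lemma tsub_add_right:
  "x \<in> carrier N \<Longrightarrow> y \<in> carrier M \<Longrightarrow> z \<in> carrier M \<Longrightarrow>
    frag_of (x, y \<oplus>\<^bsub>M\<^esub> z) - frag_of (x, y) - frag_of (x, z) \<in> tsub"
  by (rule relation_in_tsub) (auto simp: tensor_relations_def)

lemma tsub_smult:
  "r \<in> carrier R \<Longrightarrow> x \<in> carrier N \<Longrightarrow> z \<in> carrier M \<Longrightarrow>
    frag_of (r \<odot>\<^bsub>N\<^esub> x, z) - frag_of (x, r \<odot>\<^bsub>M\<^esub> z) \<in> tsub"
  by (rule relation_in_tsub) (auto simp: tensor_relations_def)

lemma tsub_zero_left: "z \<in> carrier M \<Longrightarrow> frag_of (\<zero>\<^bsub>N\<^esub>, z) \<in> tsub"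
  using tsub_uminus[OF tsub_add_left[of "\<zero>\<^bsub>N\<^esub>" "\<zero>\<^bsub>N\<^esub>" z]] by simp

lemma tsub_zero_right: "x \<in> carrier N \<Longrightarrow> frag_of (x, \<zero>\<^bsub>M\<^esub>) \<in> tsub"
  using tsub_uminus[OF tsub_add_right[of x "\<zero>\<^bsub>M\<^esub>" "\<zero>\<^bsub>M\<^esub>"]] by simp

lemma tsub_diff_left:
  assumes "x \<in> carrier N" "y \<in> carrier N" "z \<in> carrier M"
  shows "frag_of (x \<ominus>\<^bsub>N\<^esub> y, z) - (frag_of (x, z) - frag_of (y, z)) \<in> tsub"
proof -
  have "(x \<ominus>\<^bsub>N\<^esub> y) \<oplus>\<^bsub>N\<^esub> y = x"
    using assms by (simp add: N.M.minus_eq N.M.a_assoc N.M.l_neg)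
  then have "frag_of (x, z) - frag_of (x \<ominus>\<^bsub>N\<^esub> y, z) - frag_of (y, z) \<in> tsub"
    using tsub_add_left[of "x \<ominus>\<^bsub>N\<^esub> y" y z] assms by simp
  from tsub_uminus[OF this] show ?thesis
    by (simp add: algebra_simps)
qed

lemma tsub_finsum_right:
  assumes "finite I" "x \<in> carrier N" "\<And>i. i \<in> I \<Longrightarrow> z i \<in> carrier M"
  shows "frag_of (x, \<Oplus>\<^bsub>M\<^esub>i\<in>I. z i) - (\<Sum>i\<in>I. frag_of (x, z i)) \<in> tsub"
  using assms
proof (induction I)
  case empty
  then show ?case using tsub_zero_right by simp
next
  case (insert i I)
  have z: "z i \<in> carrier M" "(\<Oplus>\<^bsub>M\<^esub>i\<in>I. z i) \<in> carrier M" "z \<in> I \<rightarrow> carrier M"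
    using insert.prems by auto
  then have "frag_of (x, \<Oplus>\<^bsub>M\<^esub>i\<in>insert i I. z i) - (\<Sum>i\<in>insert i I. frag_of (x, z i)) =
    (frag_of (x, z i \<oplus>\<^bsub>M\<^esub> (\<Oplus>\<^bsub>M\<^esub>i\<in>I. z i)) - frag_of (x, z i) - frag_of (x, \<Oplus>\<^bsub>M\<^esub>i\<in>I. z i)) +
    (frag_of (x, \<Oplus>\<^bsub>M\<^esub>i\<in>I. z i) - (\<Sum>i\<in>I. frag_of (x, z i)))"
    using insert.hyps by simp
  also have "\<dots> \<in> tsub"
    using insert z by (intro tsub_add tsub_add_right) auto
  finally show ?case .
qed

lemma carrier_tensor_product:
  "C \<in> carrier (tensor_product R N M) \<longleftrightarrow>
    (\<exists>x. Poly_Mapping.keys x \<subseteq> carrier N \<times> carrier M \<and> C = (\<lambda>h. h + x) ` tsub)"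
  unfolding tensor_product_def FactGroup_def
  by (auto simp: RCOSETS_def r_coset_def free_Abelian_group_def)

lemma coset_eq:
  assumes "x - y \<in> tsub"
  shows "(\<lambda>h. h + x) ` tsub = (\<lambda>h. h + y) ` tsub"
proof -
  have "(\<lambda>h. h + x) ` tsub \<subseteq> (\<lambda>h. h + y) ` tsub" if "x - y \<in> tsub" for x y
  proof
    fix u assume "u \<in> (\<lambda>h. h + x) ` tsub"
    then obtain h where "h \<in> tsub" "u = (h + (x - y)) + y" by auto
    then show "u \<in> (\<lambda>h. h + y) ` tsub"
      using that tsub_add by blast
  qed
  from this[OF assms] this[of y x] tsub_uminus[OF assms] show ?thesis by auto
qed

text \<open>The contraction \<open>N \<otimes> M \<rightarrow> N\<close> of \<open>M\<close> against a linear form \<open>c\<close>, on representatives.\<close>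

lemma contraction_exists:
  assumes c: "c \<in> carrier M \<rightarrow> carrier R"
    and c_add: "\<And>x y. x \<in> carrier M \<Longrightarrow> y \<in> carrier M \<Longrightarrow> c (x \<oplus>\<^bsub>M\<^esub> y) = c x \<oplus>\<^bsub>R\<^esub> c y"
    and c_smult: "\<And>r x. r \<in> carrier R \<Longrightarrow> x \<in> carrier M \<Longrightarrow> c (r \<odot>\<^bsub>M\<^esub> x) = r \<otimes>\<^bsub>R\<^esub> c x"
  shows "\<exists>\<phi>\<in>hom FA (add_monoid N).
    (\<forall>n\<in>carrier N. \<forall>z\<in>carrier M. \<phi> (frag_of (n, z)) = c z \<odot>\<^bsub>N\<^esub> n) \<and>
    (\<forall>x\<in>tsub. \<phi> x = \<zero>\<^bsub>N\<^esub>) \<and>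
    (\<forall>x\<in>carrier FA. \<forall>y\<in>carrier FA. \<phi> (x - y) = \<phi> x \<ominus>\<^bsub>N\<^esub> \<phi> y)"
proof -
  let ?f = "\<lambda>(n, z). c z \<odot>\<^bsub>N\<^esub> n"
  have cc: "c z \<in> carrier R" if "z \<in> carrier M" for z using c that by auto
  have "?f ` (carrier N \<times> carrier M) \<subseteq> carrier (add_monoid N)"
    using cc by auto
  then obtain \<phi> where \<phi>: "\<phi> \<in> hom FA (add_monoid N)"
    and \<phi>f: "\<And>x. x \<in> carrier N \<times> carrier M \<Longrightarrow> \<phi> (frag_of x) = ?f x"
    using comm_group.free_Abelian_group_universal[OF N.M.a_comm_group] by metis
  interpret \<phi>: group_hom FA "add_monoid N" \<phi>
    by (intro group_hom.intro group_hom_axioms.intro) (use \<phi> N.M.a_group in auto)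
  have val: "\<phi> (frag_of (n, z)) = c z \<odot>\<^bsub>N\<^esub> n" if "n \<in> carrier N" "z \<in> carrier M" for n z
    using \<phi>f[of "(n, z)"] that by simp
  have diff: "\<phi> (x - y) = \<phi> x \<ominus>\<^bsub>N\<^esub> \<phi> y" if "x \<in> carrier FA" "y \<in> carrier FA" for x y
  proof -
    have y: "- y \<in> carrier FA" using that by simp
    have "\<phi> (x - y) = \<phi> x \<oplus>\<^bsub>N\<^esub> \<phi> (- y)"
      using \<phi>.hom_mult[OF that(1) y] by simp
    moreover have "\<phi> (- y) = \<ominus>\<^bsub>N\<^esub> \<phi> y"
      using \<phi>.hom_inv[OF that(2)] that by (simp add: a_inv_def)
    ultimately show ?thesis by (simp add: a_minus_def)
  qed
  have "tsub \<subseteq> kernel FA (add_monoid N) \<phi>"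
    unfolding tensor_subgroup_def
  proof (rule group.generate_subgroup_incl[OF group_free_Abelian_group _ \<phi>.subgroup_kernel])
    have d3: "\<phi> (x - y - w) = \<phi> x \<ominus>\<^bsub>N\<^esub> \<phi> y \<ominus>\<^bsub>N\<^esub> \<phi> w"
      if "x \<in> carrier FA" "y \<in> carrier FA" "w \<in> carrier FA" for x y w
      using that diff[of "x - y" w] diff[of x y] keys_diff[of x y] by auto
    have cancel: "a \<oplus>\<^bsub>N\<^esub> b \<ominus>\<^bsub>N\<^esub> a \<ominus>\<^bsub>N\<^esub> b = \<zero>\<^bsub>N\<^esub>" if "a \<in> carrier N" "b \<in> carrier N" for a b
    proof -
      have "a \<oplus>\<^bsub>N\<^esub> b \<ominus>\<^bsub>N\<^esub> a \<ominus>\<^bsub>N\<^esub> b = (a \<oplus>\<^bsub>N\<^esub> b) \<oplus>\<^bsub>N\<^esub> \<ominus>\<^bsub>N\<^esub> (a \<oplus>\<^bsub>N\<^esub> b)"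
        using that by (simp add: N.M.minus_eq N.M.a_assoc N.M.minus_add)
      then show ?thesis using that by (simp add: N.M.r_neg)
    qed
    have "\<phi> x = \<zero>\<^bsub>N\<^esub>" if "x \<in> rels" for x
      using that unfolding tensor_relations_def
    proof (elim UnE CollectE exE conjE)
      fix u v z assume "x = frag_of (u \<oplus>\<^bsub>N\<^esub> v, z) - frag_of (u, z) - frag_of (v, z)"
        "u \<in> carrier N" "v \<in> carrier N" "z \<in> carrier M"
      then show ?thesis
        using cancel cc by (simp add: d3 val N.smult_r_distr)
    next
      fix u v z assume "x = frag_of (u, v \<oplus>\<^bsub>M\<^esub> z) - frag_of (u, v) - frag_of (u, z)"
        "u \<in> carrier N" "v \<in> carrier M" "z \<in> carrier M"
      then show ?thesis
        using cancel cc by (simp add: d3 val c_add N.smult_l_distr)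
    next
      fix r u z assume "x = frag_of (r \<odot>\<^bsub>N\<^esub> u, z) - frag_of (u, r \<odot>\<^bsub>M\<^esub> z)"
        "r \<in> carrier R" "u \<in> carrier N" "z \<in> carrier M"
      then show ?thesis
        using cc by (simp add: diff val c_smult N.smult_assoc1[symmetric] N.R.m_comm
            N.M.r_neg N.M.minus_eq)
    qed
    then show "rels \<subseteq> kernel FA (add_monoid N) \<phi>"
      using subsetD[OF relations_subset] by (simp add: kernel_def subset_iff)
  qed
  then have "\<phi> x = \<zero>\<^bsub>N\<^esub>" if "x \<in> tsub" for x
    using that by (auto simp: kernel_def)
  with \<phi> val diff show ?thesis by blast
qed

end

text \<open>A dual basis \<open>(b, c)\<close> recovers a tensor \<open>x \<in> N \<otimes> M\<close> from its contractions
  \<open>\<phi> i x \<in> N\<close>, as \<open>\<Sum>i. \<phi> i x \<otimes> b i\<close>; the contractions commute with \<open>f \<otimes> id\<close>.\<close>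

lemma flat_module_dual_basis:
  fixes R :: "('r, 'b) ring_scheme" and M :: "('r, 'm, 'd) module_scheme"
  assumes M: "Module.module R M" and I: "finite I"
    and b: "\<And>i. i \<in> I \<Longrightarrow> b i \<in> carrier M"
    and c: "\<And>i. i \<in> I \<Longrightarrow> c i \<in> carrier M \<rightarrow> carrier R"
    and c_add: "\<And>i x y. i \<in> I \<Longrightarrow> x \<in> carrier M \<Longrightarrow> y \<in> carrier M \<Longrightarrow>
      c i (x \<oplus>\<^bsub>M\<^esub> y) = c i x \<oplus>\<^bsub>R\<^esub> c i y"
    and c_smult: "\<And>i r x. i \<in> I \<Longrightarrow> r \<in> carrier R \<Longrightarrow> x \<in> carrier M \<Longrightarrow>
      c i (r \<odot>\<^bsub>M\<^esub> x) = r \<otimes>\<^bsub>R\<^esub> c i x"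
    and dual: "\<And>z. z \<in> carrier M \<Longrightarrow> z = (\<Oplus>\<^bsub>M\<^esub>i\<in>I. c i z \<odot>\<^bsub>M\<^esub> b i)"
  shows "flat_module TN TP R M"
  unfolding flat_module_def
proof (intro conjI M allI impI)
  fix N :: "('r, 'n) module" and P :: "('r, 'p) module" and f
  assume "Module.module R N \<and> Module.module R P \<and> f \<in> linear_maps R N P \<and> inj_on f (carrier N)"
  then have N: "Module.module R N" and P: "Module.module R P" and f: "f \<in> linear_maps R N P"
    and inj: "inj_on f (carrier N)" by auto
  interpret N: tensor_pair R N M using N M by (rule tensor_pair.intro)
  interpret P: tensor_pair R P M using P M by (rule tensor_pair.intro)
  have f_carrier: "f n \<in> carrier P" if "n \<in> carrier N" for n
    using f that by (auto simp: linear_maps_def)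
  have f_add: "f (x \<oplus>\<^bsub>N\<^esub> y) = f x \<oplus>\<^bsub>P\<^esub> f y" if "x \<in> carrier N" "y \<in> carrier N" for x y
    using f that by (auto simp: linear_maps_def)
  have f_smult: "f (r \<odot>\<^bsub>N\<^esub> x) = r \<odot>\<^bsub>P\<^esub> f x" if "r \<in> carrier R" "x \<in> carrier N" for r x
    using f that by (auto simp: linear_maps_def)
  have f_diff: "f (x \<ominus>\<^bsub>N\<^esub> y) = f x \<ominus>\<^bsub>P\<^esub> f y" if "x \<in> carrier N" "y \<in> carrier N" for x y
  proof -
    have "f ((x \<ominus>\<^bsub>N\<^esub> y) \<oplus>\<^bsub>N\<^esub> y) = f (x \<ominus>\<^bsub>N\<^esub> y) \<oplus>\<^bsub>P\<^esub> f y"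
      using that by (intro f_add) auto
    moreover have "(x \<ominus>\<^bsub>N\<^esub> y) \<oplus>\<^bsub>N\<^esub> y = x"
      using that by (simp add: N.N.M.minus_eq N.N.M.a_assoc N.N.M.l_neg)
    ultimately have "f x \<ominus>\<^bsub>P\<^esub> f y = (f (x \<ominus>\<^bsub>N\<^esub> y) \<oplus>\<^bsub>P\<^esub> f y) \<ominus>\<^bsub>P\<^esub> f y" by simp
    also have "\<dots> = f (x \<ominus>\<^bsub>N\<^esub> y)"
      using that f_carrier by (simp add: P.N.M.minus_eq P.N.M.a_assoc P.N.M.r_neg)
    finally show ?thesis by simp
  qed
  have f_zero: "f \<zero>\<^bsub>N\<^esub> = \<zero>\<^bsub>P\<^esub>"
  proof -
    have "\<zero>\<^bsub>N\<^esub> \<ominus>\<^bsub>N\<^esub> \<zero>\<^bsub>N\<^esub> = \<zero>\<^bsub>N\<^esub>"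
      unfolding N.N.M.minus_eq by (rule N.N.M.r_neg) simp
    then show ?thesis
      using f_diff[of "\<zero>\<^bsub>N\<^esub>" "\<zero>\<^bsub>N\<^esub>"] f_carrier[of "\<zero>\<^bsub>N\<^esub>"]
      by (simp add: P.N.M.minus_eq P.N.M.r_neg)
  qed
  define F where "F = frag_extend (\<lambda>(n, z :: 'm). frag_of (f n, z))"
  have F_keys: "F x \<in> carrier P.FA" if "x \<in> carrier N.FA" for x
  proof -
    have "Poly_Mapping.keys x \<subseteq> carrier N \<times> carrier M" using that by simp
    then show ?thesis
    proof (induction x rule: frag_induction)
      case (diff u v)
      then show ?case
        using keys_diff[of "F u" "F v"] by (auto simp: F_def frag_extend_diff)
    qed (auto simp: F_def f_carrier)
  qed
  \<comment> \<open>Collects the properties of a contraction on \<open>N\<close> and of its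
    counterpart on \<open>P\<close>, so that one choice supplies both families together.\<close>
  define Q where "Q = (\<lambda>i \<phi> \<psi>. (\<forall>x y. x \<in> carrier N.FA \<longrightarrow> y \<in> carrier N.FA \<longrightarrow> \<phi> (x - y) = \<phi> x \<ominus>\<^bsub>N\<^esub> \<phi> y) \<and>
     (\<forall>x. x \<in> carrier N.FA \<longrightarrow> \<phi> x \<in> carrier N) \<and>
     (\<forall>n z. n \<in> carrier N \<longrightarrow> z \<in> carrier M \<longrightarrow> \<phi> (frag_of (n, z)) = c i z \<odot>\<^bsub>N\<^esub> n) \<and>
     (\<forall>x. x \<in> P.tsub \<longrightarrow> \<psi> x = \<zero>\<^bsub>P\<^esub>) \<and>
     (\<forall>x. x \<in> carrier N.FA \<longrightarrow> \<psi> (F x) = f (\<phi> x)))"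
  have "\<exists>\<phi> \<psi>. Q i \<phi> \<psi>" if i: "i \<in> I" for i
  proof -
    obtain \<phi> where \<phi>: "\<phi> \<in> hom N.FA (add_monoid N)"
      "\<And>n z. n \<in> carrier N \<Longrightarrow> z \<in> carrier M \<Longrightarrow> \<phi> (frag_of (n, z)) = c i z \<odot>\<^bsub>N\<^esub> n"
      "\<And>x. x \<in> N.tsub \<Longrightarrow> \<phi> x = \<zero>\<^bsub>N\<^esub>"
      "\<And>x y. x \<in> carrier N.FA \<Longrightarrow> y \<in> carrier N.FA \<Longrightarrow> \<phi> (x - y) = \<phi> x \<ominus>\<^bsub>N\<^esub> \<phi> y"
      using N.contraction_exists[OF c[OF i] c_add[OF i] c_smult[OF i]] by blast
    obtain \<psi> where \<psi>: "\<psi> \<in> hom P.FA (add_monoid P)"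
      "\<And>n z. n \<in> carrier P \<Longrightarrow> z \<in> carrier M \<Longrightarrow> \<psi> (frag_of (n, z)) = c i z \<odot>\<^bsub>P\<^esub> n"
      "\<And>x. x \<in> P.tsub \<Longrightarrow> \<psi> x = \<zero>\<^bsub>P\<^esub>"
      "\<And>x y. x \<in> carrier P.FA \<Longrightarrow> y \<in> carrier P.FA \<Longrightarrow> \<psi> (x - y) = \<psi> x \<ominus>\<^bsub>P\<^esub> \<psi> y"
      using P.contraction_exists[OF c[OF i] c_add[OF i] c_smult[OF i]] by blast
    have \<phi>c: "\<phi> x \<in> carrier N" if "x \<in> carrier N.FA" for x
      using hom_in_carrier[OF \<phi>(1) that] by simp
    \<comment> \<open>Naturality of the contraction. On a generator both sides are
      \<open>c i z\<close> times \<open>f n\<close>, by linearity of \<open>f\<close>.\<close>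
    have \<psi>F: "\<psi> (F x) = f (\<phi> x)" if "x \<in> carrier N.FA" for x
    proof -
      have "Poly_Mapping.keys x \<subseteq> carrier N \<times> carrier M" using that by simp
      then show ?thesis
      proof (induction x rule: free_Abelian_group_induct[consumes 1, case_names zero diff of])
        case zero
        have "\<psi> 0 = \<zero>\<^bsub>P\<^esub>" by (rule \<psi>(3)[OF P.tsub_zero])
        then show ?case
          using \<phi>(3)[OF N.tsub_zero] f_zero by (simp add: F_def)
      next
        case (diff x y)
        have "\<psi> (F (x - y)) = \<psi> (F x - F y)" by (simp add: F_def frag_extend_diff)
        also have "\<dots> = \<psi> (F x) \<ominus>\<^bsub>P\<^esub> \<psi> (F y)"
          using diff F_keys by (intro \<psi>(4)) simp_all
        also have "\<dots> = f (\<phi> (x - y))"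
          using diff \<phi>c by (simp add: f_diff \<phi>(4))
        finally show ?case .
      next
        case (of a)
        then show ?case
          using c i by (cases a) (auto simp: F_def \<phi>(2) \<psi>(2) f_carrier f_smult Pi_def)
      qed
    qed
    have "Q i \<phi> \<psi>"
      unfolding Q_def using \<phi>(2,4) \<phi>c \<psi>(3) \<psi>F by simp
    then show ?thesis by blast
  qed
  then obtain \<phi> \<psi> where Q: "\<And>i. i \<in> I \<Longrightarrow> Q i (\<phi> i) (\<psi> i)" by metis
  have
    \<phi>_diff: "\<And>x y. i \<in> I \<Longrightarrow> x \<in> carrier N.FA \<Longrightarrow> y \<in> carrier N.FA \<Longrightarrow>
      \<phi> i (x - y) = \<phi> i x \<ominus>\<^bsub>N\<^esub> \<phi> i y" and
    \<phi>_carrier: "\<And>x. i \<in> I \<Longrightarrow> x \<in> carrier N.FA \<Longrightarrow> \<phi> i x \<in> carrier N" and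
    \<phi>_of: "\<And>n z. i \<in> I \<Longrightarrow> n \<in> carrier N \<Longrightarrow> z \<in> carrier M \<Longrightarrow>
      \<phi> i (frag_of (n, z)) = c i z \<odot>\<^bsub>N\<^esub> n" and
    \<psi>_tsub: "\<And>x. i \<in> I \<Longrightarrow> x \<in> P.tsub \<Longrightarrow> \<psi> i x = \<zero>\<^bsub>P\<^esub>" and
    \<psi>_F: "\<And>x. i \<in> I \<Longrightarrow> x \<in> carrier N.FA \<Longrightarrow> \<psi> i (F x) = f (\<phi> i x)" for i
    using Q[of i] unfolding Q_def by blast+
  have \<phi>_zero: "\<phi> i 0 = \<zero>\<^bsub>N\<^esub>" if "i \<in> I" for i
    using \<phi>_diff[OF that, of 0 0] \<phi>_carrier[OF that, of 0] by (simp add: N.N.M.minus_eq N.N.M.r_neg)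
  \<comment> \<open>On a generator, expanding \<open>z\<close> in the dual basis and moving the
    scalars \<open>c i z\<close> across the tensor sign turns \<open>n \<otimes> z\<close> into the
    sum of the \<open>(c i z n) \<otimes> b i\<close>, whose left factors are the contractions.
    Differences extend this to all representatives.\<close>
  have recover: "x - (\<Sum>i\<in>I. frag_of (\<phi> i x, b i)) \<in> N.tsub" if "x \<in> carrier N.FA" for x
  proof -
    have "Poly_Mapping.keys x \<subseteq> carrier N \<times> carrier M" using that by simp
    then show ?thesis
    proof (induction x rule: free_Abelian_group_induct[consumes 1, case_names zero diff of])
      case zero
      have "(\<Sum>i\<in>I. frag_of (\<phi> i 0, b i)) \<in> N.tsub"
        using b by (intro N.tsub_sum) (simp add: \<phi>_zero N.tsub_zero_left)
      then show ?case using N.tsub_uminus by simp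
    next
      case (diff x y)
      have "(\<Sum>i\<in>I. frag_of (\<phi> i (x - y), b i) - (frag_of (\<phi> i x, b i) - frag_of (\<phi> i y, b i)))
        \<in> N.tsub"
        using b diff by (intro N.tsub_sum) (simp add: \<phi>_diff N.tsub_diff_left \<phi>_carrier)
      then have "(x - (\<Sum>i\<in>I. frag_of (\<phi> i x, b i))) - (y - (\<Sum>i\<in>I. frag_of (\<phi> i y, b i))) -
        (\<Sum>i\<in>I. frag_of (\<phi> i (x - y), b i) - (frag_of (\<phi> i x, b i) - frag_of (\<phi> i y, b i)))
        \<in> N.tsub"
        using N.tsub_diff[OF N.tsub_diff] diff by blast
      then show ?case by (simp add: sum_subtractf sum.distrib algebra_simps)
    next
      case (of a)
      then obtain n z where a: "a = (n, z)" and n: "n \<in> carrier N" and z: "z \<in> carrier M" by auto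
      have cz: "c i z \<in> carrier R" if "i \<in> I" for i using c that z by auto
      have "frag_of (n, \<Oplus>\<^bsub>M\<^esub>i\<in>I. c i z \<odot>\<^bsub>M\<^esub> b i) - (\<Sum>i\<in>I. frag_of (n, c i z \<odot>\<^bsub>M\<^esub> b i)) \<in> N.tsub"
        using I n b cz by (intro N.tsub_finsum_right) auto
      then have "frag_of a - (\<Sum>i\<in>I. frag_of (n, c i z \<odot>\<^bsub>M\<^esub> b i)) \<in> N.tsub"
        using dual[OF z] a by simp
      moreover have "(\<Sum>i\<in>I. frag_of (\<phi> i (frag_of a), b i) - frag_of (n, c i z \<odot>\<^bsub>M\<^esub> b i)) \<in> N.tsub"
        using n b cz z by (intro N.tsub_sum) (simp add: a \<phi>_of N.tsub_smult)
      ultimately have "frag_of a - (\<Sum>i\<in>I. frag_of (n, c i z \<odot>\<^bsub>M\<^esub> b i)) -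
        (\<Sum>i\<in>I. frag_of (\<phi> i (frag_of a), b i) - frag_of (n, c i z \<odot>\<^bsub>M\<^esub> b i)) \<in> N.tsub"
        by (rule N.tsub_diff)
      then show ?case by (simp add: sum_subtractf)
    qed
  qed
  \<comment> \<open>The contractions of \<open>F x\<close> vanish, so by injectivity of
    \<open>f\<close> those of \<open>x\<close> vanish, and by \<open>recover\<close> these determine
    \<open>x\<close> modulo the relations.\<close>
  have reflect: "x \<in> N.tsub" if x: "x \<in> carrier N.FA" and Fx: "F x \<in> P.tsub" for x
  proof -
    have "\<phi> i x = \<zero>\<^bsub>N\<^esub>" if i: "i \<in> I" for i
    proof -
      have "f (\<phi> i x) = \<zero>\<^bsub>P\<^esub>" using \<psi>_F[OF i x] \<psi>_tsub[OF i Fx] by simp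
      also have "\<zero>\<^bsub>P\<^esub> = f \<zero>\<^bsub>N\<^esub>"
        using \<psi>_F[OF i, of 0] \<psi>_tsub[OF i P.tsub_zero] \<phi>_zero[OF i] by (simp add: F_def)
      finally show ?thesis using inj i x \<phi>_carrier by (auto dest: inj_onD)
    qed
    then have "(\<Sum>i\<in>I. frag_of (\<phi> i x, b i)) \<in> N.tsub"
      using b by (intro N.tsub_sum) (simp add: N.tsub_zero_left)
    from N.tsub_add[OF recover[OF x] this] show ?thesis by simp
  qed
  have map_eq: "tensor_map R P M f C = (\<Union>x\<in>C. (\<lambda>h. h + F x) ` P.tsub)" for C
    by (auto simp: tensor_map_def F_def r_coset_def)
  show "inj_on (tensor_map R P M f) (carrier (tensor_product R N M))"
  proof (rule inj_onI)
    fix C D assume C: "C \<in> carrier (tensor_product R N M)" and D: "D \<in> carrier (tensor_product R N M)"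
      and eq: "tensor_map R P M f C = tensor_map R P M f D"
    obtain x where x: "x \<in> carrier N.FA" "C = (\<lambda>h. h + x) ` N.tsub"
      using C unfolding N.carrier_tensor_product by auto
    obtain y where y: "y \<in> carrier N.FA" "D = (\<lambda>h. h + y) ` N.tsub"
      using D unfolding N.carrier_tensor_product by auto
    have "x \<in> C"
      unfolding x by (rule image_eqI[OF _ N.tsub_zero]) simp
    moreover have "F x \<in> (\<lambda>h. h + F x) ` P.tsub"
      by (rule image_eqI[OF _ P.tsub_zero]) simp
    ultimately have "F x \<in> tensor_map R P M f C"
      unfolding map_eq by (rule UN_I)
    \<comment> \<open>It suffices to find one member of \<open>D\<close> whose image coset contains
      \<open>F x\<close>; that member differs from \<open>y\<close> by an element of
      \<open>N.tsub\<close>.\<close>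
    then obtain d where d: "d \<in> D" "F x \<in> (\<lambda>h. h + F d) ` P.tsub"
      unfolding eq unfolding map_eq by (rule UN_E)
    from d(1) obtain g where g: "g \<in> N.tsub" and dg: "d = g + y"
      unfolding y by (rule imageE)
    from d(2) obtain k where k: "k \<in> P.tsub" "F x = k + F (g + y)"
      unfolding dg by (rule imageE)
    have "F (x - (g + y)) = F x - F (g + y)"
      unfolding F_def by (rule frag_extend_diff)
    then have "F (x - (g + y)) \<in> P.tsub"
      using k by simp
    moreover have "x - (g + y) \<in> carrier N.FA"
      using x(1) y(1) N.tsub_subset[OF g] keys_diff[of x "g + y"] keys_add[of g y]
      unfolding carrier_free_Abelian_group_iff by (meson Un_least order.trans)
    ultimately have "x - (g + y) \<in> N.tsub" by (intro reflect)
    from N.tsub_add[OF this g] have "x - y \<in> N.tsub" by simp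
    then show "C = D" using x y N.coset_eq by blast
  qed
qed


section \<open>Factorizations of cyclic groups by boxes\<close>

definition multiples :: "rat \<Rightarrow> rat set" where
  "multiples h = range (\<lambda>m::int. of_int m * h)"

lemma zero_multiples [simp]: "0 \<in> multiples h"
  unfolding multiples_def by (rule range_eqI[of _ _ 0]) simp

lemma multiples_self [simp]: "h \<in> multiples h"
  unfolding multiples_def by (rule range_eqI[of _ _ 1]) simp

lemma multiples_add: "x \<in> multiples h \<Longrightarrow> y \<in> multiples h \<Longrightarrow> x + y \<in> multiples h"
  unfolding multiples_def by (auto simp flip: distrib_right of_int_add)

lemma multiples_of_int_mult: "x \<in> multiples h \<Longrightarrow> of_int m * x \<in> multiples h"
  unfolding multiples_def by (auto simp flip: mult.assoc of_int_mult)

lemma multiples_of_nat_mult: "x \<in> multiples h \<Longrightarrow> of_nat m * x \<in> multiples h"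
  using multiples_of_int_mult[of x h "int m"] by simp

lemma multiples_diff: "x \<in> multiples h \<Longrightarrow> y \<in> multiples h \<Longrightarrow> x - y \<in> multiples h"
  using multiples_add[of x h "- y"] multiples_of_int_mult[of y h "- 1"] by simp

lemma multiples_trans: "x \<in> multiples h \<Longrightarrow> h \<in> multiples g \<Longrightarrow> x \<in> multiples g"
  using multiples_of_int_mult[of h g] by (auto simp: multiples_def)

text \<open>The subgroup generated by \<open>h\<close> and \<open>x\<close> is cyclic: over a common
  denominator \<open>d\<close> its generator is the gcd of the numerators divided by
  \<open>d\<close>, and Bezout expresses it by \<open>h\<close> and \<open>x\<close>. Cyclicity is
  what provides a character with this subgroup as kernel.\<close>

lemma multiples_gcd:
  assumes "0 < h"
  obtains g where "0 < g" "h \<in> multiples g" "x \<in> multiples g"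
    "\<And>m::int. \<exists>a b::int. of_int m * g = of_int a * h + of_int b * x"
proof -
  obtain p1 q1 where h: "h = of_int p1 / of_int q1" "q1 > 0"
    using quotient_of_div[of h] quotient_of_denom_pos[of h] by (cases "quotient_of h") auto
  obtain p2 q2 where x: "x = of_int p2 / of_int q2" "q2 > 0"
    using quotient_of_div[of x] quotient_of_denom_pos[of x] by (cases "quotient_of x") auto
  define p q d where "p = p1 * q2" and "q = p2 * q1" and "d = q1 * q2"
  have d: "d > 0" "h = of_int p / of_int d" "x = of_int q / of_int d"
    using h x by (simp_all add: p_def q_def d_def)
  have p: "p > 0" using d assms by (simp add: zero_less_divide_iff)
  define g where "g = of_int (gcd p q) / (of_int d :: rat)"
  obtain u v where uv: "u * p + v * q = gcd p q" using bezout_int by blast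
  show thesis
  proof (rule that)
    show "0 < g" using d p by (simp add: g_def)
    have "z * of_int (gcd p q) / of_int d = z * g" for z by (simp add: g_def)
    moreover have "of_int p = of_int (p div gcd p q) * (of_int (gcd p q) :: rat)"
      "of_int q = of_int (q div gcd p q) * (of_int (gcd p q) :: rat)"
      by (simp_all flip: of_int_mult)
    ultimately show "h \<in> multiples g" "x \<in> multiples g"
      unfolding multiples_def d by (metis rangeI)+
    have "g = of_int u * h + of_int v * x"
      unfolding g_def uv[symmetric] by (simp add: d add_divide_distrib)
    then have "of_int m * g = of_int (m * u) * h + of_int (m * v) * x" for m
      by (simp add: algebra_simps)
    then show "\<exists>a b::int. of_int m * g = of_int a * h + of_int b * x" for m
      by blast
  qed
qed

text \<open>For nonzero \<open>h\<close>, the character of the additive group of rationals with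
  kernel \<open>multiples h\<close>.\<close>

definition rat_character :: "rat \<Rightarrow> rat \<Rightarrow> complex" where
  "rat_character h t = cis (2 * pi * of_rat (t / h))"

lemma rat_character_add: "rat_character h (x + y) = rat_character h x * rat_character h y"
  by (simp add: rat_character_def cis_mult add_divide_distrib of_rat_add distrib_left)

lemma rat_character_of_nat_mult: "rat_character h (of_nat n * x) = rat_character h x ^ n"
  by (simp add: rat_character_def DeMoivre of_rat_mult mult_ac of_rat_divide)

lemma rat_character_sum: "rat_character h (\<Sum>i\<in>I. f i) = (\<Prod>i\<in>I. rat_character h (f i))"
proof (induction I rule: infinite_finite_induct)
qed (auto simp: rat_character_add, auto simp: rat_character_def)

lemma rat_character_eq_1_iff:
  assumes "h \<noteq> 0"
  shows "rat_character h t = 1 \<longleftrightarrow> t \<in> multiples h"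
proof
  assume "t \<in> multiples h"
  then obtain m :: int where "t / h = of_int m" using assms by (auto simp: multiples_def)
  then show "rat_character h t = 1"
    unfolding rat_character_def by (simp add: cis_multiple_2pi)
next
  assume "rat_character h t = 1"
  then have "cos (2 * pi * of_rat (t / h)) = 1"
    by (simp add: rat_character_def complex_eq_iff)
  then obtain m :: int where "2 * pi * of_rat (t / h) = of_int m * 2 * pi"
    using cos_one_2pi_int by blast
  then have "(of_rat (t / h) :: real) = of_rat (of_int m)" by simp
  then have "t / h = of_int m" by (simp only: of_rat_eq_iff)
  then have "t = of_int m * h" using assms by (simp add: field_simps)
  then show "t \<in> multiples h" by (auto simp: multiples_def)
qed


text \<open>Only exponents occur here, no coefficients. Over the semigroup of multiples of
  \<open>s\<close>, an exponent is Apery exactly if subtracting a single \<open>s\<close> leaves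
  \<open>S'\<close>; hence the set in \<open>box_bij\<close>.\<close>

locale apery_box =
  fixes S' :: "rat set" and s :: rat and n :: nat and \<sigma> :: "nat \<Rightarrow> rat" and \<beta> :: "nat \<Rightarrow> nat"
  assumes s_pos: "0 < s" and s_mem: "s \<in> S'"
    and zero_mem: "0 \<in> S'" and add_mem: "\<And>a b. a \<in> S' \<Longrightarrow> b \<in> S' \<Longrightarrow> a + b \<in> S'"
    and nonneg: "\<And>a. a \<in> S' \<Longrightarrow> 0 \<le> a"
    and \<sigma>_mem: "\<And>i. i < n \<Longrightarrow> \<sigma> i \<in> S'" and \<sigma>_pos: "\<And>i. i < n \<Longrightarrow> 0 < \<sigma> i"
    and \<beta>_pos: "\<And>i. i < n \<Longrightarrow> 0 < \<beta> i"
    and box_bij: "bij_betw (\<lambda>l. \<Sum>i<n. of_nat (l i) * \<sigma> i) (\<Pi>\<^sub>E i\<in>{..<n}. {..<\<beta> i})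
      {t \<in> S'. t - s \<notin> S'}"
begin

section \<open>The Apery exponents as representatives modulo \<open>s\<close>\<close>

definition W where "W = {t \<in> S'. t - s \<notin> S'}"

lemma W_subset: "w \<in> W \<Longrightarrow> w \<in> S'"
  by (simp add: W_def)

lemma finite_W: "finite W"
  using box_bij unfolding W_def by (rule bij_betw_finite[THEN iffD1]) (simp add: finite_PiE)

lemma of_nat_mult_mem: "a \<in> S' \<Longrightarrow> of_nat k * a \<in> S'"
  by (induction k) (auto simp: zero_mem distrib_right intro: add_mem)

text \<open>Subtract \<open>s\<close> as long as the result stays in \<open>S'\<close>. Elements of
  \<open>S'\<close> are nonnegative, so the floor of \<open>t / s\<close> drops each time and the
  process ends.\<close>

lemma W_decomposition:
  assumes "t \<in> S'"
  obtains k w where "w \<in> W" "t = of_nat k * s + w"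
proof -
  have "\<exists>k w. w \<in> W \<and> t = of_nat k * s + w" using assms
  proof (induction "nat \<lfloor>t / s\<rfloor>" arbitrary: t rule: less_induct)
    case less
    show ?case
    proof (cases "t - s \<in> S'")
      case False
      then have "t \<in> W" using less.prems by (simp add: W_def)
      then show ?thesis by (intro exI[of _ 0] exI[of _ t]) simp
    next
      case True
      have "(t - s) / s = t / s - 1" using s_pos by (simp add: field_simps)
      moreover have "0 \<le> (t - s) / s" using nonneg[OF True] s_pos by simp
      ultimately have "nat \<lfloor>(t - s) / s\<rfloor> < nat \<lfloor>t / s\<rfloor>" by linarith
      from less.hyps[OF this True] obtain k w where "w \<in> W" "t - s = of_nat k * s + w" by blast
      then have "w \<in> W \<and> t = of_nat (Suc k) * s + w" by (simp add: algebra_simps)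
      then show ?thesis by blast
    qed
  qed
  then show thesis using that by blast
qed

lemma W_minimal:
  assumes "w \<in> W" "w = of_nat k * s + t" "t \<in> S'"
  shows "k = 0"
proof (cases k)
  case (Suc j)
  then have "w - s = of_nat j * s + t" using assms(2) by (simp add: algebra_simps)
  moreover have "of_nat j * s + t \<in> S'" using assms s_mem by (intro add_mem of_nat_mult_mem)
  ultimately have "w - s \<in> S'" by (rule ssubst)
  then show ?thesis using assms by (simp add: W_def)
qed

text \<open>Of two congruent elements one is the other plus a nonnegative multiple of
  \<open>s\<close>, and \<open>W_minimal\<close> makes this multiple zero.\<close>

lemma W_unique:
  assumes "w \<in> W" "w' \<in> W" "w - w' \<in> multiples s"
  shows "w = w'"
proof -
  obtain m :: int where m: "w - w' = of_int m * s" using assms by (auto simp: multiples_def)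
  show ?thesis
  proof (cases "m \<ge> 0")
    case True
    then have "w = of_nat (nat m) * s + w'" using m by simp
    then show ?thesis using W_minimal[of w "nat m" w'] assms W_subset by simp
  next
    case False
    then have "w' = of_nat (nat (- m)) * s + w" using m by simp
    then show ?thesis using W_minimal[of w' "nat (- m)" w] assms W_subset by simp
  qed
qed

definition apery_part :: "rat \<Rightarrow> rat" where
  "apery_part t = (SOME w. w \<in> W \<and> (\<exists>k::nat. t = of_nat k * s + w))"

lemma apery_part:
  assumes "t \<in> S'"
  shows "apery_part t \<in> W" "\<exists>k::nat. t = of_nat k * s + apery_part t"
proof -
  have "\<exists>w. w \<in> W \<and> (\<exists>k::nat. t = of_nat k * s + w)"
    using W_decomposition[OF assms] by metis
  from someI_ex[OF this] show "apery_part t \<in> W" "\<exists>k::nat. t = of_nat k * s + apery_part t"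
    unfolding apery_part_def by auto
qed

lemma apery_part_multiples: "t \<in> S' \<Longrightarrow> t - apery_part t \<in> multiples s"
proof -
  assume "t \<in> S'"
  then obtain k where "t = of_nat k * s + apery_part t" using apery_part(2) by blast
  then have "t - apery_part t = of_nat k * s" by simp
  then show ?thesis using multiples_of_nat_mult[of s s] by simp
qed

text \<open>Hajos' theorem for a cyclic group of classes modulo \<open>s\<close>: a faithful character sums to zero
  over the representatives \<open>W\<close>, and this sum factors along the box.\<close>

lemma exists_multiple:
  assumes h: "h \<noteq> 0" "s \<in> multiples h" and i0: "i0 < n" "\<sigma> i0 \<notin> multiples h"
  shows "\<exists>i<n. \<sigma> i \<notin> multiples h \<and> of_nat (\<beta> i) * \<sigma> i \<in> multiples h"
proof -
  let ?\<chi> = "rat_character h"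
  \<comment> \<open>Translation by \<open>\<sigma> i0\<close> on the classes modulo
    \<open>s\<close>, transported to the representatives; being injective on a finite set, it
    permutes \<open>W\<close>.\<close>
  define f where "f = (\<lambda>w. apery_part (w + \<sigma> i0))"
  have mem: "w + \<sigma> i0 \<in> S'" if "w \<in> W" for w
    using that W_subset \<sigma>_mem i0 add_mem by blast
  have "inj_on f W"
  proof (rule inj_onI)
    fix w w' assume w: "w \<in> W" "w' \<in> W" "f w = f w'"
    have "(w + \<sigma> i0 - f w) - (w' + \<sigma> i0 - f w') \<in> multiples s"
      unfolding f_def using w mem by (intro multiples_diff apery_part_multiples) auto
    then show "w = w'" using w by (intro W_unique) auto
  qed
  moreover have "f ` W \<subseteq> W" using apery_part(1) mem by (auto simp: f_def)
  ultimately have f: "bij_betw f W W"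
    using finite_W endo_inj_surj[of W f] by (auto simp: bij_betw_def)
  \<comment> \<open>Passing to the representative changes an exponent by a multiple of
    \<open>s\<close>, hence of \<open>h\<close>, where the character is 1. So the permutation
    multiplies the sum by the character value at \<open>\<sigma> i0\<close>, which is not 1, and the
    sum must vanish.\<close>
  have \<chi>f: "?\<chi> (f w) = ?\<chi> w * ?\<chi> (\<sigma> i0)" if "w \<in> W" for w
  proof -
    have "(w + \<sigma> i0) - f w \<in> multiples h"
      using apery_part_multiples[OF mem[OF that]] h multiples_trans by (auto simp: f_def)
    then have "?\<chi> ((w + \<sigma> i0) - f w) = 1" using h by (simp add: rat_character_eq_1_iff)
    then have "?\<chi> (((w + \<sigma> i0) - f w) + f w) = ?\<chi> (f w)"
      by (simp only: rat_character_add mult_1)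
    then show ?thesis by (simp add: rat_character_add)
  qed
  have "(\<Sum>w\<in>W. ?\<chi> w) = (\<Sum>w\<in>W. ?\<chi> (f w))"
    using sum.reindex_bij_betw[OF f, of ?\<chi>] by simp
  also have "\<dots> = (\<Sum>w\<in>W. ?\<chi> w) * ?\<chi> (\<sigma> i0)"
    by (simp add: \<chi>f sum_distrib_right)
  finally have "(\<Sum>w\<in>W. ?\<chi> w) = 0"
    using i0 h by (auto simp: rat_character_eq_1_iff)
  also have "(\<Sum>w\<in>W. ?\<chi> w) =
      (\<Sum>l\<in>(\<Pi>\<^sub>E i\<in>{..<n}. {..<\<beta> i}). ?\<chi> (\<Sum>i<n. of_nat (l i) * \<sigma> i))"
    using sum.reindex_bij_betw[OF box_bij, of ?\<chi>] by (simp add: W_def)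
  also have "\<dots> = (\<Sum>l\<in>(\<Pi>\<^sub>E i\<in>{..<n}. {..<\<beta> i}). \<Prod>i<n. ?\<chi> (\<sigma> i) ^ l i)"
    by (simp add: rat_character_sum rat_character_of_nat_mult)
  also have "\<dots> = (\<Prod>i<n. \<Sum>l<\<beta> i. ?\<chi> (\<sigma> i) ^ l)"
    by (subst prod_sum_PiE) auto
  finally obtain i where i: "i < n" "(\<Sum>l<\<beta> i. ?\<chi> (\<sigma> i) ^ l) = 0"
    by auto
  \<comment> \<open>At the value 1 the vanishing factor would equal \<open>\<beta> i\<close>, which
    is positive.\<close>
  have neq: "?\<chi> (\<sigma> i) \<noteq> 1" using i \<beta>_pos[of i] by auto
  have "?\<chi> (\<sigma> i) ^ \<beta> i = 1"
    using i(2) neq by (simp add: geometric_sum)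
  then show ?thesis
    using i neq h by (auto simp: rat_character_eq_1_iff simp flip: rat_character_of_nat_mult)
qed

text \<open>The exponent of \<open>u\<close> in the image of \<open>Y^e\<close>.\<close>

definition weight :: "(nat \<Rightarrow>\<^sub>0 nat) \<Rightarrow> rat" where
  "weight e = (\<Sum>i<n. of_nat (Poly_Mapping.lookup e i) * \<sigma> i)"

definition exponents :: "(nat \<Rightarrow>\<^sub>0 nat) set" where
  "exponents = {e. Poly_Mapping.keys e \<subseteq> {..<n}}"

definition box :: "(nat \<Rightarrow>\<^sub>0 nat) set" where
  "box = {e \<in> exponents. \<forall>i<n. Poly_Mapping.lookup e i < \<beta> i}"

lemma weight_zero [simp]: "weight 0 = 0"
  by (simp add: weight_def)

lemma weight_add: "weight (e + f) = weight e + weight f"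
  by (simp add: weight_def lookup_add distrib_right sum.distrib)

lemma weight_single: "i < n \<Longrightarrow> weight (Poly_Mapping.single i m) = of_nat m * \<sigma> i"
  unfolding weight_def by (subst sum.remove[of _ i]) (auto simp: lookup_single when_def intro!: sum.neutral)

lemma keys_add_nat: "Poly_Mapping.keys (e + f) = Poly_Mapping.keys e \<union> Poly_Mapping.keys f"
  for e f :: "nat \<Rightarrow>\<^sub>0 nat"
  by (auto simp: in_keys_iff lookup_add)

lemma exponents_add [simp]: "e + f \<in> exponents \<longleftrightarrow> e \<in> exponents \<and> f \<in> exponents"
  by (simp add: exponents_def keys_add_nat)

lemma exponents_zero [simp]: "0 \<in> exponents"
  by (simp add: exponents_def)

lemma exponents_single [simp]: "i < n \<Longrightarrow> Poly_Mapping.single i m \<in> exponents"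
  by (simp add: exponents_def)

lemma box_exponents: "e \<in> box \<Longrightarrow> e \<in> exponents"
  by (simp add: box_def)

text \<open>Transports \<open>box_bij\<close> from extensional functions to the finitely supported
  exponents of the power series ring.\<close>

lemma weight_box: "bij_betw weight box W"
proof -
  have 1: "bij_betw (\<lambda>e. restrict (Poly_Mapping.lookup e) {..<n}) box (\<Pi>\<^sub>E i\<in>{..<n}. {..<\<beta> i})"
  proof (rule bij_betw_imageI)
    show "inj_on (\<lambda>e. restrict (Poly_Mapping.lookup e) {..<n}) box"
    proof (rule inj_onI, rule poly_mapping_eqI)
      fix e f :: "nat \<Rightarrow>\<^sub>0 nat" and i
      assume *: "e \<in> box" "f \<in> box"
        "restrict (Poly_Mapping.lookup e) {..<n} = restrict (Poly_Mapping.lookup f) {..<n}"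
      show "Poly_Mapping.lookup e i = Poly_Mapping.lookup f i"
      proof (cases "i < n")
        case True
        then show ?thesis using fun_cong[OF *(3), of i] by simp
      next
        case False
        then have "i \<notin> Poly_Mapping.keys e" "i \<notin> Poly_Mapping.keys f"
          using * by (auto simp: box_def exponents_def)
        then show ?thesis by (simp add: in_keys_iff)
      qed
    qed
    show "(\<lambda>e. restrict (Poly_Mapping.lookup e) {..<n}) ` box = (\<Pi>\<^sub>E i\<in>{..<n}. {..<\<beta> i})"
    proof (intro equalityI subsetI)
      fix l assume "l \<in> (\<lambda>e. restrict (Poly_Mapping.lookup e) {..<n}) ` box"
      then show "l \<in> (\<Pi>\<^sub>E i\<in>{..<n}. {..<\<beta> i})"
        by (auto simp: box_def split: if_splits)
    next
      fix l assume l: "l \<in> (\<Pi>\<^sub>E i\<in>{..<n}. {..<\<beta> i})"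
      define e where "e = Abs_poly_mapping (\<lambda>i. if i < n then l i else 0)"
      have e: "Poly_Mapping.lookup e = (\<lambda>i. if i < n then l i else 0)"
        unfolding e_def by (rule lookup_Abs_poly_mapping) (rule finite_subset[of _ "{..<n}"], auto)
      have "l i < \<beta> i" if "i < n" for i using PiE_mem[OF l, of i] that by simp
      then have "e \<in> box" by (auto simp: box_def exponents_def in_keys_iff e intro: ccontr)
      moreover have "l = restrict (Poly_Mapping.lookup e) {..<n}"
        using PiE_arb[OF l] by (auto simp: e fun_eq_iff)
      ultimately show "l \<in> (\<lambda>e. restrict (Poly_Mapping.lookup e) {..<n}) ` box" by blast
    qed
  qed
  have "bij_betw weight box W \<longleftrightarrow> bij_betw ((\<lambda>l. \<Sum>i<n. of_nat (l i) * \<sigma> i) \<circ>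
      (\<lambda>e. restrict (Poly_Mapping.lookup e) {..<n})) box W"
    by (rule bij_betw_cong) (simp add: weight_def)
  then show ?thesis
    using bij_betw_trans[OF 1 box_bij[folded W_def]] by (rule iffD2)
qed

lemma weight_eq_mod_box:
  assumes "e \<in> box" "f \<in> box" "weight e - weight f \<in> multiples s"
  shows "e = f"
  using weight_box W_unique[of "weight e" "weight f"] assms
  by (auto simp: bij_betw_def dest: inj_onD)

lemma box_decomposition:
  assumes "t \<in> S'"
  obtains k e where "e \<in> box" "t = of_nat k * s + weight e"
proof -
  obtain k w where w: "w \<in> W" "t = of_nat k * s + w" using W_decomposition[OF assms] .
  then have "w \<in> weight ` box" using weight_box by (simp add: bij_betw_def)
  then obtain e where e: "e \<in> box" "w = weight e" by (rule imageE)
  show thesis using w e by (intro that[of e k]) simp_all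
qed

lemma weight_mem: "weight e \<in> S'"
proof -
  have "(\<Sum>i\<in>I. of_nat (Poly_Mapping.lookup e i) * \<sigma> i) \<in> S'" if "finite I" "I \<subseteq> {..<n}" for I
    using that by (induction I) (auto simp: zero_mem intro!: add_mem of_nat_mult_mem \<sigma>_mem)
  then show ?thesis unfolding weight_def by simp
qed

text \<open>\<open>of_nat (\<beta> j) * \<sigma> j\<close> in normal form, which gives the relation
  \<open>Y\<^sub>j^\<beta>\<^sub>j = u^(krel j * s) Y^(lrel j)\<close> of the algebra.\<close>

definition rel_normal_form :: "nat \<Rightarrow> nat \<times> (nat \<Rightarrow>\<^sub>0 nat)" where
  "rel_normal_form j = (SOME p. snd p \<in> box \<and>
     of_nat (\<beta> j) * \<sigma> j = of_nat (fst p) * s + weight (snd p))"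

definition "krel j = fst (rel_normal_form j)"
definition "lrel j = snd (rel_normal_form j)"

lemma rel_normal_form:
  assumes "j < n"
  shows "lrel j \<in> box" "of_nat (\<beta> j) * \<sigma> j = of_nat (krel j) * s + weight (lrel j)"
proof -
  obtain k e where "e \<in> box" "of_nat (\<beta> j) * \<sigma> j = of_nat k * s + weight e"
    using box_decomposition[OF of_nat_mult_mem[OF \<sigma>_mem[OF assms]]] .
  then have "\<exists>p. snd p \<in> box \<and> of_nat (\<beta> j) * \<sigma> j = of_nat (fst p) * s + weight (snd p)"
    by auto
  from someI_ex[OF this] show "lrel j \<in> box"
      "of_nat (\<beta> j) * \<sigma> j = of_nat (krel j) * s + weight (lrel j)"
    by (auto simp: lrel_def krel_def rel_normal_form_def)
qed

text \<open>The pair \<open>(k, e)\<close> stands for the monomial \<open>u^(k * s) Y^e\<close>.\<close>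

inductive mono_equiv :: "nat \<times> (nat \<Rightarrow>\<^sub>0 nat) \<Rightarrow> nat \<times> (nat \<Rightarrow>\<^sub>0 nat) \<Rightarrow> bool" where
  refl: "e \<in> exponents \<Longrightarrow> mono_equiv (k, e) (k, e)"
| sym: "mono_equiv p q \<Longrightarrow> mono_equiv q p"
| trans: "mono_equiv p q \<Longrightarrow> mono_equiv q r \<Longrightarrow> mono_equiv p r"
| step: "j < n \<Longrightarrow> e \<in> exponents \<Longrightarrow>
    mono_equiv (k, e + Poly_Mapping.single j (\<beta> j)) (k + krel j, e + lrel j)"

lemma mono_equiv_shift:
  assumes "mono_equiv p q" "f \<in> exponents"
  shows "mono_equiv (fst p + a, snd p + f) (fst q + a, snd q + f)"
  using assms
proof (induction rule: mono_equiv.induct)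
  case (step j e k)
  from mono_equiv.step[OF step(1), of "e + f" "k + a"] step show ?case
    by (simp add: ac_simps)
qed (auto intro: mono_equiv.intros)

text \<open>By the choice of \<open>krel\<close> and \<open>lrel\<close> the relations are
  homogeneous, so rewriting preserves the image of a monomial.\<close>

lemma mono_equiv_weight:
  "mono_equiv p q \<Longrightarrow> of_nat (fst p) * s + weight (snd p) = of_nat (fst q) * s + weight (snd q)"
  by (induction rule: mono_equiv.induct)
    (auto simp: weight_add weight_single rel_normal_form distrib_right)

text \<open>The induction invariant. \<open>J\<close> holds the variables already ordered, and
  \<open>multiples h\<close> is the subgroup generated by \<open>s\<close> and the
  \<open>\<sigma> i\<close> with \<open>i\<close> in \<open>J\<close>. The last two clauses say that
  the box over \<open>J\<close> represents this subgroup modulo \<open>s\<close>, and that the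
  relations reduce every monomial in the variables of \<open>J\<close> to that box.\<close>

definition reduced_on :: "nat set \<Rightarrow> rat \<Rightarrow> bool" where
  "reduced_on J h \<longleftrightarrow> 0 < h \<and> s \<in> multiples h \<and> (\<forall>i\<in>J. \<sigma> i \<in> multiples h) \<and>
     (\<forall>m::int. \<exists>e\<in>box. Poly_Mapping.keys e \<subseteq> J \<and> of_int m * h - weight e \<in> multiples s) \<and>
     (\<forall>e. Poly_Mapping.keys e \<subseteq> J \<longrightarrow> (\<exists>k. \<exists>f\<in>box. Poly_Mapping.keys f \<subseteq> J \<and> mono_equiv (0, e) (k, f)))"

lemma box_zero: "0 \<in> box"
  by (simp add: box_def \<beta>_pos)

lemma box_add_single:
  assumes "e \<in> box" "Poly_Mapping.keys e \<subseteq> J" "j \<notin> J" "j < n" "m < \<beta> j"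
  shows "e + Poly_Mapping.single j m \<in> box"
proof -
  have "Poly_Mapping.lookup e j = 0" using assms by (auto simp: in_keys_iff)
  then show ?thesis
    using assms by (auto simp: box_def lookup_add lookup_single when_def)
qed

text \<open>Relation \<open>j\<close> turns out triangular: it replaces
  \<open>Y_j^(\<beta> j)\<close> by a power of \<open>u\<close> times a monomial in the variables of
  \<open>J\<close> alone, and such monomials can already be reduced.\<close>

lemma reduced_on_insert:
  assumes red: "reduced_on J h" and J: "J \<subseteq> {..<n}" and j: "j \<in> {..<n} - J"
    and \<beta>\<sigma>: "of_nat (\<beta> j) * \<sigma> j \<in> multiples h"
  shows "\<exists>g. reduced_on (insert j J) g"
proof -
  have h: "0 < h" "s \<in> multiples h" "\<And>i. i \<in> J \<Longrightarrow> \<sigma> i \<in> multiples h"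
    and repr: "\<And>t. t \<in> multiples h \<Longrightarrow> \<exists>e\<in>box. Poly_Mapping.keys e \<subseteq> J \<and> t - weight e \<in> multiples s"
    and reduce: "\<And>e. Poly_Mapping.keys e \<subseteq> J \<Longrightarrow>
      \<exists>k. \<exists>f\<in>box. Poly_Mapping.keys f \<subseteq> J \<and> mono_equiv (0, e) (k, f)"
    using red unfolding reduced_on_def by (auto simp: multiples_def)
  obtain g where g: "0 < g" "h \<in> multiples g" "\<sigma> j \<in> multiples g"
    "\<And>m::int. \<exists>a b::int. of_int m * g = of_int a * h + of_int b * \<sigma> j"
    using multiples_gcd[OF h(1), of "\<sigma> j"] by metis
  \<comment> \<open>The class of \<open>\<beta> j * \<sigma> j\<close> has a representative in the
    box over \<open>J\<close>, and uniqueness of representatives in the whole box identifies it with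
    \<open>lrel j\<close>.\<close>
  have lrel: "Poly_Mapping.keys (lrel j) \<subseteq> J"
  proof -
    obtain e where e: "e \<in> box" "Poly_Mapping.keys e \<subseteq> J"
      "of_nat (\<beta> j) * \<sigma> j - weight e \<in> multiples s"
      using repr[OF \<beta>\<sigma>] by blast
    have "of_nat (\<beta> j) * \<sigma> j - weight (lrel j) \<in> multiples s"
      using rel_normal_form[of j] j multiples_of_nat_mult[of s s] by simp
    from multiples_diff[OF e(3) this] have "weight (lrel j) - weight e \<in> multiples s" by simp
    then have "lrel j = e" using weight_eq_mod_box e(1) rel_normal_form(1) j by auto
    then show ?thesis using e by simp
  qed
  have 1: "\<exists>e\<in>box. Poly_Mapping.keys e \<subseteq> insert j J \<and> of_int m * g - weight e \<in> multiples s" for m :: int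
  proof -
    obtain a b :: int where ab: "of_int m * g = of_int a * h + of_int b * \<sigma> j" using g(4) by blast
    \<comment> \<open>Division with remainder: \<open>r\<close> becomes the exponent of
      \<open>Y_j\<close>, while \<open>q\<close> copies of \<open>\<beta> j * \<sigma> j\<close>
      join the part in \<open>multiples h\<close>.\<close>
    define q r where "q = b div int (\<beta> j)" and "r = nat (b mod int (\<beta> j))"
    have \<beta>j: "\<beta> j > 0" using \<beta>_pos j by simp
    then have r: "r < \<beta> j" by (simp add: r_def nat_less_iff)
    have "b = q * int (\<beta> j) + int r" using \<beta>j by (simp add: q_def r_def)
    then have "(of_int b :: rat) = of_int (q * int (\<beta> j) + int r)" by simp
    then have b: "(of_int b :: rat) = of_int q * of_nat (\<beta> j) + of_nat r" by simp
    have "of_int a * h + of_int q * (of_nat (\<beta> j) * \<sigma> j) \<in> multiples h"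
      using \<beta>\<sigma> by (intro multiples_add multiples_of_int_mult) auto
    then obtain e where e: "e \<in> box" "Poly_Mapping.keys e \<subseteq> J"
      "of_int a * h + of_int q * (of_nat (\<beta> j) * \<sigma> j) - weight e \<in> multiples s"
      using repr by blast
    have "e + Poly_Mapping.single j r \<in> box" using e r j by (intro box_add_single) auto
    moreover have "Poly_Mapping.keys (e + Poly_Mapping.single j r) \<subseteq> insert j J"
      using e by (auto simp: keys_add_nat)
    moreover have "of_int m * g - weight (e + Poly_Mapping.single j r) \<in> multiples s"
      using e(3) j unfolding ab b by (simp add: weight_add weight_single algebra_simps)
    ultimately show ?thesis by blast
  qed
  \<comment> \<open>Each use of relation \<open>j\<close> lowers the exponent of \<open>Y_j\<close>
    by \<open>\<beta> j\<close> and multiplies the cofactor by a monomial over \<open>J\<close>;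
    hence \<open>e\<close> is arbitrary in the induction on \<open>m\<close>.\<close>
  have 2: "\<exists>k. \<exists>f\<in>box. Poly_Mapping.keys f \<subseteq> insert j J \<and>
      mono_equiv (0, e + Poly_Mapping.single j m) (k, f)" if "Poly_Mapping.keys e \<subseteq> J" for e m
    using that
  proof (induction m arbitrary: e rule: less_induct)
    case (less m)
    show ?case
    proof (cases "m < \<beta> j")
      case True
      obtain k f where f: "f \<in> box" "Poly_Mapping.keys f \<subseteq> J" "mono_equiv (0, e) (k, f)"
        using reduce[OF less.prems] by blast
      have "mono_equiv (0, e + Poly_Mapping.single j m) (k, f + Poly_Mapping.single j m)"
        using mono_equiv_shift[OF f(3), of "Poly_Mapping.single j m" 0] j by simp
      moreover have "f + Poly_Mapping.single j m \<in> box"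
        using f True j by (intro box_add_single) auto
      moreover have "Poly_Mapping.keys (f + Poly_Mapping.single j m) \<subseteq> insert j J"
        using f by (auto simp: keys_add_nat)
      ultimately show ?thesis by blast
    next
      case False
      have \<beta>j: "\<beta> j > 0" using \<beta>_pos j by simp
      have m: "Poly_Mapping.single j m =
          Poly_Mapping.single j (m - \<beta> j) + Poly_Mapping.single j (\<beta> j)"
        using False by (simp flip: single_add)
      have "Poly_Mapping.keys (e + lrel j) \<subseteq> J" using less.prems lrel by (simp add: keys_add_nat)
      from less.IH[OF _ this, of "m - \<beta> j"] obtain k f where
        f: "f \<in> box" "Poly_Mapping.keys f \<subseteq> insert j J"
          "mono_equiv (0, e + lrel j + Poly_Mapping.single j (m - \<beta> j)) (k, f)"
        using False \<beta>j by auto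
      have "e \<in> exponents" using less.prems J by (auto simp: exponents_def)
      then have "mono_equiv (0, (e + Poly_Mapping.single j (m - \<beta> j)) + Poly_Mapping.single j (\<beta> j))
        (0 + krel j, (e + Poly_Mapping.single j (m - \<beta> j)) + lrel j)"
        using j by (intro mono_equiv.step) auto
      moreover have "mono_equiv (krel j, e + lrel j + Poly_Mapping.single j (m - \<beta> j)) (k + krel j, f)"
        using mono_equiv_shift[OF f(3), of 0 "krel j"] by simp
      ultimately have "mono_equiv (0, e + Poly_Mapping.single j m) (k + krel j, f)"
        unfolding m by (auto simp: ac_simps intro: mono_equiv.trans)
      then show ?thesis using f by blast
    qed
  qed
  have 3: "\<exists>k. \<exists>f\<in>box. Poly_Mapping.keys f \<subseteq> insert j J \<and> mono_equiv (0, e) (k, f)"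
    if e: "Poly_Mapping.keys e \<subseteq> insert j J" for e
  proof -
    define e' where "e' = e - Poly_Mapping.single j (Poly_Mapping.lookup e j)"
    have "e = e' + Poly_Mapping.single j (Poly_Mapping.lookup e j)"
      by (rule poly_mapping_eqI) (auto simp: e'_def lookup_add lookup_minus lookup_single when_def)
    moreover have "Poly_Mapping.keys e' \<subseteq> Poly_Mapping.keys e - {j}"
      by (auto simp: e'_def in_keys_iff lookup_minus lookup_single when_def split: if_splits)
    then have "Poly_Mapping.keys e' \<subseteq> J" using e by blast
    ultimately show ?thesis using 2[of e'] by metis
  qed
  have "s \<in> multiples g" "\<sigma> i \<in> multiples g" if "i \<in> insert j J" for i
    using h g that multiples_trans by blast+
  then have "reduced_on (insert j J) g"
    unfolding reduced_on_def using g(1) 1 3 by auto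
  then show ?thesis by blast
qed

lemma exists_reduced_on: "m \<le> n \<Longrightarrow> \<exists>J h. J \<subseteq> {..<n} \<and> card J = m \<and> reduced_on J h"
proof (induction m)
  case 0
  have "reduced_on {} s"
    unfolding reduced_on_def using s_pos box_zero
    by (auto intro!: bexI[of _ 0] exI[of _ "0::nat"] mono_equiv.refl multiples_of_int_mult)
  then show ?case by auto
next
  case (Suc m)
  then obtain J h where J: "J \<subseteq> {..<n}" "card J = m" "reduced_on J h" by auto
  have h: "h \<noteq> 0" "s \<in> multiples h" "\<And>i. i \<in> J \<Longrightarrow> \<sigma> i \<in> multiples h"
    using J(3) by (auto simp: reduced_on_def)
  have "J \<noteq> {..<n}" using J Suc.prems by auto
  then obtain i where i: "i \<in> {..<n} - J" using J by blast
  \<comment> \<open>If the remaining \<open>\<sigma> i\<close> already lies in the subgroup,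
    \<open>i\<close> itself serves. Otherwise \<open>exists_multiple\<close> gives an index whose
    \<open>\<sigma>\<close> lies outside the subgroup and which therefore is not in
    \<open>J\<close>.\<close>
  have "\<exists>j\<in>{..<n} - J. of_nat (\<beta> j) * \<sigma> j \<in> multiples h"
  proof (cases "\<sigma> i \<in> multiples h")
    case True
    then show ?thesis using i multiples_of_nat_mult by blast
  next
    case False
    then show ?thesis using exists_multiple[OF h(1,2), of i] i h(3) by blast
  qed
  then obtain j where j: "j \<in> {..<n} - J" "of_nat (\<beta> j) * \<sigma> j \<in> multiples h" by blast
  moreover have "card (insert j J) = Suc m"
    using J j finite_subset[OF J(1)] by simp
  ultimately show ?case
    using reduced_on_insert[OF J(3,1) j] J(1) by (intro exI[of _ "insert j J"]) auto
qed

lemma mono_equiv_box: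
  assumes "e \<in> exponents"
  obtains k' f where "f \<in> box" "mono_equiv (k, e) (k', f)"
proof -
  obtain J h where J: "J \<subseteq> {..<n}" "card J = n" "reduced_on J h"
    using exists_reduced_on[of n] by auto
  then have "J = {..<n}" by (simp add: card_subset_eq)
  then obtain k' f where "f \<in> box" "mono_equiv (0, e) (k', f)"
    using J(3) assms unfolding reduced_on_def exponents_def by blast
  then show thesis
    using that mono_equiv_shift[of "(0, e)" "(k', f)" 0 k] by auto
qed

text \<open>The converse of \<open>mono_equiv_weight\<close>. Both monomials reduce to the box;
  there equal degrees make the exponent vectors congruent modulo \<open>s\<close>, hence equal, and
  then the powers of \<open>u\<close> agree too. So the \<open>n\<close> chosen relations account
  for every coincidence between images of monomials.\<close>

lemma mono_equivI:
  assumes "e \<in> exponents" "f \<in> exponents"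
    and "of_nat k * s + weight e = of_nat m * s + weight f"
  shows "mono_equiv (k, e) (m, f)"
proof -
  obtain k' e' where e': "e' \<in> box" "mono_equiv (k, e) (k', e')" using mono_equiv_box assms(1) .
  obtain m' f' where f': "f' \<in> box" "mono_equiv (m, f) (m', f')" using mono_equiv_box assms(2) .
  have eq: "of_nat k' * s + weight e' = of_nat m' * s + weight f'"
    using mono_equiv_weight[OF e'(2)] mono_equiv_weight[OF f'(2)] assms(3) by simp
  then have "weight e' - weight f' = of_int (int m' - int k') * s"
    by (simp add: algebra_simps)
  then have "weight e' - weight f' \<in> multiples s"
    unfolding multiples_def by (rule range_eqI)
  then have "e' = f'" using e'(1) f'(1) by (intro weight_eq_mod_box)
  moreover from this eq have "k' = m'" using s_pos by simp
  ultimately show ?thesis using e'(2) f'(2) by (auto intro: mono_equiv.intros)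
qed

end


section \<open>Flatness of rectangular algebras\<close>

lemma finite_exponents_bounded:
  assumes "finite I"
  shows "finite {e :: 'i \<Rightarrow>\<^sub>0 nat. Poly_Mapping.keys e \<subseteq> I \<and> (\<forall>i\<in>I. Poly_Mapping.lookup e i \<le> b i)}"
    (is "finite ?E")
proof (rule inj_on_finite)
  show "inj_on (\<lambda>e. restrict (Poly_Mapping.lookup e) I) ?E"
  proof (rule inj_onI, rule poly_mapping_eqI)
    fix e f :: "'i \<Rightarrow>\<^sub>0 nat" and i
    assume *: "e \<in> ?E" "f \<in> ?E"
      "restrict (Poly_Mapping.lookup e) I = restrict (Poly_Mapping.lookup f) I"
    show "Poly_Mapping.lookup e i = Poly_Mapping.lookup f i"
    proof (cases "i \<in> I")
      case True
      then show ?thesis using fun_cong[OF *(3), of i] by simp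
    next
      case False
      then have "i \<notin> Poly_Mapping.keys e" "i \<notin> Poly_Mapping.keys f" using * by auto
      then show ?thesis by (simp add: in_keys_iff)
    qed
  qed
  show "(\<lambda>e. restrict (Poly_Mapping.lookup e) I) ` ?E \<subseteq> (\<Pi>\<^sub>E i\<in>I. {..b i})" by auto
  show "finite (\<Pi>\<^sub>E i\<in>I. {..b i})" using assms by (simp add: finite_PiE)
qed

lemma power_series_exponents_poly_mapping:
  "power_series_exponents {e :: 'i \<Rightarrow>\<^sub>0 nat. Poly_Mapping.keys e \<subseteq> I}"
proof
  let ?E = "{e :: 'i \<Rightarrow>\<^sub>0 nat. Poly_Mapping.keys e \<subseteq> I}"
  show "e + f \<in> ?E" if "e \<in> ?E" "f \<in> ?E" for e f
    using that keys_add[of e f] by auto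
  fix a :: "'i \<Rightarrow>\<^sub>0 nat"
  let ?D = "{e. Poly_Mapping.keys e \<subseteq> Poly_Mapping.keys a \<and>
    (\<forall>i\<in>Poly_Mapping.keys a. Poly_Mapping.lookup e i \<le> Poly_Mapping.lookup a i)}"
  have "{p \<in> ?E \<times> ?E. fst p + snd p = a} \<subseteq> (\<lambda>e. (e, a - e)) ` ?D"
  proof
    fix p assume p: "p \<in> {p \<in> ?E \<times> ?E. fst p + snd p = a}"
    then have a: "a = fst p + snd p" by simp
    have "Poly_Mapping.keys (fst p) \<subseteq> Poly_Mapping.keys a"
      by (auto simp: a in_keys_iff lookup_add)
    then have "fst p \<in> ?D" by (auto simp: a lookup_add)
    moreover have "p = (fst p, a - fst p)" by (simp add: a prod_eq_iff)
    ultimately show "p \<in> (\<lambda>e. (e, a - e)) ` ?D" by (rule rev_image_eqI)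
  qed
  moreover have "finite ?D" by (rule finite_exponents_bounded) simp
  ultimately show "finite {p \<in> ?E \<times> ?E. fst p + snd p = a}"
    by (meson finite_imageI finite_subset)
  show "a = 0" if "a + b = 0" for b
    using that by (metis add_is_0 lookup_add lookup_zero poly_mapping_eqI)
qed simp

lemma power_series_exponents_subset:
  assumes "power_series_exponents A" "B \<subseteq> A" "0 \<in> B" "\<And>a b. a \<in> B \<Longrightarrow> b \<in> B \<Longrightarrow> a + b \<in> B"
  shows "power_series_exponents B"
proof -
  interpret A: power_series_exponents A by fact
  have "finite {p \<in> B \<times> B. fst p + snd p = a}" for a
    by (rule finite_subset[OF _ A.finite_decompositions[of a]]) (use assms(2) in auto)
  then show ?thesis
    using assms A.add_eq_zero by unfold_locales blast+
qed

text \<open>Below, \<open>A.PS\<close> is K[[u^S']], \<open>B.PS\<close> is R = K[[u^S]], and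
  \<open>Y.PS\<close> is R[[Y]]. The coefficients of \<open>Y.PS\<close> are series again, so its
  elements take an exponent vector and then a rational.\<close>

locale rectangular_algebra = apery_box S' s n \<sigma> \<beta> + field K + A: power_series_ring K S'
  for K (structure) and S' s n \<sigma> \<beta>
begin

definition S where "S = range (\<lambda>k::nat. of_nat k * s)"

lemma S_subset: "S \<subseteq> S'"
  using s_mem of_nat_mult_mem by (auto simp: S_def)

lemma of_nat_mem_S [simp]: "of_nat k * s \<in> S"
  unfolding S_def by (rule rangeI)

lemma zero_mem_S [simp]: "0 \<in> S"
  using of_nat_mem_S[of 0] by simp

lemma S_add: "a \<in> S \<Longrightarrow> b \<in> S \<Longrightarrow> a + b \<in> S"
  by (auto simp: S_def simp flip: distrib_right of_nat_add)

sublocale B: power_series_ring K S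
proof (rule power_series_ring.intro)
  show "power_series_exponents S"
    by (rule power_series_exponents_subset[OF A.power_series_exponents_axioms S_subset])
      (auto intro: S_add)
qed (rule cring_axioms)

sublocale Y: power_series_ring B.PS exponents
  unfolding exponents_def
  by (intro power_series_ring.intro B.PS_cring power_series_exponents_poly_mapping)

abbreviation "R' \<equiv> semigroup_algebra K S'"

lemma semigroup_algebra_simps:
  "carrier R' = carrier A.PS" "monoid.mult R' = monoid.mult A.PS" "monoid.one R' = monoid.one A.PS"
  "ring.zero R' = ring.zero A.PS" "ring.add R' = ring.add A.PS" "smult R' = monoid.mult A.PS"
  by (simp_all add: semigroup_algebra_def)

lemma semigroup_algebra_abelian_group: "abelian_group R'"
  by (rule abelian_groupI)
    (use A.PS.l_neg A.PS.a_inv_closed in \<open>auto simp: semigroup_algebra_simps A.PS.a_ac\<close>)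

lemma semigroup_algebra_cring: "cring R'"
proof (rule cringI)
  show "comm_monoid R'"
    by (rule comm_monoidI) (auto simp: semigroup_algebra_simps A.PS.m_ac)
qed (auto simp: semigroup_algebra_simps A.PS.l_distr semigroup_algebra_abelian_group)

lemma Units_semigroup_algebra: "Units R' = Units A.PS"
  by (simp add: Units_def semigroup_algebra_simps)

lemma nonunits_additive_rings:
  "nonunits_additive B.PS" "nonunits_additive Y.PS" "nonunits_additive R'"
proof -
  show B: "nonunits_additive B.PS"
    by (rule B.nonunits_additive_PS[OF nonunits_additive_field])
  show "nonunits_additive Y.PS"
    by (rule Y.nonunits_additive_PS[OF B])
  show "nonunits_additive R'"
    using A.nonunits_additive_PS[OF nonunits_additive_field]
    by (simp add: nonunits_additive_def Units_semigroup_algebra semigroup_algebra_simps)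
qed

lemma carrier_subset: "f \<in> carrier B.PS \<Longrightarrow> f \<in> carrier A.PS"
  unfolding A.mem_carrier B.mem_carrier using S_subset by blast

text \<open>Summing over the larger exponent set adds only terms with a zero factor. Together with
  \<open>one_eq\<close> and \<open>add_eq\<close> this makes R a subring of R'.\<close>

lemma mult_eq:
  assumes "f \<in> carrier B.PS" "g \<in> carrier B.PS"
  shows "f \<otimes>\<^bsub>B.PS\<^esub> g = f \<otimes>\<^bsub>A.PS\<^esub> g"
proof
  fix a
  show "(f \<otimes>\<^bsub>B.PS\<^esub> g) a = (f \<otimes>\<^bsub>A.PS\<^esub> g) a"
    unfolding A.mult_apply B.mult_apply
  proof (rule finsum_mono_neutral)
    fix p assume "p \<in> A.decompositions a - B.decompositions a"
    then have "fst p \<notin> S \<or> snd p \<notin> S" by auto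
    then show "f (fst p) \<otimes> g (snd p) = \<zero>"
      using assms by (auto simp: B.coeff_notin)
  qed (use assms S_subset in auto)
qed

lemma one_eq: "\<one>\<^bsub>B.PS\<^esub> = \<one>\<^bsub>A.PS\<^esub>"
  by (simp add: fun_eq_iff A.one_apply B.one_apply)

lemma add_eq: "f \<oplus>\<^bsub>B.PS\<^esub> g = f \<oplus>\<^bsub>A.PS\<^esub> g"
  by (simp add: fun_eq_iff)

lemma semigroup_algebra_module: "Module.module B.PS R'"
proof (rule Module.moduleI)
  show "cring B.PS" by (rule B.PS_cring)
  show "abelian_group R'" by (rule semigroup_algebra_abelian_group)
qed (simp_all add: semigroup_algebra_simps carrier_subset A.PS.l_distr A.PS.r_distr A.PS.m_assoc
    add_eq mult_eq one_eq)

text \<open>The coordinate of \<open>z\<close> at the basis element \<open>u^w\<close>: the terms of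
  \<open>z\<close> with exponent in \<open>w + S\<close>, divided by \<open>u^w\<close>.\<close>

definition coordinate :: "rat \<Rightarrow> (rat \<Rightarrow> 'a) \<Rightarrow> rat \<Rightarrow> 'a" where
  "coordinate w z q = (if q \<in> S then z (q + w) else \<zero>)"

lemma coordinate_carrier: "z \<in> carrier A.PS \<Longrightarrow> coordinate w z \<in> carrier B.PS"
  by (auto simp: B.mem_carrier coordinate_def)

text \<open>\<open>t\<close> and \<open>w\<close> are congruent modulo \<open>s\<close>, so
  \<open>w\<close> is the Apery representative of \<open>t\<close>, which exceeds it by an element
  of \<open>S\<close>.\<close>

lemma S_minimal:
  assumes "w \<in> W" "q + w = q1 + t" "q \<in> S" "q1 \<in> S" "t \<in> S'"
  obtains q2 where "q2 \<in> S" "t = q2 + w" "q = q1 + q2"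
proof -
  obtain k w' where w': "w' \<in> W" "t = of_nat k * s + w'" using W_decomposition[OF assms(5)] .
  obtain a b where ab: "q = of_nat a * s" "q1 = of_nat b * s" using assms by (auto simp: S_def)
  have "w' - w = of_int (int a - int b - int k) * s"
    using assms(2) w' ab by (simp add: algebra_simps)
  then have "w' - w \<in> multiples s" unfolding multiples_def by (rule range_eqI)
  then have "w' = w" using W_unique w' assms by blast
  then show thesis using that[of "of_nat k * s"] w' assms(2) by simp
qed

lemma coordinate_smult:
  assumes w: "w \<in> W" and r: "r \<in> carrier B.PS" and z: "z \<in> carrier A.PS"
  shows "coordinate w (r \<otimes>\<^bsub>A.PS\<^esub> z) = r \<otimes>\<^bsub>B.PS\<^esub> coordinate w z"
proof
  fix q
  show "coordinate w (r \<otimes>\<^bsub>A.PS\<^esub> z) q = (r \<otimes>\<^bsub>B.PS\<^esub> coordinate w z) q"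
  proof (cases "q \<in> S")
    case True
    let ?I = "(\<lambda>p. (fst p, snd p + w)) ` B.decompositions q"
    let ?g = "\<lambda>p. r (fst p) \<otimes> z (snd p)"
    have "(r \<otimes>\<^bsub>B.PS\<^esub> coordinate w z) q = finsum K ?g ?I"
      unfolding B.mult_apply
    proof (rule finsum_bij_betw)
      show "bij_betw (\<lambda>p. (fst p, snd p + w)) (B.decompositions q) ?I"
        by (rule bij_betw_imageI) (auto simp: inj_on_def)
    qed (use r z in \<open>auto simp: coordinate_def\<close>)
    \<comment> \<open>A decomposition of \<open>q + w\<close> with first entry in \<open>S\<close>
      has its second entry in \<open>w + S\<close>, by \<open>S_minimal\<close>; on all others
      \<open>r\<close> vanishes.\<close>
    also have "\<dots> = finsum K ?g (A.decompositions (q + w))"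
    proof (rule finsum_mono_neutral)
      show "?I \<subseteq> A.decompositions (q + w)"
        using S_subset w W_subset by (auto simp: add.assoc subset_iff intro!: add_mem)
      fix p assume p: "p \<in> A.decompositions (q + w) - ?I"
      have "fst p \<notin> S"
      proof
        assume "fst p \<in> S"
        moreover have "q + w = fst p + snd p" "snd p \<in> S'" using p by auto
        ultimately obtain q2 where "q2 \<in> S" "snd p = q2 + w" "q = fst p + q2"
          using S_minimal[OF w _ True] by blast
        then have "p \<in> ?I" using \<open>fst p \<in> S\<close>
          by (intro image_eqI[of _ _ "(fst p, q2)"]) (auto simp: prod_eq_iff)
        then show False using p by blast
      qed
      then show "?g p = \<zero>" using r z by (simp add: B.coeff_notin)
    qed (use r z in auto)
    also have "\<dots> = coordinate w (r \<otimes>\<^bsub>A.PS\<^esub> z) q"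
      using True by (simp add: coordinate_def A.mult_apply)
    finally show ?thesis by simp
  next
    case False
    then show ?thesis
      using B.mult_carrier[OF r coordinate_carrier[OF z]]
      by (simp add: coordinate_def B.coeff_notin del: B.PS.m_closed)
  qed
qed

lemma coordinate_sum:
  assumes z: "z \<in> carrier A.PS"
  shows "z = (\<Oplus>\<^bsub>R'\<^esub>w\<in>W. coordinate w z \<odot>\<^bsub>R'\<^esub> A.monom w \<one>)"
proof -
  have summand: "coordinate w z \<otimes>\<^bsub>A.PS\<^esub> A.monom w \<one> \<in> carrier A.PS" if "w \<in> W" for w
    using that z
    by (intro A.PS.m_closed[OF carrier_subset[OF coordinate_carrier] A.monom_carrier] W_subset) auto
  have "(\<Oplus>\<^bsub>A.PS\<^esub>w\<in>W. coordinate w z \<otimes>\<^bsub>A.PS\<^esub> A.monom w \<one>) t = z t" for t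
  proof -
    have val: "(coordinate w z \<otimes>\<^bsub>A.PS\<^esub> A.monom w \<one>) t = (if t - w \<in> S then z t else \<zero>)" if "w \<in> W" for w
    proof -
      have "(coordinate w z \<otimes>\<^bsub>A.PS\<^esub> A.monom w \<one>) ((t - w) + w) = coordinate w z (t - w) \<otimes> \<one>"
        using that z
        by (intro A.mult_monom_apply_add[OF carrier_subset[OF coordinate_carrier]] W_subset) auto
      then show ?thesis using z by (simp add: coordinate_def)
    qed
    have "(\<Oplus>\<^bsub>A.PS\<^esub>w\<in>W. coordinate w z \<otimes>\<^bsub>A.PS\<^esub> A.monom w \<one>) t =
        (\<Oplus>w\<in>W. (coordinate w z \<otimes>\<^bsub>A.PS\<^esub> A.monom w \<one>) t)"
      using summand by (rule A.finsum_apply)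
    \<comment> \<open>The sets \<open>w + S\<close> with \<open>w\<close> in \<open>W\<close>
      partition \<open>S'\<close>, and the one containing \<open>t\<close> belongs to
      \<open>apery_part t\<close>. For \<open>t\<close> outside \<open>S'\<close> every term is
      zero.\<close>
    also have "\<dots> = (\<Oplus>w\<in>W. if w = apery_part t then z t else \<zero>)"
    proof (rule finsum_cong')
      fix w assume w: "w \<in> W"
      show "(coordinate w z \<otimes>\<^bsub>A.PS\<^esub> A.monom w \<one>) t = (if w = apery_part t then z t else \<zero>)"
      proof (cases "t \<in> S'")
        case True
        have "t - w \<in> S \<longleftrightarrow> w = apery_part t"
        proof
          assume "t - w \<in> S"
          then have "t - w \<in> multiples s" by (auto simp: S_def intro: multiples_of_nat_mult[OF multiples_self])
          from multiples_diff[OF apery_part_multiples[OF True] this]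
          have "w - apery_part t \<in> multiples s" by simp
          then show "w = apery_part t" using W_unique w apery_part(1)[OF True] by blast
        next
          assume "w = apery_part t"
          then obtain k :: nat where "t = of_nat k * s + w" using apery_part(2)[OF True] by blast
          then show "t - w \<in> S" by simp
        qed
        then show ?thesis using w by (simp add: val)
      next
        case False
        then show ?thesis using w z by (simp add: val A.coeff_notin)
      qed
    qed (use z in auto)
    also have "\<dots> = z t"
    proof -
      have "z t = \<zero>" if "apery_part t \<notin> W"
        using apery_part(1)[of t] A.coeff_notin[OF z, of t] that by blast
      then show ?thesis using finite_W z by (subst finsum_delta) auto
    qed
    finally show ?thesis .
  qed
  moreover have "(\<Oplus>\<^bsub>R'\<^esub>w\<in>W. coordinate w z \<odot>\<^bsub>R'\<^esub> A.monom w \<one>) =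
      (\<Oplus>\<^bsub>A.PS\<^esub>w\<in>W. coordinate w z \<otimes>\<^bsub>A.PS\<^esub> A.monom w \<one>)"
    by (simp add: finsum_def finprod_def semigroup_algebra_simps)
  ultimately show ?thesis by (simp add: fun_eq_iff)
qed

lemma semigroup_algebra_flat: "flat_module TN TP B.PS R'"
proof (rule flat_module_dual_basis[where I = W and b = "\<lambda>w. A.monom w \<one>" and c = coordinate])
  show "Module.module B.PS R'" by (rule semigroup_algebra_module)
  show "finite W" by (rule finite_W)
  show "z = (\<Oplus>\<^bsub>R'\<^esub>w\<in>W. coordinate w z \<odot>\<^bsub>R'\<^esub> A.monom w \<one>)" if "z \<in> carrier R'" for z
    using that coordinate_sum by (simp add: semigroup_algebra_simps)
  show "coordinate w (x \<oplus>\<^bsub>R'\<^esub> y) = coordinate w x \<oplus>\<^bsub>B.PS\<^esub> coordinate w y" for w x y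
    by (simp add: semigroup_algebra_simps fun_eq_iff coordinate_def)
qed (auto simp: semigroup_algebra_simps coordinate_smult coordinate_carrier A.monom_carrier W_subset)

end


section \<open>The presentation\<close>

context rectangular_algebra
begin

text \<open>\<open>fiber t\<close> lists the monomials \<open>u^q Y^e\<close> that are sent to \<open>u^t\<close>.\<close>

definition fiber :: "rat \<Rightarrow> ((nat \<Rightarrow>\<^sub>0 nat) \<times> rat) set" where
  "fiber t = {x. fst x \<in> exponents \<and> snd x \<in> S \<and> snd x + weight (fst x) = t}"

text \<open>The substitution of \<open>u^(\<sigma> i)\<close> for \<open>Y_i\<close>, written on
  coefficients; its convergence is the finiteness of \<open>fiber t\<close>.\<close>

definition evaluation :: "((nat \<Rightarrow>\<^sub>0 nat) \<Rightarrow> rat \<Rightarrow> 'a) \<Rightarrow> rat \<Rightarrow> 'a" where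
  "evaluation F t = (\<Oplus>x\<in>fiber t. F (fst x) (snd x))"

lemma multiple_\<sigma>_nonneg: "i < n \<Longrightarrow> 0 \<le> of_nat m * \<sigma> i"
  using \<sigma>_pos[of i] by simp

lemma weight_nonneg: "0 \<le> weight e"
  using nonneg weight_mem by blast

lemma S_nonneg: "q \<in> S \<Longrightarrow> 0 \<le> q"
  using nonneg S_subset by blast

text \<open>All contributions to the degree are nonnegative and every \<open>\<sigma> i\<close> is
  positive, so the exponent of \<open>Y_i\<close> is at most \<open>t / \<sigma> i\<close>; the
  exponent vector then determines the power of \<open>u\<close>.\<close>

lemma finite_fiber [simp]: "finite (fiber t)"
proof -
  let ?E = "{e :: nat \<Rightarrow>\<^sub>0 nat. Poly_Mapping.keys e \<subseteq> {..<n} \<and>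
    (\<forall>i\<in>{..<n}. Poly_Mapping.lookup e i \<le> nat \<lfloor>t / \<sigma> i\<rfloor>)}"
  have "fiber t \<subseteq> (\<lambda>e. (e, t - weight e)) ` ?E"
  proof
    fix x assume x: "x \<in> fiber t"
    have "of_nat (Poly_Mapping.lookup (fst x) i) * \<sigma> i \<le> t" if "i < n" for i
    proof -
      have "of_nat (Poly_Mapping.lookup (fst x) i) * \<sigma> i \<le> weight (fst x)"
        unfolding weight_def using that
        by (intro member_le_sum) (auto intro: multiple_\<sigma>_nonneg)
      also have "\<dots> \<le> t" using x S_nonneg by (auto simp: fiber_def)
      finally show ?thesis .
    qed
    then have "int (Poly_Mapping.lookup (fst x) i) \<le> \<lfloor>t / \<sigma> i\<rfloor>" if "i < n" for i
      using that \<sigma>_pos[of i] by (simp add: le_floor_iff pos_le_divide_eq)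
    then have "Poly_Mapping.lookup (fst x) i \<le> nat \<lfloor>t / \<sigma> i\<rfloor>" if "i < n" for i
      using that by force
    then have "fst x \<in> ?E" using x by (auto simp: fiber_def exponents_def)
    moreover have "x = (fst x, t - weight (fst x))" using x by (auto simp: fiber_def prod_eq_iff)
    ultimately show "x \<in> (\<lambda>e. (e, t - weight e)) ` ?E" by (rule rev_image_eqI)
  qed
  moreover have "finite ?E" by (rule finite_exponents_bounded) simp
  ultimately show ?thesis by (meson finite_imageI finite_subset)
qed

lemma fiber_notin: "t \<notin> S' \<Longrightarrow> fiber t = {}"
  using S_subset weight_mem add_mem by (auto simp: fiber_def)

lemma weight_eq_0: "e \<in> exponents \<Longrightarrow> weight e = 0 \<Longrightarrow> e = 0"
proof (rule poly_mapping_eqI)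
  fix i assume e: "e \<in> exponents" "weight e = 0"
  show "Poly_Mapping.lookup e i = Poly_Mapping.lookup 0 i"
  proof (cases "i < n")
    case True
    have "\<forall>i\<in>{..<n}. of_nat (Poly_Mapping.lookup e i) * \<sigma> i = 0"
      using e(2) unfolding weight_def
      by (subst (asm) sum_nonneg_eq_0_iff) (auto intro: multiple_\<sigma>_nonneg)
    then show ?thesis using True \<sigma>_pos[of i] by auto
  next
    case False
    then have "i \<notin> Poly_Mapping.keys e" using e by (auto simp: exponents_def)
    then show ?thesis by (simp add: in_keys_iff)
  qed
qed

text \<open>Positivity of the degrees makes the evaluation preserve constant coefficients, which is
  why it is local.\<close>

lemma fiber_zero: "fiber 0 = {(0, 0)}"
proof (intro equalityI subsetI)
  fix x assume x: "x \<in> fiber 0"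
  then have "snd x = 0" "weight (fst x) = 0"
    using S_nonneg[of "snd x"] weight_nonneg[of "fst x"] by (auto simp: fiber_def)
  then show "x \<in> {(0, 0)}" using x weight_eq_0 by (auto simp: fiber_def prod_eq_iff)
qed (auto simp: fiber_def)

lemma Y_coeff_closed [simp]: "F \<in> carrier Y.PS \<Longrightarrow> F e q \<in> carrier K"
  using B.coeff_closed[OF Y.coeff_closed] by blast

lemma Y_coeff_notin: "F \<in> carrier Y.PS \<Longrightarrow> q \<notin> S \<Longrightarrow> F e q = \<zero>"
  using B.coeff_notin[OF Y.coeff_closed] by blast

lemma Y_coeff_notin_exponents: "F \<in> carrier Y.PS \<Longrightarrow> e \<notin> exponents \<Longrightarrow> F e q = \<zero>"
  using Y.coeff_notin[of F e] by simp

lemma Y_add_apply: "(F \<oplus>\<^bsub>Y.PS\<^esub> G) e q = F e q \<oplus> G e q"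
  by simp

lemma Y_mem_carrier:
  assumes "\<And>e q. F e q \<in> carrier K" "\<And>e q. e \<notin> exponents \<Longrightarrow> F e q = \<zero>"
    "\<And>e q. q \<notin> S \<Longrightarrow> F e q = \<zero>"
  shows "F \<in> carrier Y.PS"
  unfolding Y.mem_carrier B.mem_carrier using assms by (auto simp: fun_eq_iff)

lemma evaluation_carrier: "F \<in> carrier Y.PS \<Longrightarrow> evaluation F \<in> carrier A.PS"
  unfolding A.mem_carrier evaluation_def by (auto simp: fiber_notin intro: finsum_closed)

lemma evaluation_add:
  assumes "F \<in> carrier Y.PS" "G \<in> carrier Y.PS"
  shows "evaluation (F \<oplus>\<^bsub>Y.PS\<^esub> G) = evaluation F \<oplus>\<^bsub>A.PS\<^esub> evaluation G"
proof
  fix t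
  show "evaluation (F \<oplus>\<^bsub>Y.PS\<^esub> G) t = (evaluation F \<oplus>\<^bsub>A.PS\<^esub> evaluation G) t"
    unfolding evaluation_def A.add_apply Y_add_apply using assms by (intro finsum_addf) auto
qed

lemma Y_mult_apply:
  assumes "F \<in> carrier Y.PS" "G \<in> carrier Y.PS"
  shows "(F \<otimes>\<^bsub>Y.PS\<^esub> G) e q = (\<Oplus>y\<in>Y.decompositions e \<times> B.decompositions q.
    F (fst (fst y)) (fst (snd y)) \<otimes> G (snd (fst y)) (snd (snd y)))"
proof -
  have "(F \<otimes>\<^bsub>Y.PS\<^esub> G) e q =
      (\<Oplus>p\<in>Y.decompositions e. (F (fst p) \<otimes>\<^bsub>B.PS\<^esub> G (snd p)) q)"
    unfolding Y.mult_apply using assms by (intro B.finsum_apply B.PS.m_closed) auto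
  also have "\<dots> = (\<Oplus>p\<in>Y.decompositions e. \<Oplus>r\<in>B.decompositions q.
      F (fst p) (fst r) \<otimes> G (snd p) (snd r))"
    unfolding B.mult_apply ..
  also have "\<dots> = (\<Oplus>y\<in>Y.decompositions e \<times> B.decompositions q.
      F (fst (fst y)) (fst (snd y)) \<otimes> G (snd (fst y)) (snd (snd y)))"
    using assms by (subst finsum_Sigma) auto
  finally show ?thesis .
qed

lemma evaluation_mult:
  assumes F: "F \<in> carrier Y.PS" and G: "G \<in> carrier Y.PS"
  shows "evaluation (F \<otimes>\<^bsub>Y.PS\<^esub> G) = evaluation F \<otimes>\<^bsub>A.PS\<^esub> evaluation G"
proof
  fix t
  let ?Z1 = "Sigma (fiber t) (\<lambda>x. Y.decompositions (fst x) \<times> B.decompositions (snd x))"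
  let ?Z2 = "Sigma (A.decompositions t) (\<lambda>p. fiber (fst p) \<times> fiber (snd p))"
  let ?f = "\<lambda>y. F (fst (fst y)) (fst (snd y)) \<otimes> G (snd (fst y)) (snd (snd y))"
  let ?g = "\<lambda>y. F (fst (fst y)) (snd (fst y)) \<otimes> G (fst (snd y)) (snd (snd y))"
  have "evaluation (F \<otimes>\<^bsub>Y.PS\<^esub> G) t =
      (\<Oplus>x\<in>fiber t. \<Oplus>y\<in>Y.decompositions (fst x) \<times> B.decompositions (snd x). ?f y)"
    unfolding evaluation_def Y_mult_apply[OF F G] ..
  also have "\<dots> = (\<Oplus>z\<in>?Z1. ?f (snd z))"
    using F G by (subst finsum_Sigma) auto
  \<comment> \<open>Both index sets list the pairs of monomials of R[[Y]] whose images multiply to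
    \<open>u^t\<close>: the first groups them by their product, the second by the exponents of their
    images.\<close>
  also have "\<dots> = (\<Oplus>z\<in>?Z2. ?g (snd z))"
  proof (rule finsum_bij_betw)
    show "bij_betw (\<lambda>(x, (p, r)). ((fst r + weight (fst p), snd r + weight (snd p)),
        ((fst p, fst r), (snd p, snd r)))) ?Z1 ?Z2"
    proof (rule bij_betwI[where g = "\<lambda>(v, (x, y)). ((fst x + fst y, snd x + snd y),
        ((fst x, fst y), (snd x, snd y)))"])
      show "(\<lambda>(x, (p, r)). ((fst r + weight (fst p), snd r + weight (snd p)),
        ((fst p, fst r), (snd p, snd r)))) \<in> ?Z1 \<rightarrow> ?Z2"
        using S_subset weight_mem by (auto simp: fiber_def weight_add subset_iff intro!: add_mem)
      show "(\<lambda>(v, (x, y)). ((fst x + fst y, snd x + snd y),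
        ((fst x, fst y), (snd x, snd y)))) \<in> ?Z2 \<rightarrow> ?Z1"
        by (auto simp: fiber_def weight_add intro: S_add)
    qed (auto simp: fiber_def)
  qed (use F G in auto)
  also have "\<dots> = (\<Oplus>p\<in>A.decompositions t. \<Oplus>z\<in>fiber (fst p) \<times> fiber (snd p). ?g z)"
    using F G by (subst finsum_Sigma) auto
  also have "\<dots> = (\<Oplus>p\<in>A.decompositions t. evaluation F (fst p) \<otimes> evaluation G (snd p))"
  proof (intro finsum_cong' refl)
    fix p
    have "(\<Oplus>z\<in>fiber (fst p) \<times> fiber (snd p). ?g z) =
        (\<Oplus>x\<in>fiber (fst p). \<Oplus>y\<in>fiber (snd p). F (fst x) (snd x) \<otimes> G (fst y) (snd y))"
      using F G by (subst finsum_Sigma) auto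
    also have "\<dots> = (\<Oplus>x\<in>fiber (fst p). F (fst x) (snd x) \<otimes> evaluation G (snd p))"
      unfolding evaluation_def using F G
      by (intro finsum_cong' refl) (auto simp: finsum_rdistr intro!: finsum_closed)
    also have "\<dots> = evaluation F (fst p) \<otimes> evaluation G (snd p)"
      using F A.coeff_closed[OF evaluation_carrier[OF G]]
      by (subst finsum_ldistr[symmetric]) (auto simp: evaluation_def)
    finally show "(\<Oplus>z\<in>fiber (fst p) \<times> fiber (snd p). ?g z) =
        evaluation F (fst p) \<otimes> evaluation G (snd p)" .
  qed (use A.coeff_closed[OF evaluation_carrier] F G in auto)
  also have "\<dots> = (evaluation F \<otimes>\<^bsub>A.PS\<^esub> evaluation G) t"
    by (simp add: A.mult_apply)
  finally show "evaluation (F \<otimes>\<^bsub>Y.PS\<^esub> G) t = (evaluation F \<otimes>\<^bsub>A.PS\<^esub> evaluation G) t" .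
qed

lemma evaluation_monom:
  assumes "e \<in> exponents" "r \<in> carrier B.PS"
  shows "evaluation (Y.monom e r) t = r (t - weight e)"
proof -
  have "evaluation (Y.monom e r) t =
      (\<Oplus>x\<in>fiber t. if x = (e, t - weight e) then r (t - weight e) else \<zero>)"
    unfolding evaluation_def using assms
    by (intro finsum_cong') (auto simp: Y.monom_def fiber_def)
  also have "\<dots> = (if (e, t - weight e) \<in> fiber t then r (t - weight e) else \<zero>)"
    using assms by (intro finsum_delta) auto
  also have "\<dots> = r (t - weight e)"
    using assms by (auto simp: fiber_def B.coeff_notin)
  finally show ?thesis .
qed

lemma evaluation_constant: "r \<in> carrier B.PS \<Longrightarrow> evaluation (Y.monom 0 r) = r"
  by (simp add: fun_eq_iff evaluation_monom)

lemma evaluation_smult: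
  assumes r: "r \<in> carrier B.PS" and F: "F \<in> carrier Y.PS"
  shows "evaluation (r \<odot>\<^bsub>Y.PS\<^esub> F) = r \<otimes>\<^bsub>A.PS\<^esub> evaluation F"
proof -
  have c: "Y.monom 0 r \<in> carrier Y.PS" using r by (simp add: Y.monom_carrier)
  have "(F \<otimes>\<^bsub>Y.PS\<^esub> Y.monom 0 r) (e + 0) = F e \<otimes>\<^bsub>B.PS\<^esub> r" for e
    using F r by (intro Y.mult_monom_apply_add) auto
  then have "F \<otimes>\<^bsub>Y.PS\<^esub> Y.monom 0 r = r \<odot>\<^bsub>Y.PS\<^esub> F"
    using F r by (simp add: fun_eq_iff B.mult_comm)
  then have "r \<odot>\<^bsub>Y.PS\<^esub> F = Y.monom 0 r \<otimes>\<^bsub>Y.PS\<^esub> F"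
    using Y.mult_comm[OF F c] by simp
  then show ?thesis
    using evaluation_mult[OF c F] r by (simp add: evaluation_constant)
qed

lemma evaluation_one: "evaluation \<one>\<^bsub>Y.PS\<^esub> = \<one>\<^bsub>A.PS\<^esub>"
  using evaluation_constant[OF B.PS.one_closed] unfolding Y.one_eq_monom one_eq .

lemma evaluation_ring_hom: "evaluation \<in> ring_hom Y.PS R'"
  by (rule ring_hom_memI)
    (simp_all add: semigroup_algebra_simps evaluation_carrier evaluation_mult evaluation_add evaluation_one)

lemma evaluation_linear: "evaluation \<in> linear_maps B.PS Y.PS R'"
  by (auto simp: linear_maps_def semigroup_algebra_simps evaluation_carrier evaluation_add evaluation_smult
    simp del: Y.add_apply Y.smult_apply)

lemma evaluation_surj: "evaluation ` carrier Y.PS = carrier R'"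
proof (intro equalityI subsetI)
  fix z assume "z \<in> carrier R'"
  then have z: "z \<in> carrier A.PS" by (simp add: semigroup_algebra_simps)
  \<comment> \<open>A preimage supported on the box: over each \<open>t\<close> in \<open>S'\<close>
    lies exactly one monomial \<open>u^q Y^e\<close> with \<open>e\<close> in the box, and it
    receives the coefficient of \<open>z\<close> at \<open>t\<close>.\<close>
  define F where "F = (\<lambda>e q. if e \<in> box \<and> q \<in> S then z (q + weight e) else \<zero>)"
  have "F \<in> carrier Y.PS"
    using z box_exponents by (intro Y_mem_carrier) (auto simp: F_def)
  moreover have "evaluation F t = z t" for t
  proof (cases "t \<in> S'")
    case True
    obtain k e where e: "e \<in> box" "t = of_nat k * s + weight e" using box_decomposition[OF True] .
    have "evaluation F t = (\<Oplus>x\<in>fiber t. if x = (e, of_nat k * s) then z t else \<zero>)"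
      unfolding evaluation_def
    proof (rule finsum_cong')
      fix x assume x: "x \<in> fiber t"
      then obtain m where m: "snd x = of_nat m * s" by (auto simp: fiber_def S_def)
      have "fst x = e" if "fst x \<in> box"
      proof -
        have "weight (fst x) - weight e = of_int (int k - int m) * s"
          using x m e by (simp add: fiber_def algebra_simps)
        then have "weight (fst x) - weight e \<in> multiples s"
          unfolding multiples_def by (rule range_eqI)
        then show ?thesis using weight_eq_mod_box that e by blast
      qed
      then have "fst x \<in> box \<longleftrightarrow> x = (e, of_nat k * s)"
        using x e by (auto simp: fiber_def prod_eq_iff)
      then show "F (fst x) (snd x) = (if x = (e, of_nat k * s) then z t else \<zero>)"
        using x by (auto simp: F_def fiber_def)
    qed (use z in auto)
    also have "\<dots> = z t"
    proof -
      have "(e, of_nat k * s) \<in> fiber t" using e box_exponents by (simp add: fiber_def)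
      then show ?thesis using z by (subst finsum_delta) auto
    qed
    finally show ?thesis .
  next
    case False
    then show ?thesis using z by (simp add: evaluation_def fiber_notin A.coeff_notin)
  qed
  then have "evaluation F = z" by (simp add: fun_eq_iff)
  ultimately show "z \<in> evaluation ` carrier Y.PS" by blast
qed (auto simp: evaluation_carrier semigroup_algebra_simps)

lemma evaluation_local_ring_hom: "local_ring_hom Y.PS R' evaluation"
  unfolding local_ring_hom_def
proof (intro conjI allI impI evaluation_ring_hom)
  show "local_ring Y.PS" by (rule cring.local_ringI[OF Y.PS_cring nonunits_additive_rings(2)])
  show "local_ring R'"
    by (rule cring.local_ringI[OF semigroup_algebra_cring nonunits_additive_rings(3)])
  fix I J assume "maximalideal I Y.PS" "maximalideal J R'"
  then have I: "I = carrier Y.PS - Units Y.PS" and J: "J = carrier R' - Units R'"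
    using cring.maximalideal_iff_nonunits[OF Y.PS_cring nonunits_additive_rings(2)]
      cring.maximalideal_iff_nonunits[OF semigroup_algebra_cring nonunits_additive_rings(3)] by auto
  show "evaluation ` I \<subseteq> J"
  proof
    fix z assume "z \<in> evaluation ` I"
    then obtain F where F: "F \<in> carrier Y.PS" "F \<notin> Units Y.PS" and z: "z = evaluation F"
      unfolding I by blast
    \<comment> \<open>Invertibility is decided by the constant coefficient, first over R and then
      over \<open>K\<close>.\<close>
    have "F 0 \<notin> Units B.PS" using F Y.Units_PS by blast
    then have "F 0 0 \<notin> Units K" using B.Units_PS[OF Y.coeff_closed[OF F(1)]] by blast
    moreover have "evaluation F 0 = F 0 0" using F by (simp add: evaluation_def fiber_zero)
    ultimately have "evaluation F \<notin> Units A.PS"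
      using A.Units_PS[OF evaluation_carrier[OF F(1)]] by simp
    then show "z \<in> J"
      using evaluation_carrier[OF F(1)] by (simp add: J z Units_semigroup_algebra semigroup_algebra_simps)
  qed
qed

end


section \<open>The kernel of the presentation\<close>

lemma (in abelian_group) finsum_minus:
  assumes "f \<in> I \<rightarrow> carrier G" "g \<in> I \<rightarrow> carrier G"
  shows "(\<Oplus>i\<in>I. f i \<ominus> g i) = finsum G f I \<ominus> finsum G g I"
proof -
  have "(\<Oplus>i\<in>I. (f i \<ominus> g i) \<oplus> g i) = (\<Oplus>i\<in>I. f i \<ominus> g i) \<oplus> finsum G g I"
    using assms by (intro finsum_addf) auto
  moreover have "(\<Oplus>i\<in>I. (f i \<ominus> g i) \<oplus> g i) = finsum G f I"
    using assms by (intro finsum_cong') (auto simp: minus_eq a_assoc l_neg Pi_def)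
  ultimately have "finsum G f I \<ominus> finsum G g I =
      ((\<Oplus>i\<in>I. f i \<ominus> g i) \<oplus> finsum G g I) \<ominus> finsum G g I" by simp
  also have "\<dots> = (\<Oplus>i\<in>I. f i \<ominus> g i)"
  proof -
    have "(\<Oplus>i\<in>I. f i \<ominus> g i) \<in> carrier G" "finsum G g I \<in> carrier G"
      using assms by (auto intro!: finsum_closed)
    then show ?thesis by (simp add: minus_eq a_assoc r_neg)
  qed
  finally show ?thesis by simp
qed

lemma (in ring) r_minus_distr:
  "x \<in> carrier R \<Longrightarrow> y \<in> carrier R \<Longrightarrow> z \<in> carrier R \<Longrightarrow> x \<otimes> (y \<ominus> z) = x \<otimes> y \<ominus> x \<otimes> z"
  by (simp add: minus_eq r_distr r_minus)

context rectangular_algebra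
begin

definition mono :: "'a \<Rightarrow> nat \<times> (nat \<Rightarrow>\<^sub>0 nat) \<Rightarrow> (nat \<Rightarrow>\<^sub>0 nat) \<Rightarrow> rat \<Rightarrow> 'a" where
  "mono \<kappa> p = Y.monom (snd p) (B.monom (of_nat (fst p) * s) \<kappa>)"

lemma mono_carrier:
  "\<kappa> \<in> carrier K \<Longrightarrow> snd p \<in> exponents \<Longrightarrow> mono \<kappa> p \<in> carrier Y.PS"
  unfolding mono_def by (intro Y.monom_carrier B.monom_carrier) auto

lemma mono_apply:
  "mono \<kappa> p e q = (if e = snd p \<and> q = of_nat (fst p) * s then \<kappa> else \<zero>)"
  by (simp add: mono_def Y.monom_def B.monom_def)

lemma mono_mult_mono:
  assumes "\<kappa> \<in> carrier K" "snd p \<in> exponents" "snd r \<in> exponents"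
  shows "mono \<kappa> p \<otimes>\<^bsub>Y.PS\<^esub> mono \<one> r = mono \<kappa> (fst p + fst r, snd p + snd r)"
  using assms unfolding mono_def
  by (subst Y.monom_mult_monom)
    (auto intro!: B.monom_carrier simp: B.monom_mult_monom distrib_right)

definition gen :: "nat \<Rightarrow> (nat \<Rightarrow>\<^sub>0 nat) \<Rightarrow> rat \<Rightarrow> 'a" where
  "gen j = mono \<one> (0, Poly_Mapping.single j (\<beta> j)) \<ominus>\<^bsub>Y.PS\<^esub> mono \<one> (krel j, lrel j)"

lemma lrel_exponents: "j < n \<Longrightarrow> lrel j \<in> exponents"
  using rel_normal_form(1) box_exponents by blast

lemma gen_monos:
  assumes "j < n"
  shows "mono \<one> (0, Poly_Mapping.single j (\<beta> j)) \<in> carrier Y.PS"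
    and "mono \<one> (krel j, lrel j) \<in> carrier Y.PS"
  using assms lrel_exponents by (auto intro!: mono_carrier)

lemma gen_carrier: "j < n \<Longrightarrow> gen j \<in> carrier Y.PS"
  unfolding gen_def using gen_monos by (intro Y.PS.minus_closed)

definition combination :: "(nat \<Rightarrow> (nat \<Rightarrow>\<^sub>0 nat) \<Rightarrow> rat \<Rightarrow> 'a) \<Rightarrow> (nat \<Rightarrow>\<^sub>0 nat) \<Rightarrow> rat \<Rightarrow> 'a" where
  "combination Q = (\<Oplus>\<^bsub>Y.PS\<^esub>j\<in>{..<n}. Q j \<otimes>\<^bsub>Y.PS\<^esub> gen j)"

text \<open>The ideal generated by the \<open>gen j\<close>, kept as explicit coefficient families
  because these are what is glued across degrees.\<close>

definition combinations where
  "combinations = combination ` ({..<n} \<rightarrow> carrier Y.PS)"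

lemma combination_summand: "Q \<in> {..<n} \<rightarrow> carrier Y.PS \<Longrightarrow> j < n \<Longrightarrow> Q j \<otimes>\<^bsub>Y.PS\<^esub> gen j \<in> carrier Y.PS"
  using gen_carrier by (intro Y.PS.m_closed) auto

lemma combination_carrier: "Q \<in> {..<n} \<rightarrow> carrier Y.PS \<Longrightarrow> combination Q \<in> carrier Y.PS"
  unfolding combination_def using combination_summand by (intro Y.PS.finsum_closed) auto

lemma combinations_zero: "\<zero>\<^bsub>Y.PS\<^esub> \<in> combinations"
proof -
  have "combination (\<lambda>_. \<zero>\<^bsub>Y.PS\<^esub>) = (\<Oplus>\<^bsub>Y.PS\<^esub>j\<in>{..<n}. \<zero>\<^bsub>Y.PS\<^esub>)"
    unfolding combination_def using gen_carrier by (intro Y.PS.finsum_cong') auto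
  also have "\<dots> = \<zero>\<^bsub>Y.PS\<^esub>" by (rule Y.PS.finsum_zero)
  finally have "\<zero>\<^bsub>Y.PS\<^esub> = combination (\<lambda>_. \<zero>\<^bsub>Y.PS\<^esub>)" by (rule HOL.sym)
  then show ?thesis
    unfolding combinations_def by (rule image_eqI[of _ combination "\<lambda>_. \<zero>\<^bsub>Y.PS\<^esub>"]) auto
qed

lemma combinations_add:
  assumes "F \<in> combinations" "G \<in> combinations"
  shows "F \<oplus>\<^bsub>Y.PS\<^esub> G \<in> combinations"
proof -
  obtain P Q where P: "P \<in> {..<n} \<rightarrow> carrier Y.PS" "F = combination P"
    and Q: "Q \<in> {..<n} \<rightarrow> carrier Y.PS" "G = combination Q"
    using assms unfolding combinations_def by blast
  have "combination (\<lambda>j. P j \<oplus>\<^bsub>Y.PS\<^esub> Q j) =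
      (\<Oplus>\<^bsub>Y.PS\<^esub>j\<in>{..<n}. P j \<otimes>\<^bsub>Y.PS\<^esub> gen j \<oplus>\<^bsub>Y.PS\<^esub> Q j \<otimes>\<^bsub>Y.PS\<^esub> gen j)"
    unfolding combination_def using P Q gen_carrier
    by (intro Y.PS.finsum_cong' refl) (auto simp: Pi_def intro!: Y.PS.l_distr)
  also have "\<dots> = combination P \<oplus>\<^bsub>Y.PS\<^esub> combination Q"
    unfolding combination_def using P Q combination_summand by (intro Y.PS.finsum_addf) auto
  finally have "F \<oplus>\<^bsub>Y.PS\<^esub> G = combination (\<lambda>j. P j \<oplus>\<^bsub>Y.PS\<^esub> Q j)"
    unfolding P(2) Q(2) by (rule HOL.sym)
  then show ?thesis
    unfolding combinations_def
    by (rule image_eqI[of _ combination "\<lambda>j. P j \<oplus>\<^bsub>Y.PS\<^esub> Q j"])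
      (use P Q in \<open>auto intro!: Y.PS.a_closed\<close>)
qed

lemma combinations_carrier: "F \<in> combinations \<Longrightarrow> F \<in> carrier Y.PS"
  using combination_carrier by (auto simp: combinations_def)

lemma combinations_finsum:
  assumes "finite I" "\<And>i. i \<in> I \<Longrightarrow> H i \<in> combinations"
  shows "(\<Oplus>\<^bsub>Y.PS\<^esub>i\<in>I. H i) \<in> combinations"
  using assms
proof (induction I)
  case empty
  show ?case unfolding Y.PS.finsum_empty by (rule combinations_zero)
next
  case (insert i I)
  then have "(\<Oplus>\<^bsub>Y.PS\<^esub>i\<in>insert i I. H i) = H i \<oplus>\<^bsub>Y.PS\<^esub> (\<Oplus>\<^bsub>Y.PS\<^esub>i\<in>I. H i)"
    using combinations_carrier by (intro Y.PS.finsum_insert) auto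
  then show ?case using insert combinations_add by (simp only: insertI1 insertI2)
qed

lemma mono_equiv_exponents: "mono_equiv p r \<Longrightarrow> snd p \<in> exponents \<and> snd r \<in> exponents"
  by (induction rule: mono_equiv.induct) (auto simp: lrel_exponents)

text \<open>A chain of rewriting steps telescopes, and a single step is a monomial multiple of a
  generator. The scalar stays arbitrary for the symmetric case, where it changes sign.\<close>

lemma mono_diff_combination:
  assumes "mono_equiv p r" "\<kappa> \<in> carrier K"
  shows "mono \<kappa> p \<ominus>\<^bsub>Y.PS\<^esub> mono \<kappa> r \<in> combinations"
  using assms
proof (induction arbitrary: \<kappa> rule: mono_equiv.induct)
  case (refl e k)
  then have "mono \<kappa> (k, e) \<in> carrier Y.PS" by (intro mono_carrier) auto
  then show ?case using combinations_zero Y.PS.r_neg by (simp only: Y.PS.minus_eq)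
next
  case (sym p r)
  have c: "mono \<kappa> p \<in> carrier Y.PS" "mono \<kappa> r \<in> carrier Y.PS"
    "mono (\<ominus> \<kappa>) p \<in> carrier Y.PS" "mono (\<ominus> \<kappa>) r \<in> carrier Y.PS"
    using sym.prems mono_equiv_exponents[OF sym.hyps] by (auto intro!: mono_carrier)
  have neg: "mono (\<ominus> \<kappa>) x = \<ominus>\<^bsub>Y.PS\<^esub> mono \<kappa> x" if "mono \<kappa> x \<in> carrier Y.PS" for x
    using that
    by (intro ext) (simp add: Y.a_inv_apply B.a_inv_apply Y.coeff_closed mono_apply)
  have "mono \<kappa> r \<ominus>\<^bsub>Y.PS\<^esub> mono \<kappa> p = mono (\<ominus> \<kappa>) p \<ominus>\<^bsub>Y.PS\<^esub> mono (\<ominus> \<kappa>) r"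
    using c by (simp add: neg Y.PS.minus_eq Y.PS.a_comm)
  then show ?case using sym.IH[of "\<ominus> \<kappa>"] sym.prems by simp
next
  case (trans p r u)
  have c: "mono \<kappa> p \<in> carrier Y.PS" "mono \<kappa> r \<in> carrier Y.PS" "mono \<kappa> u \<in> carrier Y.PS"
    using trans.prems mono_equiv_exponents[OF trans.hyps(1)] mono_equiv_exponents[OF trans.hyps(2)]
    by (auto intro!: mono_carrier)
  then have "mono \<kappa> p \<ominus>\<^bsub>Y.PS\<^esub> mono \<kappa> u =
      (mono \<kappa> p \<ominus>\<^bsub>Y.PS\<^esub> mono \<kappa> r) \<oplus>\<^bsub>Y.PS\<^esub> (mono \<kappa> r \<ominus>\<^bsub>Y.PS\<^esub> mono \<kappa> u)"
    by (simp add: Y.PS.minus_eq Y.PS.a_assoc Y.PS.r_neg1)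
  then show ?case using combinations_add trans.IH trans.prems by (simp only:)
next
  case (step j e k)
  let ?X = "mono \<kappa> (k, e)"
  have X: "?X \<in> carrier Y.PS" using step by (intro mono_carrier) auto
  define Q where "Q = (\<lambda>i. if i = j then ?X else \<zero>\<^bsub>Y.PS\<^esub>)"
  have Q: "Q \<in> {..<n} \<rightarrow> carrier Y.PS" using X by (auto simp: Q_def)
  have "combination Q = (\<Oplus>\<^bsub>Y.PS\<^esub>i\<in>{..<n}. if i = j then ?X \<otimes>\<^bsub>Y.PS\<^esub> gen j else \<zero>\<^bsub>Y.PS\<^esub>)"
    unfolding combination_def using X gen_carrier
    by (intro Y.PS.finsum_cong' refl) (auto simp: Q_def)
  also have "\<dots> = ?X \<otimes>\<^bsub>Y.PS\<^esub> gen j"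
    using X gen_carrier[OF step(1)] step(1) by (subst Y.PS.finsum_delta) auto
  also have "\<dots> = ?X \<otimes>\<^bsub>Y.PS\<^esub> mono \<one> (0, Poly_Mapping.single j (\<beta> j)) \<ominus>\<^bsub>Y.PS\<^esub>
      ?X \<otimes>\<^bsub>Y.PS\<^esub> mono \<one> (krel j, lrel j)"
    unfolding gen_def using X gen_monos[OF step(1)] by (intro Y.PS.r_minus_distr)
  also have "\<dots> = mono \<kappa> (k, e + Poly_Mapping.single j (\<beta> j)) \<ominus>\<^bsub>Y.PS\<^esub>
      mono \<kappa> (k + krel j, e + lrel j)"
    using step lrel_exponents by (simp add: mono_mult_mono)
  finally show ?case
    unfolding combinations_def using Q by (intro image_eqI) auto
qed

lemma Y_finsum_apply:
  assumes "\<And>i. i \<in> I \<Longrightarrow> H i \<in> carrier Y.PS"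
  shows "(\<Oplus>\<^bsub>Y.PS\<^esub>i\<in>I. H i) e q = (\<Oplus>i\<in>I. H i e q)"
  using assms by (simp add: Y.finsum_apply B.finsum_apply Y.coeff_closed)

lemma Y_minus_apply:
  assumes "F \<in> carrier Y.PS" "G \<in> carrier Y.PS"
  shows "(F \<ominus>\<^bsub>Y.PS\<^esub> G) e q = F e q \<ominus> G e q"
  using assms by (simp add: Y.minus_apply B.minus_apply Y.coeff_closed)

text \<open>The floor is exact here: it recovers \<open>k\<close> from
  \<open>q = k * s\<close>.\<close>

definition fiber_index :: "(nat \<Rightarrow>\<^sub>0 nat) \<times> rat \<Rightarrow> nat \<times> (nat \<Rightarrow>\<^sub>0 nat)" where
  "fiber_index x = (nat \<lfloor>snd x / s\<rfloor>, fst x)"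

lemma fiber_index:
  assumes "x \<in> fiber t"
  shows "of_nat (fst (fiber_index x)) * s = snd x" "snd (fiber_index x) = fst x"
proof -
  obtain k where "snd x = of_nat k * s" using assms by (auto simp: fiber_def S_def)
  then show "of_nat (fst (fiber_index x)) * s = snd x"
    using s_pos by (simp add: fiber_index_def)
  show "snd (fiber_index x) = fst x" by (simp add: fiber_index_def)
qed

text \<open>The coefficients of a kernel element over one fiber sum to zero, so its part over this fiber
  is a combination of differences of equivalent monomials.\<close>

lemma fiber_combination:
  assumes F: "F \<in> carrier Y.PS" and ker: "evaluation F t = \<zero>"
  shows "\<exists>Q\<in>{..<n} \<rightarrow> carrier Y.PS. \<forall>x\<in>fiber t. F (fst x) (snd x) = combination Q (fst x) (snd x)"
proof (cases "fiber t = {}")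
  case True
  then show ?thesis by (intro bexI[of _ "\<lambda>_. \<zero>\<^bsub>Y.PS\<^esub>"]) auto
next
  case False
  then obtain x0 where x0: "x0 \<in> fiber t" by blast
  \<comment> \<open>Every term of \<open>F\<close> over \<open>t\<close> is moved to the fixed
    monomial \<open>x0\<close>, to which all monomials of the fiber are equivalent. What accumulates
    at \<open>x0\<close> is the sum of all coefficients, which is zero by
    \<open>ker\<close>.\<close>
  define H where "H = (\<lambda>x. mono (F (fst x) (snd x)) (fiber_index x) \<ominus>\<^bsub>Y.PS\<^esub>
    mono (F (fst x) (snd x)) (fiber_index x0))"
  have exps: "snd (fiber_index x) \<in> exponents" if "x \<in> fiber t" for x
    using that fiber_index by (simp add: fiber_def)
  have mono_F: "mono (F (fst x) (snd x)) (fiber_index y) \<in> carrier Y.PS" if "y \<in> fiber t" for x y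
    using F that exps by (intro mono_carrier) auto
  have H: "H x \<in> combinations" if "x \<in> fiber t" for x
    unfolding H_def
  proof (rule mono_diff_combination)
    have "mono_equiv (fst (fiber_index x), snd (fiber_index x))
        (fst (fiber_index x0), snd (fiber_index x0))"
      using that x0 exps fiber_index[OF that] fiber_index[OF x0]
      by (intro mono_equivI) (auto simp: fiber_def)
    then show "mono_equiv (fiber_index x) (fiber_index x0)" by simp
  qed (use F in simp)
  then have "(\<Oplus>\<^bsub>Y.PS\<^esub>x\<in>fiber t. H x) \<in> combinations"
    by (intro combinations_finsum) auto
  then obtain Q where Q: "Q \<in> {..<n} \<rightarrow> carrier Y.PS" "(\<Oplus>\<^bsub>Y.PS\<^esub>x\<in>fiber t. H x) = combination Q"
    unfolding combinations_def by blast
  have "F (fst y) (snd y) = combination Q (fst y) (snd y)" if y: "y \<in> fiber t" for y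
  proof -
    have val: "mono \<kappa> (fiber_index x) (fst y) (snd y) = (if x = y then \<kappa> else \<zero>)"
      if "x \<in> fiber t" for x \<kappa>
      unfolding mono_apply fiber_index[OF that] by (auto simp: prod_eq_iff)
    have "combination Q (fst y) (snd y) = (\<Oplus>x\<in>fiber t. H x (fst y) (snd y))"
      unfolding Q(2)[symmetric] using H combinations_carrier by (intro Y_finsum_apply) auto
    also have "\<dots> = (\<Oplus>x\<in>fiber t. (if x = y then F (fst y) (snd y) else \<zero>) \<ominus>
        (if x0 = y then F (fst x) (snd x) else \<zero>))"
      using F mono_F x0 by (intro finsum_cong' refl) (auto simp: H_def Y_minus_apply val)
    also have "\<dots> = (\<Oplus>x\<in>fiber t. if x = y then F (fst y) (snd y) else \<zero>) \<ominus>
        (\<Oplus>x\<in>fiber t. if x0 = y then F (fst x) (snd x) else \<zero>)"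
      using F by (intro finsum_minus) auto
    also have "(\<Oplus>x\<in>fiber t. if x = y then F (fst y) (snd y) else \<zero>) = F (fst y) (snd y)"
      using F y by (subst finsum_delta) auto
    also have "(\<Oplus>x\<in>fiber t. if x0 = y then F (fst x) (snd x) else \<zero>) = \<zero>"
      using ker by (cases "x0 = y") (simp_all add: evaluation_def)
    finally show ?thesis using F by (simp add: minus_eq)
  qed
  then show ?thesis using Q(1) by blast
qed

text \<open>Multiplication by a monomial raises the degree by a fixed amount, so a coefficient of
  the product sees \<open>Q\<close> in a single degree only.\<close>

lemma mult_mono_local:
  assumes Q: "Q \<in> carrier Y.PS" "Q' \<in> carrier Y.PS" and p: "snd p \<in> exponents"
    and eq: "\<And>e' q'. q' \<in> S \<Longrightarrow>
      (q' + weight e') + (of_nat (fst p) * s + weight (snd p)) = q + weight e \<Longrightarrow> Q e' q' = Q' e' q'"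
  shows "(Q \<otimes>\<^bsub>Y.PS\<^esub> mono \<one> p) e q = (Q' \<otimes>\<^bsub>Y.PS\<^esub> mono \<one> p) e q"
proof (cases "\<exists>e'\<in>exponents. e = e' + snd p")
  case True
  then obtain e' where e': "e = e' + snd p" by blast
  have m: "B.monom (of_nat (fst p) * s) \<one> \<in> carrier B.PS" by (intro B.monom_carrier) auto
  have val: "(Q \<otimes>\<^bsub>Y.PS\<^esub> mono \<one> p) e = Q e' \<otimes>\<^bsub>B.PS\<^esub> B.monom (of_nat (fst p) * s) \<one>"
    if "Q \<in> carrier Y.PS" for Q
    unfolding e' mono_def using that p m by (intro Y.mult_monom_apply_add)
  show ?thesis
  proof (cases "\<exists>q'\<in>S. q = q' + of_nat (fst p) * s")
    case True
    then obtain q' where q': "q' \<in> S" "q = q' + of_nat (fst p) * s" by blast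
    have "Q e' q' = Q' e' q'" using q' by (intro eq) (auto simp: e' weight_add)
    then show ?thesis
      unfolding val[OF Q(1)] val[OF Q(2)] q'(2)
      using Q by (simp add: B.mult_monom_apply_add Y.coeff_closed)
  next
    case False
    then show ?thesis
      unfolding val[OF Q(1)] val[OF Q(2)]
      using Q by (simp add: B.mult_monom_apply_notin Y.coeff_closed)
  qed
next
  case False
  have m: "B.monom (of_nat (fst p) * s) \<one> \<in> carrier B.PS" by (intro B.monom_carrier) auto
  have "(Q \<otimes>\<^bsub>Y.PS\<^esub> mono \<one> p) e = \<zero>\<^bsub>B.PS\<^esub>" if "Q \<in> carrier Y.PS" for Q
    unfolding mono_def using that p m False by (intro Y.mult_monom_apply_notin) auto
  then show ?thesis using Q by simp
qed

text \<open>Both monomials of \<open>gen j\<close> have degree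
  \<open>\<beta> j * \<sigma> j\<close>, so they see \<open>Q\<close> in the same degree.\<close>

lemma mult_gen_local:
  assumes j: "j < n" and Q: "Q \<in> carrier Y.PS" "Q' \<in> carrier Y.PS"
    and eq: "\<And>e' q'. q' \<in> S \<Longrightarrow>
      (q' + weight e') + of_nat (\<beta> j) * \<sigma> j = q + weight e \<Longrightarrow> Q e' q' = Q' e' q'"
  shows "(Q \<otimes>\<^bsub>Y.PS\<^esub> gen j) e q = (Q' \<otimes>\<^bsub>Y.PS\<^esub> gen j) e q"
proof -
  have val: "(Q \<otimes>\<^bsub>Y.PS\<^esub> gen j) e q = (Q \<otimes>\<^bsub>Y.PS\<^esub> mono \<one> (0, Poly_Mapping.single j (\<beta> j))) e q \<ominus>
      (Q \<otimes>\<^bsub>Y.PS\<^esub> mono \<one> (krel j, lrel j)) e q" if "Q \<in> carrier Y.PS" for Q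
    unfolding gen_def Y.PS.r_minus_distr[OF that gen_monos[OF j]]
    using that gen_monos[OF j] by (intro Y_minus_apply Y.PS.m_closed)
  have "(Q \<otimes>\<^bsub>Y.PS\<^esub> mono \<one> (0, Poly_Mapping.single j (\<beta> j))) e q =
      (Q' \<otimes>\<^bsub>Y.PS\<^esub> mono \<one> (0, Poly_Mapping.single j (\<beta> j))) e q"
    using Q j by (intro mult_mono_local) (auto simp: weight_single intro: eq)
  moreover have "(Q \<otimes>\<^bsub>Y.PS\<^esub> mono \<one> (krel j, lrel j)) e q = (Q' \<otimes>\<^bsub>Y.PS\<^esub> mono \<one> (krel j, lrel j)) e q"
    using Q j lrel_exponents
    by (intro mult_mono_local) (auto simp flip: rel_normal_form(2) intro: eq)
  ultimately show ?thesis by (simp add: val Q)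
qed

text \<open>\<open>fiber_combination\<close> gives coefficients that are right in one degree only,
  chosen anew for each of infinitely many degrees. Homogeneity of the generators allows them to be
  merged into one family.\<close>

lemma kernel_combination:
  assumes F: "F \<in> carrier Y.PS" and ker: "evaluation F = \<zero>\<^bsub>A.PS\<^esub>"
  shows "F \<in> combinations"
proof -
  have "\<forall>t. \<exists>Q\<in>{..<n} \<rightarrow> carrier Y.PS. \<forall>x\<in>fiber t. F (fst x) (snd x) = combination Q (fst x) (snd x)"
    using fiber_combination[OF F] ker by simp
  then obtain Q where Q: "\<And>t. Q t \<in> {..<n} \<rightarrow> carrier Y.PS"
    and FQ: "\<And>t x. x \<in> fiber t \<Longrightarrow> F (fst x) (snd x) = combination (Q t) (fst x) (snd x)"
    by metis
  have Qc: "Q t j \<in> carrier Y.PS" if "j < n" for t j using Q that by blast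
  \<comment> \<open>In the factor of \<open>gen j\<close>, the place \<open>(e, q)\<close>
    contributes only to degree \<open>q + weight e + \<beta> j * \<sigma> j\<close>, so it is filled
    from the family chosen for that degree.\<close>
  define P where "P = (\<lambda>j e q. Q (q + weight e + of_nat (\<beta> j) * \<sigma> j) j e q)"
  have P: "P j \<in> carrier Y.PS" if "j < n" for j
    using Qc[OF that] Y_coeff_notin Y_coeff_notin_exponents
    by (intro Y_mem_carrier) (auto simp: P_def)
  then have P': "P \<in> {..<n} \<rightarrow> carrier Y.PS" by auto
  have "F e q = combination P e q" for e q
  proof (cases "e \<in> exponents \<and> q \<in> S")
    case True
    let ?t = "q + weight e"
    have "F e q = combination (Q ?t) e q"
      using FQ[of "(e, q)" ?t] True by (simp add: fiber_def)
    also have "\<dots> = (\<Oplus>j\<in>{..<n}. (Q ?t j \<otimes>\<^bsub>Y.PS\<^esub> gen j) e q)"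
      unfolding combination_def using combination_summand[OF Q] by (intro Y_finsum_apply) auto
    also have "\<dots> = (\<Oplus>j\<in>{..<n}. (P j \<otimes>\<^bsub>Y.PS\<^esub> gen j) e q)"
    proof (rule finsum_cong'[OF HOL.refl])
      show "(\<lambda>j. (P j \<otimes>\<^bsub>Y.PS\<^esub> gen j) e q) \<in> {..<n} \<rightarrow> carrier K"
        using combination_summand[OF P'] by (auto intro: Y_coeff_closed)
      fix j assume "j \<in> {..<n}"
      then show "(Q ?t j \<otimes>\<^bsub>Y.PS\<^esub> gen j) e q = (P j \<otimes>\<^bsub>Y.PS\<^esub> gen j) e q"
        using Qc P by (intro mult_gen_local) (auto simp: P_def)
    qed
    also have "\<dots> = combination P e q"
      unfolding combination_def using combination_summand[OF P']
      by (intro Y_finsum_apply[symmetric]) auto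
    finally show ?thesis .
  next
    case False
    then show ?thesis
      using F combination_carrier[OF P'] by (auto simp: Y_coeff_notin Y_coeff_notin_exponents)
  qed
  then have "F = combination P" by (intro ext)
  then show ?thesis unfolding combinations_def using P' by blast
qed

lemma evaluation_mono: "snd p \<in> exponents \<Longrightarrow>
    evaluation (mono \<one> p) = A.monom (of_nat (fst p) * s + weight (snd p)) \<one>"
  unfolding mono_def fun_eq_iff
  by (subst evaluation_monom) (auto simp: B.monom_carrier B.monom_def A.monom_def)

lemma evaluation_gen:
  assumes "j < n"
  shows "evaluation (gen j) = \<zero>\<^bsub>A.PS\<^esub>"
proof -
  let ?M = "mono \<one> (0, Poly_Mapping.single j (\<beta> j))" and ?N = "mono \<one> (krel j, lrel j)"
  note c = gen_monos[OF assms] gen_carrier[OF assms]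
  have "gen j \<oplus>\<^bsub>Y.PS\<^esub> ?N = ?M"
    unfolding gen_def using c by (simp add: Y.PS.minus_eq Y.PS.a_assoc Y.PS.l_neg)
  then have "evaluation ?M = evaluation (gen j) \<oplus>\<^bsub>A.PS\<^esub> evaluation ?N"
    using evaluation_add[OF c(3,2)] by simp
  moreover have "evaluation ?M = evaluation ?N"
    using assms lrel_exponents by (simp add: evaluation_mono weight_single rel_normal_form(2))
  ultimately show ?thesis
    using A.PS.add.r_cancel_one[of "evaluation ?N" "evaluation (gen j)"] evaluation_carrier c by simp
qed

lemma evaluation_kernel: "a_kernel Y.PS R' evaluation = Idl\<^bsub>Y.PS\<^esub> (gen ` {..<n})"
proof
  have gens: "gen ` {..<n} \<subseteq> carrier Y.PS" using gen_carrier by auto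
  have kernel: "a_kernel Y.PS R' evaluation = {F \<in> carrier Y.PS. evaluation F = \<zero>\<^bsub>A.PS\<^esub>}"
    unfolding a_kernel_def' semigroup_algebra_simps ..
  have ideal: "ideal (a_kernel Y.PS R' evaluation) Y.PS"
    by (rule ring_hom_ring.kernel_is_ideal[OF ring_hom_ringI2[OF Y.PS.ring_axioms
      cring.axioms(1)[OF semigroup_algebra_cring] evaluation_ring_hom]])
  show "Idl\<^bsub>Y.PS\<^esub> (gen ` {..<n}) \<subseteq> a_kernel Y.PS R' evaluation"
    using evaluation_gen gen_carrier
    by (intro Y.PS.genideal_minimal[OF ideal]) (auto simp: kernel)
  interpret idl: ideal "Idl\<^bsub>Y.PS\<^esub> (gen ` {..<n})" Y.PS
    by (rule Y.PS.genideal_ideal[OF gens])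
  have gen_idl: "gen j \<in> Idl\<^bsub>Y.PS\<^esub> (gen ` {..<n})" if "j < n" for j
    using Y.PS.genideal_self[OF gens] that by auto
  show "a_kernel Y.PS R' evaluation \<subseteq> Idl\<^bsub>Y.PS\<^esub> (gen ` {..<n})"
  proof
    fix F assume "F \<in> a_kernel Y.PS R' evaluation"
    then have "F \<in> combinations" unfolding kernel using kernel_combination by blast
    then obtain Q where Q: "Q \<in> {..<n} \<rightarrow> carrier Y.PS" "F = combination Q"
      unfolding combinations_def by blast
    have "(\<Oplus>\<^bsub>Y.PS\<^esub>j\<in>J. Q j \<otimes>\<^bsub>Y.PS\<^esub> gen j) \<in> Idl\<^bsub>Y.PS\<^esub> (gen ` {..<n})"
      if "finite J" "J \<subseteq> {..<n}" for J
      using that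
    proof (induction J)
      case empty
      show ?case unfolding Y.PS.finsum_empty by (rule idl.zero_closed)
    next
      case (insert j J)
      then have "(\<Oplus>\<^bsub>Y.PS\<^esub>j\<in>insert j J. Q j \<otimes>\<^bsub>Y.PS\<^esub> gen j) =
          Q j \<otimes>\<^bsub>Y.PS\<^esub> gen j \<oplus>\<^bsub>Y.PS\<^esub> (\<Oplus>\<^bsub>Y.PS\<^esub>j\<in>J. Q j \<otimes>\<^bsub>Y.PS\<^esub> gen j)"
        using combination_summand[OF Q(1)] by (intro Y.PS.finsum_insert) auto
      moreover have "Q j \<otimes>\<^bsub>Y.PS\<^esub> gen j \<in> Idl\<^bsub>Y.PS\<^esub> (gen ` {..<n})"
        using Q(1) insert.prems gen_idl by (intro idl.I_l_closed) auto
      ultimately show ?case using insert idl.a_closed by (simp only: insert_subset)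
    qed
    then show "F \<in> Idl\<^bsub>Y.PS\<^esub> (gen ` {..<n})" by (simp add: Q(2) combination_def)
  qed
qed

theorem complete_intersection_semigroup_algebra: "complete_intersection TN TP B.PS R'"
  unfolding complete_intersection_def
proof (intro conjI exI[of _ n] exI[of _ evaluation] exI[of _ gen])
  have Y: "multi_power_series B.PS n = Y.PS"
    by (simp add: multi_power_series_def exponents_def)
  show "flat_module TN TP B.PS R'" by (rule semigroup_algebra_flat)
  show "local_ring_hom (multi_power_series B.PS n) R' evaluation"
    unfolding Y by (rule evaluation_local_ring_hom)
  show "evaluation \<in> linear_maps B.PS (multi_power_series B.PS n) R'"
    unfolding Y by (rule evaluation_linear)
  show "evaluation ` carrier (multi_power_series B.PS n) = carrier R'"
    unfolding Y by (rule evaluation_surj)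
  show "\<forall>i<n. gen i \<in> carrier (multi_power_series B.PS n)"
    unfolding Y using gen_carrier by blast
  show "a_kernel (multi_power_series B.PS n) R' evaluation =
      Idl\<^bsub>multi_power_series B.PS n\<^esub> (gen ` {..<n})"
    unfolding Y by (rule evaluation_kernel)
qed

end


section \<open>Numerical semigroups\<close>

lemma monoid_span_add:
  "x \<in> monoid_span G \<Longrightarrow> y \<in> monoid_span G \<Longrightarrow> x + y \<in> monoid_span G"
  by (induction rule: monoid_span.induct) (auto intro: monoid_span.add simp: add.assoc)

lemma monoid_span_singleton: "monoid_span {s :: rat} = range (\<lambda>k::nat. of_nat k * s)"
proof (intro equalityI subsetI)
  fix x assume "x \<in> monoid_span {s}"
  then show "x \<in> range (\<lambda>k::nat. of_nat k * s)"
  proof (induction rule: monoid_span.induct)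
    case zero
    show ?case by (rule range_eqI[of _ _ 0]) simp
  next
    case (add g x)
    then obtain k :: nat where "x = of_nat k * s" by blast
    then show ?case using add by (intro range_eqI[of _ _ "Suc k"]) (simp add: distrib_right)
  qed
next
  fix x assume "x \<in> range (\<lambda>k::nat. of_nat k * s)"
  then obtain k :: nat where x: "x = of_nat k * s" by blast
  have "of_nat k * s \<in> monoid_span {s}"
    by (induction k) (auto simp: distrib_right intro: monoid_span.intros)
  then show "x \<in> monoid_span {s}" by (simp add: x)
qed

text \<open>Finitely many generators have a common denominator, which their sums keep. The semigroup
  thus lies in a discrete set of nonnegative rationals, the source of the finiteness of
  decompositions.\<close>

lemma numerical_semigroup_denominator:
  assumes "numerical_semigroup S"
  shows "\<exists>d>0. S \<subseteq> range (\<lambda>k::nat. of_nat k / rat_of_nat d)"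
proof -
  obtain G where G: "finite G" "\<forall>g\<in>G. 0 < g" and S: "S = monoid_span G"
    using assms unfolding numerical_semigroup_def by blast
  have "\<exists>d>0. \<forall>g\<in>G. \<exists>k::nat. g = of_nat k / rat_of_nat d"
    using G
  proof (induction G)
    case empty
    show ?case by (intro exI[of _ 1]) simp
  next
    case (insert g G)
    then obtain d where d: "d > 0" "\<forall>g\<in>G. \<exists>k::nat. g = of_nat k / rat_of_nat d" by auto
    obtain p q where g: "g = of_int p / of_int q" "q > 0"
      using quotient_of_div[of g] quotient_of_denom_pos[of g] by (cases "quotient_of g") auto
    have "p > 0" using insert.prems g by (simp add: zero_less_divide_iff)
    then have "g = of_nat (nat p) / of_nat (nat q)" using g by simp
    then have "g = of_nat (nat p * d) / of_nat (d * nat q)" using d by simp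
    moreover have "\<exists>k::nat. x = of_nat k / rat_of_nat (d * nat q)" if x: "x \<in> G" for x
    proof -
      obtain k :: nat where "x = of_nat k / rat_of_nat d" using bspec[OF d(2) x] ..
      then have "x = of_nat (k * nat q) / rat_of_nat (d * nat q)" using g by simp
      then show ?thesis by blast
    qed
    ultimately have "\<forall>x\<in>insert g G. \<exists>k::nat. x = of_nat k / rat_of_nat (d * nat q)" by blast
    moreover have "d * nat q > 0" using d g by simp
    ultimately show ?case by blast
  qed
  then obtain d where d: "d > 0" "\<forall>g\<in>G. \<exists>k::nat. g = of_nat k / rat_of_nat d" by blast
  have "x \<in> range (\<lambda>k::nat. of_nat k / rat_of_nat d)" if "x \<in> monoid_span G" for x
    using that
  proof (induction rule: monoid_span.induct)
    case zero
    show ?case by (rule range_eqI[of _ _ 0]) simp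
  next
    case (add g x)
    obtain k :: nat where "g = of_nat k / rat_of_nat d" using bspec[OF d(2) add.hyps(1)] ..
    moreover obtain m where "x = of_nat m / rat_of_nat d" using add.IH by (rule rangeE)
    ultimately show ?case by (intro range_eqI[of _ _ "k + m"]) (simp add: add_divide_distrib)
  qed
  then have "S \<subseteq> range (\<lambda>k::nat. of_nat k / rat_of_nat d)" unfolding S by (rule subsetI)
  with d(1) show ?thesis by (intro exI conjI)
qed

lemma numerical_semigroup_nonneg: "numerical_semigroup S \<Longrightarrow> x \<in> S \<Longrightarrow> 0 \<le> x"
  using numerical_semigroup_denominator[of S] by force

lemma numerical_semigroup_exponents:
  assumes "numerical_semigroup S"
  shows "power_series_exponents S"
proof
  obtain G where S: "S = monoid_span G"
    using assms unfolding numerical_semigroup_def by blast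
  show "0 \<in> S" unfolding S by (rule monoid_span.zero)
  show "a + b \<in> S" if "a \<in> S" "b \<in> S" for a b
    using that unfolding S by (rule monoid_span_add)
  show "a = 0" if "a \<in> S" "b \<in> S" "a + b = 0" for a b
    using that numerical_semigroup_nonneg[OF assms] by (meson add_nonneg_eq_0_iff)
  obtain d where d: "d > 0" "S \<subseteq> range (\<lambda>k::nat. of_nat k / rat_of_nat d)"
    using numerical_semigroup_denominator[OF assms] by blast
  show "finite {p \<in> S \<times> S. fst p + snd p = a}" for a
  proof -
    \<comment> \<open>Over the denominator \<open>d\<close> the numerators of the two summands add
      up to \<open>a * d\<close>, which bounds both.\<close>
    let ?N = "nat \<lfloor>a * of_nat d\<rfloor>"
    let ?f = "\<lambda>k::nat. of_nat k / rat_of_nat d"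
    have "{p \<in> S \<times> S. fst p + snd p = a} \<subseteq> (\<lambda>k. (?f (fst k), ?f (snd k))) ` ({..?N} \<times> {..?N})"
    proof
      fix p assume p: "p \<in> {p \<in> S \<times> S. fst p + snd p = a}"
      then obtain k m :: nat where km: "fst p = ?f k" "snd p = ?f m"
        using d(2) by fastforce
      then have "a * of_nat d = of_nat (k + m)" using p d(1) by (auto simp: field_simps)
      then have "?N = k + m" by (simp only: floor_of_nat nat_int)
      then show "p \<in> (\<lambda>k. (?f (fst k), ?f (snd k))) ` ({..?N} \<times> {..?N})"
        using km by (intro image_eqI[of _ _ "(k, m)"]) (auto simp: prod_eq_iff)
    qed
    then show ?thesis by (rule finite_subset) simp
  qed
qed

section \<open>Monomials and Apery monomials in terms of exponents\<close>

lemma (in power_series_ring) ps_monom_mult: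
  "a \<in> A \<Longrightarrow> b \<in> A \<Longrightarrow> ps_monom R a \<otimes>\<^bsub>PS\<^esub> ps_monom R b = ps_monom R (a + b)"
  by (simp add: ps_monom_eq monom_mult_monom)

lemma (in power_series_ring) ps_monom_carrier: "a \<in> A \<Longrightarrow> ps_monom R a \<in> carrier PS"
  by (simp add: ps_monom_eq monom_carrier)

lemma (in power_series_ring) ps_monom_zero: "ps_monom R 0 = \<one>\<^bsub>PS\<^esub>"
  by (simp add: ps_monom_eq one_eq_monom)

lemma (in field) ps_monom_eq_iff: "ps_monom R a = ps_monom R b \<longleftrightarrow> a = b"
proof
  assume "ps_monom R a = ps_monom R b"
  then have "ps_monom R a a = ps_monom R b a" by simp
  then show "a = b" by (simp add: ps_monom_def split: if_splits)
qed simp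

text \<open>The iterated addition stands for the multiple of \<open>c i\<close> by
  \<open>l i\<close>, as the exponent type need not have a multiplication;
  \<open>funpow_plus_rat\<close> translates it for rationals.\<close>

lemma (in power_series_ring) ps_monom_prod:
  fixes c :: "'i \<Rightarrow> 'e" and l :: "'i \<Rightarrow> nat"
  assumes "finite I" "\<And>i. i \<in> I \<Longrightarrow> c i \<in> A"
  shows "(\<Otimes>\<^bsub>PS\<^esub>i\<in>I. ps_monom R (c i) [^]\<^bsub>PS\<^esub> l i) = ps_monom R (\<Sum>i\<in>I. ((+) (c i) ^^ l i) 0)"
    and "(\<Sum>i\<in>I. ((+) (c i) ^^ l i) 0) \<in> A"
proof -
  have mem: "((+) a ^^ k) 0 \<in> A" if "a \<in> A" for a k
    using that by (induction k) (auto intro: add_mem)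
  have pow: "ps_monom R a [^]\<^bsub>PS\<^esub> k = ps_monom R (((+) a ^^ k) 0)" if "a \<in> A" for a and k :: nat
    using that mem by (induction k) (auto simp: ps_monom_zero ps_monom_mult add.commute)
  have "(\<Otimes>\<^bsub>PS\<^esub>i\<in>I. ps_monom R (c i) [^]\<^bsub>PS\<^esub> l i) = ps_monom R (\<Sum>i\<in>I. ((+) (c i) ^^ l i) 0) \<and>
    (\<Sum>i\<in>I. ((+) (c i) ^^ l i) 0) \<in> A"
    using assms
  proof (induction I)
    case empty
    then show ?case by (simp add: ps_monom_zero)
  next
    case (insert i I)
    then have "(\<Otimes>\<^bsub>PS\<^esub>i\<in>insert i I. ps_monom R (c i) [^]\<^bsub>PS\<^esub> l i) =
        ps_monom R (c i) [^]\<^bsub>PS\<^esub> l i \<otimes>\<^bsub>PS\<^esub> (\<Otimes>\<^bsub>PS\<^esub>i\<in>I. ps_monom R (c i) [^]\<^bsub>PS\<^esub> l i)"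
      by (intro PS.finprod_insert) (auto intro!: PS.nat_pow_closed ps_monom_carrier)
    then show ?case
      using insert mem by (auto simp: pow ps_monom_mult intro: add_mem)
  qed
  then show "(\<Otimes>\<^bsub>PS\<^esub>i\<in>I. ps_monom R (c i) [^]\<^bsub>PS\<^esub> l i) = ps_monom R (\<Sum>i\<in>I. ((+) (c i) ^^ l i) 0)"
    and "(\<Sum>i\<in>I. ((+) (c i) ^^ l i) 0) \<in> A" by auto
qed

lemma funpow_plus_rat: "((+) a ^^ k) 0 = of_nat k * (a :: rat)"
  by (induction k) (auto simp: distrib_right)

text \<open>For a principal \<open>S\<close>, a monomial with a factor from R other than 1 already
  has the factor \<open>u^s\<close>, so one subtraction tests the Apery property.\<close>

lemma apery_monomials_principal:
  fixes K (structure)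
  assumes "field K" and S': "power_series_exponents S'" and s: "0 < s" "s \<in> S'"
    and S: "S = range (\<lambda>k::nat. of_nat k * s)"
  shows "apery_monomials K S S' = ps_monom K ` {t \<in> S'. t - s \<notin> S'}"
proof -
  interpret field K by fact
  interpret A: power_series_ring K S'
    using S' by (intro power_series_ring.intro cring_axioms)
  have mult: "of_nat k * s \<in> S'" for k
    using s(2) by (induction k) (auto simp: distrib_right intro: A.add_mem)
  show ?thesis
  proof (intro equalityI subsetI)
    fix p assume p: "p \<in> apery_monomials K S S'"
    then obtain t where t: "t \<in> S'" "p = ps_monom K t"
      unfolding apery_monomials_def monomials_def by blast
    have "t - s \<notin> S'"
    proof
      assume ts: "t - s \<in> S'"
      then have "p = ps_monom K s \<otimes>\<^bsub>power_series K S'\<^esub> ps_monom K (t - s)"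
        using t s by (simp add: A.ps_monom_mult)
      moreover have "s \<in> S" unfolding S by (rule range_eqI[of _ _ 1]) simp
      ultimately have "ps_monom K s = \<one>\<^bsub>power_series K S'\<^esub>"
        using p ts unfolding apery_monomials_def monomials_def by blast
      then show False using s by (simp add: ps_monom_eq_iff flip: A.ps_monom_zero)
    qed
    then show "p \<in> ps_monom K ` {t \<in> S'. t - s \<notin> S'}" using t by blast
  next
    fix p assume "p \<in> ps_monom K ` {t \<in> S'. t - s \<notin> S'}"
    then obtain t where t: "t \<in> S'" "t - s \<notin> S'" "p = ps_monom K t" by blast
    have "p1 = \<one>\<^bsub>power_series K S'\<^esub>"
      if p12: "p1 \<in> monomials K S" "p2 \<in> monomials K S'" "p = p1 \<otimes>\<^bsub>power_series K S'\<^esub> p2" for p1 p2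
    proof -
      obtain k where k: "p1 = ps_monom K (of_nat k * s)"
        using p12 by (auto simp: monomials_def S)
      obtain t' where t': "t' \<in> S'" "p2 = ps_monom K t'"
        using p12 by (auto simp: monomials_def)
      have eq: "t = of_nat k * s + t'"
        using p12 t(3) mult t' by (simp add: k A.ps_monom_mult ps_monom_eq_iff)
      have "k = 0"
      proof (cases k)
        case (Suc m)
        then have "t - s = of_nat m * s + t'" by (simp add: eq distrib_right)
        then show ?thesis using t(2) A.add_mem[OF mult t'(1), of m] by simp
      qed
      then show ?thesis by (simp add: k A.ps_monom_zero)
    qed
    then show "p \<in> apery_monomials K S S'"
      unfolding apery_monomials_def using t by (auto simp: monomials_def)
  qed
qed

text \<open>Since \<open>ps_monom K\<close> is injective, unique factorization of Apery monomials
  becomes bijectivity of the weight on the box. Positivity of \<open>\<sigma> i\<close> comes from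
  minimal monomials being different from 1.\<close>

lemma rectangular_algebra_of_rectangle:
  fixes K (structure)
  assumes "field K" and S': "numerical_semigroup S'" and s: "0 < s" "s \<in> S'"
    and S: "S = range (\<lambda>k::nat. of_nat k * s)"
    and rect: "apery_rectangle K S S' n \<sigma> \<beta>"
  shows "rectangular_algebra K S' s n \<sigma> \<beta>"
proof -
  interpret field K by fact
  interpret A: power_series_ring K S'
    by (intro power_series_ring.intro cring_axioms numerical_semigroup_exponents S')
  let ?W = "{t \<in> S'. t - s \<notin> S'}"
  let ?L = "\<Pi>\<^sub>E i\<in>{..<n}. {..<\<beta> i}"
  let ?w = "\<lambda>l. \<Sum>i<n. of_nat (l i) * \<sigma> i"
  have apery: "apery_monomials K S S' = ps_monom K ` ?W"
    by (rule apery_monomials_principal[OF field_axioms A.power_series_exponents_axioms s S])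
  have \<beta>: "\<And>i. i < n \<Longrightarrow> 0 < \<beta> i"
    and minimal: "(\<lambda>i. ps_monom K (\<sigma> i)) ` {..<n} = minimal_monomials K S S'"
    and unique: "\<And>p. p \<in> apery_monomials K S S' \<Longrightarrow> \<exists>!l. l \<in> ?L \<and>
        p = (\<Otimes>\<^bsub>A.PS\<^esub>i\<in>{..<n}. ps_monom K (\<sigma> i) [^]\<^bsub>A.PS\<^esub> l i)"
    and box: "\<And>l. l \<in> ?L \<Longrightarrow>
        (\<Otimes>\<^bsub>A.PS\<^esub>i\<in>{..<n}. ps_monom K (\<sigma> i) [^]\<^bsub>A.PS\<^esub> l i) \<in> apery_monomials K S S'"
    using rect unfolding apery_rectangle_def by blast+
  have \<sigma>: "\<sigma> i \<in> S'" "\<sigma> i \<noteq> 0" if "i < n" for i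
  proof -
    have m: "ps_monom K (\<sigma> i) \<in> minimal_monomials K S S'"
      using minimal that by blast
    then have "ps_monom K (\<sigma> i) \<in> ps_monom K ` ?W"
      unfolding minimal_monomials_def using apery by blast
    then show "\<sigma> i \<in> S'" by (auto simp: ps_monom_eq_iff)
    show "\<sigma> i \<noteq> 0"
      using m by (auto simp: minimal_monomials_def A.ps_monom_zero)
  qed
  have prod: "(\<Otimes>\<^bsub>A.PS\<^esub>i\<in>{..<n}. ps_monom K (\<sigma> i) [^]\<^bsub>A.PS\<^esub> l i) = ps_monom K (?w l)" for l
    using A.ps_monom_prod(1)[of "{..<n}" \<sigma> l] \<sigma> by (simp add: funpow_plus_rat)
  have "bij_betw ?w ?L ?W"
  proof (rule bij_betw_imageI)
    have into: "?w l \<in> ?W" if "l \<in> ?L" for l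
    proof -
      have "ps_monom K (?w l) \<in> ps_monom K ` ?W"
        using box[OF that] unfolding prod apery .
      then show ?thesis by (auto simp: ps_monom_eq_iff)
    qed
    show "inj_on ?w ?L"
    proof (rule inj_onI)
      fix l l' assume l: "l \<in> ?L" "l' \<in> ?L" "?w l = ?w l'"
      have "ps_monom K (?w l) \<in> apery_monomials K S S'"
        using into[OF l(1)] unfolding apery by (rule imageI)
      from unique[OF this] show "l = l'"
        unfolding prod using l by metis
    qed
    show "?w ` ?L = ?W"
    proof (intro equalityI subsetI)
      fix t assume "t \<in> ?W"
      then have "ps_monom K t \<in> apery_monomials K S S'"
        unfolding apery by (rule imageI)
      from unique[OF this] obtain l where "l \<in> ?L" "ps_monom K t = ps_monom K (?w l)"
        unfolding prod by blast
      then show "t \<in> ?w ` ?L" by (auto simp: ps_monom_eq_iff)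
    qed (use into in auto)
  qed
  moreover have "0 < \<sigma> i" if "i < n" for i
    using \<sigma>[OF that] numerical_semigroup_nonneg[OF S'] by force
  ultimately have "apery_box S' s n \<sigma> \<beta>"
    using s \<beta> \<sigma> numerical_semigroup_nonneg[OF S']
    by (intro apery_box.intro) (auto intro: A.add_mem)
  then show ?thesis
    by (intro rectangular_algebra.intro field_axioms A.power_series_ring_axioms)
qed

theorem theorem5p5:
  fixes K :: "('k, 'b) ring_scheme"
    and S S' :: "rat set"
    and s s1 s2 s3 s4 :: rat
  assumes "field K"
    and "numerical_semigroup S"
    and "numerical_semigroup S'"
    and "S \<subseteq> S'"
    and "rectangular K S S'"
    and "card {s1, s2, s3, s4} = 4"
    and "minimal_monomials K S S' = ps_monom K ` {s1, s2, s3, s4}"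
    and "0 < s"
    and "S = monoid_span {s}"
    and "s \<in> monoid_span {s1, s2, s3, s4}"
  shows "complete_intersection TYPE('n) TYPE('p) (power_series K S) (semigroup_algebra K S')"
proof -
  have S: "S = range (\<lambda>k::nat. of_nat k * s)"
    using assms(9) by (simp add: monoid_span_singleton)
  have "s \<in> S" unfolding S by (rule range_eqI[of _ _ 1]) simp
  then have s: "s \<in> S'" using assms(4) by blast
  obtain n \<sigma> \<beta> where "apery_rectangle K S S' n \<sigma> \<beta>"
    using assms(5) unfolding rectangular_def by blast
  then interpret rectangular_algebra K S' s n \<sigma> \<beta>
    by (rule rectangular_algebra_of_rectangle[OF assms(1,3,8) s S])
  show ?thesis
    using complete_intersection_semigroup_algebra unfolding S_def S .
qed

end
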